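(* Let $\ell\geq1$. The spectrum of the Laplacian operator on $\mathrm{SU}(\ell+1)$, endowed with the bi-invariant Riemannian metric $g=-\gamma\kappa$ with $\gamma>0$, is $$\mathrm{Spec}(\mathrm{SU}(\ell+1))=\{\lambda_\nu:\nu=(\nu_1,\dots,\nu_\ell)\in\mathbb N^\ell\},$$ where $$\lambda_\nu=\frac{1}{2(\ell+1)^3\gamma}\left[\left(\sum_{j=1}^\ell(\ell+1-j)\nu_j\right)^2+\sum_{k=2}^\ell\left(-\sum_{j=1}^{k-1}j\nu_j+\sum_{j=k}^\ell(\ell+1-j)\nu_j\right)^2+\left(\sum_{j=1}^\ell j\nu_j\right)^2-\frac14\sum_{k=1}^{\ell+1}(\ell-2(k-1))^2(\ell+1)^2\right].$$
   Context: $\mathbb N=\{1,2,3,\dots\}$; empty sums are zero. $\kappa(X,Y)=\mathrm{Tr}(\mathrm{ad}(X)\mathrm{ad}(Y))$ is the Killing form of the Lie algebra of the group $G$; the Laplacian is $\mathcal L_G=-\sum_{j}X_j^2$, where $\{X_j\}$ is a $g$-orthonormal basis of left-invariant vector fields on $G$; $\mathrm{Spec}(G)$ is the set of eigenvalues of $\mathcal L_G$ (without multiplicity). *)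

theory Defs
  imports "HOL-Analysis.Analysis"
begin

section \<open>Matrix groups and their Lie algebras\<close>

type_synonym 'n cmat = "complex ^ 'n ^ 'n"

definition ctranspose :: "'n::finite cmat \<Rightarrow> 'n cmat" where
  "ctranspose A = (\<chi> i j. cnj (A $ j $ i))"

definition SU :: "('n::finite cmat) set" where
  "SU = {A. A ** ctranspose A = mat 1 \<and> det A = 1}"

(* The library's multiplication and power on vectors are entrywise, hence matpow and mexp. *)

primrec matpow :: "'n::finite cmat \<Rightarrow> nat \<Rightarrow> 'n cmat" where
  "matpow A 0 = mat 1"
| "matpow A (Suc k) = A ** matpow A k"

definition mexp :: "'n::finite cmat \<Rightarrow> 'n cmat" where
  "mexp A = (\<Sum>k. matpow A k /\<^sub>R fact k)"

definition lie_algebra :: "('n::finite cmat) set \<Rightarrow> ('n cmat) set" where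
  "lie_algebra G = {X. \<forall>t::real. mexp (t *\<^sub>R X) \<in> G}"

definition ad :: "'n::finite cmat \<Rightarrow> 'n cmat \<Rightarrow> 'n cmat" where
  "ad X Y = X ** Y - Y ** X"

definition is_basis :: "'a::real_vector set \<Rightarrow> 'a set \<Rightarrow> bool" where
  "is_basis V B \<longleftrightarrow> B \<subseteq> V \<and> independent B \<and> span B = V"

text \<open>
  Trace of an endomorphism T of a finite-dimensional real subspace V, computed in some basis;
  the value does not depend on the basis.
\<close>

definition trace_on :: "'a::real_vector set \<Rightarrow> ('a \<Rightarrow> 'a) \<Rightarrow> real" where
  "trace_on V T = (let B = (SOME B. is_basis V B) in \<Sum>b\<in>B. representation B (T b) b)"

definition killing :: "('n::finite cmat) set \<Rightarrow> 'n cmat \<Rightarrow> 'n cmat \<Rightarrow> real" where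
  "killing G X Y = trace_on (lie_algebra G) (ad X \<circ> ad Y)"

section \<open>Smooth functions\<close>

text \<open>
  A function is k times differentiable on an open set if all its iterated directional
  derivatives up to order k - 1 are (Frechet) differentiable there; for all k together this is
  the usual notion of a smooth function on an open set.
\<close>

primrec differentiable_times ::
    "nat \<Rightarrow> ('a::real_normed_vector \<Rightarrow> 'b::real_normed_vector) \<Rightarrow> 'a set \<Rightarrow> bool" where
  "differentiable_times 0 f U \<longleftrightarrow> continuous_on U f"
| "differentiable_times (Suc k) f U \<longleftrightarrow>
     (\<forall>x\<in>U. f differentiable (at x)) \<and>
     (\<forall>v. differentiable_times k (\<lambda>x. frechet_derivative f (at x) v) U)"

definition smooth_on_open :: "('a::real_normed_vector \<Rightarrow> 'b::real_normed_vector) \<Rightarrow> 'a set \<Rightarrow> bool" where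
  "smooth_on_open f U \<longleftrightarrow> open U \<and> (\<forall>k. differentiable_times k f U)"

text \<open>
  Smoothness on an embedded submanifold S: locally the restriction of a smooth function of
  the ambient space. Only the values of f on S matter.
\<close>

definition smooth_on :: "('a::real_normed_vector \<Rightarrow> 'b::real_normed_vector) \<Rightarrow> 'a set \<Rightarrow> bool" where
  "smooth_on f S \<longleftrightarrow>
     (\<forall>x\<in>S. \<exists>U F. x \<in> U \<and> smooth_on_open F U \<and> (\<forall>y\<in>U \<inter> S. F y = f y))"

section \<open>The Laplacian of a left-invariant metric\<close>

text \<open>
  Left-invariant vector fields on G are identified with elements X of the Lie algebra; the flow
  of the field of X is right multiplication by the exponentials of tX. A left-invariant
  Riemannian metric is likewise identified with its inner product g on the Lie algebra, so that
  left-invariant fields are orthonormal at every point iff the corresponding elements are.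
\<close>

definition left_inv_deriv :: "'n::finite cmat \<Rightarrow> ('n cmat \<Rightarrow> complex) \<Rightarrow> 'n cmat \<Rightarrow> complex" where
  "left_inv_deriv X f x = vector_derivative (\<lambda>t::real. f (x ** mexp (t *\<^sub>R X))) (at 0)"

definition orthonormal_basis :: "'a::real_vector set \<Rightarrow> ('a \<Rightarrow> 'a \<Rightarrow> real) \<Rightarrow> 'a set \<Rightarrow> bool" where
  "orthonormal_basis V g B \<longleftrightarrow>
     is_basis V B \<and> (\<forall>X\<in>B. \<forall>Y\<in>B. g X Y = (if X = Y then 1 else 0))"

text \<open>
  The operator does not depend on the choice of the orthonormal basis.
\<close>

definition laplacian ::
    "('n::finite cmat) set \<Rightarrow> ('n cmat \<Rightarrow> 'n cmat \<Rightarrow> real) \<Rightarrow> ('n cmat \<Rightarrow> complex) \<Rightarrow> 'n cmat \<Rightarrow> complex" where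
  "laplacian G g f x =
     (let B = (SOME B. orthonormal_basis (lie_algebra G) g B)
      in - (\<Sum>X\<in>B. left_inv_deriv X (left_inv_deriv X f) x))"

definition Spec :: "('n::finite cmat) set \<Rightarrow> ('n cmat \<Rightarrow> 'n cmat \<Rightarrow> real) \<Rightarrow> complex set" where
  "Spec G g = {\<mu>. \<exists>f. smooth_on f G \<and> (\<exists>x\<in>G. f x \<noteq> 0) \<and> (\<forall>x\<in>G. laplacian G g f x = \<mu> * f x)}"

section \<open>The eigenvalues\<close>

text \<open>
  Here n stands for a tuple of l positive integers, indexed by 1, ..., l.
\<close>

definition eigval :: "nat \<Rightarrow> real \<Rightarrow> (nat \<Rightarrow> nat) \<Rightarrow> real" where
  "eigval l \<gamma> n =
     1 / (2 * (real l + 1) ^ 3 * \<gamma>) *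
     ((\<Sum>j=1..l. (real l + 1 - real j) * real (n j))\<^sup>2
      + (\<Sum>k=2..l. (- (\<Sum>j=1..k-1. real j * real (n j))
                    + (\<Sum>j=k..l. (real l + 1 - real j) * real (n j)))\<^sup>2)
      + (\<Sum>j=1..l. real j * real (n j))\<^sup>2
      - 1 / 4 * (\<Sum>k=1..l+1. (real l - 2 * (real k - 1))\<^sup>2 * (real l + 1)\<^sup>2))"

end

theory Submission
  imports Defs "HOL-Computational_Algebra.Fundamental_Theorem_Algebra" "HOL-Library.Function_Algebras"
begin

text \<open>
  Complexified left-invariant fields act on polynomial functions of the matrix entries through
  finite-dimensional modules of the Lie algebra of traceless matrices. For \<open>g = - \<gamma> \<kappa>\<close> the Laplacian is
  a multiple of the Casimir operator, which commutes with this action; so an eigenspace in such a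
  module contains a highest weight vector, and the eigenvalue can be read off from its weight, which
  is dominant integral. Conversely, products of powers of the leading principal minors are highest
  weight vectors of every dominant integral weight.

  It remains to pass from polynomials to smooth eigenfunctions. In place of the Haar integral, averages
  over minimal nets are used. They are invariant under translations in the limit, and hence make the
  Laplacian symmetric in the limit. A nonzero eigenfunction \<open>f\<close> pairs nontrivially with some polynomial
  \<open>p\<close>, by the Stone-Weierstrass theorem. On the finite-dimensional module generated by \<open>p\<close>, the pairing
  with \<open>f\<close> is an approximate eigenvector of the transposed Laplacian, so the eigenvalue of \<open>f\<close> already
  occurs on this module.
\<close>


section \<open>Operators on finite-dimensional complex spaces\<close>

text \<open>Write n = l + 1. On a module of highest weight L the Casimir operator is the scalar |L +
  r|^2 - |r|^2, where r is half the sum of the positive roots. Since r is also the sum of the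
  fundamental weights, the coordinates of L + r in them are those of L raised by 1: this is why
  \<nu> ranges over tuples of positive integers, and the last sum of the formula is a multiple of
  |r|^2. The fundamental weights have denominator n, which accounts for a factor 1/n^2; the
  remaining 1/(2 n \<gamma>) appears because the Killing form is 2n Tr(XY). The obstacle is that a
  smooth eigenfunction f is not given inside any finite-dimensional invariant space. Only its
  eigenvalue has to be located there: if a polynomial q in the Laplacian annihilates a polynomial
  function p, then pairing with f shows that the eigenvalue is a root of q, as soon as the pairing
  of p with f does not tend to zero. Convergence of the means is never asserted; all statements are
  about expressions in them that do or do not tend to zero.\<close>

no_notation vector_scalar_mult (infixl "*s" 70)

locale complex_vector_space = vector_space scale
  for scale :: "complex \<Rightarrow> 'v::ab_group_add \<Rightarrow> 'v" (infixr \<open>*s\<close> 75)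
begin

text \<open>Dependence is stated for positions instead of vectors, so that a repeated vector counts
  as a relation. If the first \<open>card B + 1\<close> terms are distinct, they are too many to be
  independent; otherwise the difference of two equal terms is the relation.\<close>

lemma dependent_sequence:
  fixes u :: "nat \<Rightarrow> 'v"
  assumes "finite B" and u: "\<And>k. u k \<in> span B"
  shows "\<exists>N c. (\<Sum>k\<le>N. c k *s u k) = 0 \<and> (\<exists>k\<le>N. c k \<noteq> 0)"
proof (cases "inj_on u {..card B}")
  case True
  have "dependent (u ` {..card B})"
  proof (rule ccontr)
    assume "independent (u ` {..card B})"
    then have "card (u ` {..card B}) \<le> card B"
      using independent_span_bound[OF \<open>finite B\<close>] u by blast
    then show False
      using True by (simp add: card_image)
  qed
  then obtain r where r: "\<exists>v\<in>u ` {..card B}. r v \<noteq> 0" "(\<Sum>v\<in>u ` {..card B}. r v *s v) = 0"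
    by (auto simp: dependent_finite)
  have "(\<Sum>k\<le>card B. r (u k) *s u k) = 0"
    using r(2) by (simp add: sum.reindex[OF True])
  then show ?thesis
    using r(1) by (intro exI[of _ "card B"] exI[of _ "\<lambda>k. r (u k)"]) auto
next
  case False
  then obtain i j where ij: "i \<le> card B" "j \<le> card B" "i \<noteq> j" "u i = u j"
    by (auto simp: inj_on_def)
  let ?c = "\<lambda>k. (if k = i then 1 else 0) - (if k = j then 1 else 0)"
  have "(\<Sum>k\<le>card B. ?c k *s u k) = (\<Sum>k\<le>card B. if k = i then u k else 0) - (\<Sum>k\<le>card B. if k = j then u k else 0)"
    unfolding sum_subtractf[symmetric] by (rule sum.cong) auto
  also have "\<dots> = 0"
    using ij by simp
  finally show ?thesis
    using ij by (intro exI[of _ "card B"] exI[of _ ?c]) auto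
qed

text \<open>Linearity is required only on \<open>S\<close>: the differential operators used later
  are additive on smooth functions but not on arbitrary ones.\<close>

definition operator_on :: "'v set \<Rightarrow> ('v \<Rightarrow> 'v) \<Rightarrow> bool" where
  "operator_on S T \<longleftrightarrow> (\<forall>v\<in>S. T v \<in> S) \<and> (\<forall>v\<in>S. \<forall>w\<in>S. T (v + w) = T v + T w)
     \<and> (\<forall>a. \<forall>v\<in>S. T (a *s v) = a *s T v)"

lemma operator_onI:
  assumes "\<And>v. v \<in> S \<Longrightarrow> T v \<in> S"
    and "\<And>v w. v \<in> S \<Longrightarrow> w \<in> S \<Longrightarrow> T (v + w) = T v + T w"
    and "\<And>a v. v \<in> S \<Longrightarrow> T (a *s v) = a *s T v"
  shows "operator_on S T"
  using assms by (auto simp: operator_on_def)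

lemma operator_onD:
  assumes "operator_on S T" "v \<in> S"
  shows "T v \<in> S" "w \<in> S \<Longrightarrow> T (v + w) = T v + T w" "T (a *s v) = a *s T v"
  using assms by (auto simp: operator_on_def)

lemma operator_on_zero: "operator_on S T \<Longrightarrow> subspace S \<Longrightarrow> T 0 = 0"
  using operator_onD(3)[of S T 0 0] subspace_0 by simp

lemma operator_on_diff:
  assumes "operator_on S T" "subspace S" "v \<in> S" "w \<in> S"
  shows "T (v - w) = T v - T w"
proof -
  have "v - w \<in> S"
    using assms subspace_diff by blast
  from operator_onD(2)[OF assms(1) this assms(4)] show ?thesis
    by (simp add: algebra_simps)
qed

lemma operator_on_sum:
  assumes "operator_on S T" "subspace S" "\<And>i. i \<in> I \<Longrightarrow> f i \<in> S"
  shows "T (\<Sum>i\<in>I. f i) = (\<Sum>i\<in>I. T (f i))"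
  using assms(3)
proof (induction I rule: infinite_finite_induct)
  case (insert i I)
  then have "sum f I \<in> S"
    by (intro subspace_sum[OF assms(2)]) auto
  then show ?case
    using insert by (simp add: operator_onD[OF assms(1)])
qed (use operator_on_zero[OF assms(1,2)] in auto)

text \<open>This is q(T)v in Horner form, evaluated vector by vector because \<open>T\<close> is
  linear only on \<open>S\<close>.\<close>

definition poly_apply :: "complex poly \<Rightarrow> ('v \<Rightarrow> 'v) \<Rightarrow> 'v \<Rightarrow> 'v" where
  "poly_apply q T v = fold_coeffs (\<lambda>a w. a *s v + T w) q 0"

context
  fixes S T
  assumes S: "subspace S" and T: "operator_on S T"
begin

lemma poly_apply_0 [simp]: "poly_apply 0 T v = 0"
  by (simp add: poly_apply_def)

lemma poly_apply_pCons: "poly_apply (pCons a q) T v = a *s v + T (poly_apply q T v)"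
  by (cases "pCons a q = 0") (auto simp: poly_apply_def operator_on_zero[OF T S])

lemma poly_apply_closed: "v \<in> S \<Longrightarrow> poly_apply q T v \<in> S"
  by (induction q)
     (auto simp: poly_apply_pCons operator_onD[OF T] intro!: subspace_add[OF S] subspace_scale[OF S] subspace_0[OF S])

lemma poly_apply_add:
  assumes "v \<in> S"
  shows "poly_apply (p + q) T v = poly_apply p T v + poly_apply q T v"
  by (induction p q rule: poly_induct2)
     (auto simp: poly_apply_pCons operator_onD[OF T] poly_apply_closed[OF assms] algebra_simps)

lemma poly_apply_smult:
  assumes "v \<in> S"
  shows "poly_apply (smult a q) T v = a *s poly_apply q T v"
  by (induction q)
     (auto simp: poly_apply_pCons operator_onD[OF T] poly_apply_closed[OF assms] algebra_simps)

lemma poly_apply_linear_factor: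
  assumes "v \<in> S"
  shows "poly_apply ([:- z, 1:] * q) T v = T (poly_apply q T v) - z *s poly_apply q T v"
proof -
  have "[:- z, 1:] * q = pCons 0 q + smult (- z) q"
    by simp
  then show ?thesis
    by (simp only: poly_apply_add[OF assms] poly_apply_smult[OF assms] poly_apply_pCons) simp
qed

lemma poly_apply_monom:
  assumes "v \<in> S"
  shows "poly_apply (monom a k) T v = a *s (T ^^ k) v"
proof (induction k)
  case (Suc k)
  have "(T ^^ k) v \<in> S" for k
    by (induction k) (auto simp: assms operator_onD[OF T])
  then show ?case
    using Suc by (simp add: monom_Suc poly_apply_pCons operator_onD[OF T])
qed (simp add: monom_0 poly_apply_pCons operator_on_zero[OF T S])

text \<open>The vectors v, Tv, T^2 v, ... lie in a finite-dimensional space, so a linear relation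
  between them supplies the coefficients of \<open>q\<close>.\<close>

lemma poly_apply_annihilator:
  assumes "finite B" "S \<subseteq> span B" "v \<in> S"
  shows "\<exists>q. q \<noteq> 0 \<and> poly_apply q T v = 0"
proof -
  have TS: "(T ^^ k) v \<in> S" for k
    by (induction k) (auto simp: assms operator_onD[OF T])
  then have "(T ^^ k) v \<in> span B" for k
    using assms by blast
  from dependent_sequence[OF \<open>finite B\<close>, of "\<lambda>k. (T ^^ k) v", OF this]
  obtain N c where Nc: "(\<Sum>k\<le>N. c k *s (T ^^ k) v) = 0" "\<exists>k\<le>N. c k \<noteq> 0"
    by blast
  let ?q = "\<Sum>k\<le>N. monom (c k) k"
  have "poly_apply (\<Sum>k\<in>I. monom (c k) k) T v = (\<Sum>k\<in>I. c k *s (T ^^ k) v)" if "finite I" for I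
    using that by induction (simp_all add: poly_apply_add[OF assms(3)] poly_apply_monom[OF assms(3)])
  then have "poly_apply ?q T v = 0"
    using Nc(1) by simp
  moreover have "coeff ?q k = c k" if "k \<le> N" for k
    using that by (simp add: coeff_sum)
  then have "?q \<noteq> 0"
    using Nc(2) by (metis coeff_0)
  ultimately show ?thesis by blast
qed

end

text \<open>Linear factors are removed from an annihilating polynomial: if q = (X - z) r, then r(T)v
  is either an eigenvector for z or zero, and in the second case r is an annihilator of smaller
  degree. The hypothesis on roots is made for all annihilators of \<open>v\<close>, so that it
  survives this descent; through \<open>Z\<close> it can prescribe the eigenvalue.\<close>

lemma eigenvalue_of_root:
  assumes S: "subspace S" and T: "operator_on S T" and "v \<in> S" "v \<noteq> 0"
    and "q \<noteq> 0" "poly_apply q T v = 0"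
    and root: "\<And>r. r \<noteq> 0 \<Longrightarrow> poly_apply r T v = 0 \<Longrightarrow> \<exists>z\<in>Z. poly r z = 0"
  shows "\<exists>z\<in>Z. \<exists>w\<in>S. w \<noteq> 0 \<and> T w = z *s w"
  using \<open>q \<noteq> 0\<close> \<open>poly_apply q T v = 0\<close>
proof (induction "degree q" arbitrary: q rule: less_induct)
  case less
  then obtain z where z: "z \<in> Z" "poly q z = 0"
    using root by blast
  then obtain r where r: "q = [:- z, 1:] * r"
    using poly_eq_0_iff_dvd[of q z] by (metis dvd_def)
  let ?w = "poly_apply r T v"
  have "T ?w - z *s ?w = 0"
    using less.prems(2) poly_apply_linear_factor[OF S T \<open>v \<in> S\<close>] r by simp
  then have eig: "T ?w = z *s ?w"
    by simp
  show ?case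
  proof (cases "?w = 0")
    case True
    have "r \<noteq> 0"
      using less.prems(1) r by auto
    then have "degree q = Suc (degree r)"
      unfolding r by (subst degree_mult_eq) auto
    then show ?thesis
      using less.hyps[of r] True \<open>r \<noteq> 0\<close> by auto
  next
    case False
    then show ?thesis
      using eig poly_apply_closed[OF S T \<open>v \<in> S\<close>] z(1) by blast
  qed
qed


lemma exists_eigenvector:
  assumes S: "subspace S" and T: "operator_on S T"
    and B: "finite B" "S \<subseteq> span B" and v: "v \<in> S" "v \<noteq> 0"
  shows "\<exists>z. \<exists>w\<in>S. w \<noteq> 0 \<and> T w = z *s w"
proof -
  have root: "\<exists>z\<in>UNIV. poly r z = 0" if r: "r \<noteq> 0" "poly_apply r T v = 0" for r :: "complex poly"
  proof -
    have "degree r \<noteq> 0"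
    proof
      assume "degree r = 0"
      then obtain a where a: "r = [:a:]"
        using degree_eq_zeroE by blast
      then have "a *s v = 0"
        using r(2) by (simp add: poly_apply_pCons[OF S T] poly_apply_0[OF S T] operator_on_zero[OF T S])
      then show False
        using v r a by simp
    qed
    then show ?thesis
      using fundamental_theorem_of_algebra[of r] constant_degree[of r] by auto
  qed
  obtain q where q: "q \<noteq> 0" "poly_apply q T v = 0"
    using poly_apply_annihilator[OF S T B v(1)] by blast
  show ?thesis
    using eigenvalue_of_root[OF S T v q root] by blast
qed

text \<open>The functionals satisfy the transposed eigenvalue equation only in the limit. By
  induction on r, the value at r(T)v differs from r(\<mu>) times the value at v by a null sequence;
  so if r annihilates v and \<open>\<phi> v\<close> is not null, then r(\<mu>) = 0. Hence every
  annihilator of v has the root \<mu>, and \<open>eigenvalue_of_root\<close> applies with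
  \<open>Z = {\<mu>}\<close>.\<close>

lemma eigenvalue_of_asymptotic_functional:
  fixes \<phi> :: "'v \<Rightarrow> nat \<Rightarrow> complex"
  assumes S: "subspace S" and T: "operator_on S T"
    and B: "finite B" "S \<subseteq> span B" and v: "v \<in> S"
    and phi_add: "\<And>v w k. v \<in> S \<Longrightarrow> w \<in> S \<Longrightarrow> \<phi> (v + w) k = \<phi> v k + \<phi> w k"
    and phi_scale: "\<And>a v k. v \<in> S \<Longrightarrow> \<phi> (a *s v) k = a * \<phi> v k"
    and lim: "\<And>v. v \<in> S \<Longrightarrow> (\<lambda>k. \<phi> (T v) k - \<mu> * \<phi> v k) \<longlonglongrightarrow> 0"
    and ne: "\<not> \<phi> v \<longlonglongrightarrow> 0"
  shows "\<exists>w\<in>S. w \<noteq> 0 \<and> T w = \<mu> *s w"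
proof -
  have phi0: "\<phi> 0 k = 0" for k
    using phi_scale[OF subspace_0[OF S], of 0 k] by simp
  have lim_poly: "(\<lambda>k. \<phi> (poly_apply r T v) k - poly r \<mu> * \<phi> v k) \<longlonglongrightarrow> 0" for r
  proof (induction r)
    case 0
    then show ?case by (simp only: poly_apply_0[OF S T] phi0) simp
  next
    case (pCons a r)
    let ?w = "poly_apply r T v"
    have w: "?w \<in> S" "T ?w \<in> S"
      using poly_apply_closed[OF S T v] operator_onD[OF T] by auto
    have "(\<lambda>k. (\<phi> (T ?w) k - \<mu> * \<phi> ?w k) + \<mu> * (\<phi> ?w k - poly r \<mu> * \<phi> v k)) \<longlonglongrightarrow> 0"
      using tendsto_add[OF lim[OF w(1)] tendsto_mult_right_zero[OF pCons(2)]] by (simp only: add_0)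
    moreover have "\<phi> (poly_apply (pCons a r) T v) k = a * \<phi> v k + \<phi> (T ?w) k" for k
      using w v by (simp add: poly_apply_pCons[OF S T] phi_add phi_scale subspace_scale[OF S])
    ultimately show ?case
      by (simp add: algebra_simps)
  qed
  have root: "\<exists>z\<in>{\<mu>}. poly r z = 0" if r: "poly_apply r T v = 0" for r
  proof (rule ccontr)
    assume "\<not> ?thesis"
    then have "poly r \<mu> \<noteq> 0" by simp
    have "(\<lambda>k. - poly r \<mu> * \<phi> v k) \<longlonglongrightarrow> 0"
      using lim_poly[of r] unfolding r phi0 by simp
    then have "(\<lambda>k. (- inverse (poly r \<mu>)) * (- poly r \<mu> * \<phi> v k)) \<longlonglongrightarrow> 0"
      by (rule tendsto_mult_right_zero)
    moreover have "(- inverse (poly r \<mu>)) * (- poly r \<mu> * \<phi> v k) = \<phi> v k" for k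
      using \<open>poly r \<mu> \<noteq> 0\<close> by (simp add: field_simps)
    ultimately have "(\<lambda>k. \<phi> v k) \<longlonglongrightarrow> 0"
      by (simp only:)
    then show False
      using ne by blast
  qed
  have "v \<noteq> 0"
  proof
    assume "v = 0"
    then have "\<phi> v = (\<lambda>k. 0)"
      using phi0 by (intro ext) simp
    then show False
      using ne by simp
  qed
  obtain q where q: "q \<noteq> 0" "poly_apply q T v = 0"
    using poly_apply_annihilator[OF S T B v] by blast
  show ?thesis
    using eigenvalue_of_root[OF S T v \<open>v \<noteq> 0\<close> q, of "{\<mu>}"] root by simp
qed

text \<open>The joint eigenspace of the first \<open>m\<close> operators is invariant under the next
  one because they commute, so the next one has an eigenvector inside it.\<close>

lemma common_eigenvector:
  fixes T :: "nat \<Rightarrow> 'v \<Rightarrow> 'v"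
  assumes S: "subspace S" and B: "finite B" "S \<subseteq> span B" and v: "v \<in> S" "v \<noteq> 0"
    and T: "\<And>i. i < m \<Longrightarrow> operator_on S (T i)"
    and comm: "\<And>i j u. i < m \<Longrightarrow> j < m \<Longrightarrow> u \<in> S \<Longrightarrow> T i (T j u) = T j (T i u)"
  shows "\<exists>z. \<exists>w\<in>S. w \<noteq> 0 \<and> (\<forall>i<m. T i w = z i *s w)"
  using T comm
proof (induction m)
  case 0
  then show ?case using v by auto
next
  case (Suc m)
  then obtain z w where w: "w \<in> S" "w \<noteq> 0" "\<forall>i<m. T i w = z i *s w"
    by (metis less_SucI)
  define E where "E = {u \<in> S. \<forall>i<m. T i u = z i *s u}"
  have E: "subspace E"
    unfolding subspace_def E_def
    using subspace_0[OF S] subspace_add[OF S] subspace_scale[OF S]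
      Suc.prems(1)[THEN operator_onD(2)] Suc.prems(1)[THEN operator_onD(3)]
    by (auto simp: operator_on_zero[OF Suc.prems(1) S] scale_right_distrib mult.commute)
  have "operator_on E (T m)"
  proof (rule operator_onI)
    fix u assume u: "u \<in> E"
    have "T i (T m u) = z i *s T m u" if "i < m" for i
      using Suc.prems(2)[of i m u] u that operator_onD(3)[OF Suc.prems(1)[of m]]
      by (auto simp: E_def)
    then show "T m u \<in> E"
      using u operator_onD(1)[OF Suc.prems(1)[of m]] by (auto simp: E_def)
  qed (use operator_onD[OF Suc.prems(1)[of m]] in \<open>auto simp: E_def\<close>)
  moreover have "E \<subseteq> span B" "w \<in> E"
    using B w by (auto simp: E_def)
  ultimately obtain a u where "u \<in> E" "u \<noteq> 0" "T m u = a *s u"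
    using exists_eigenvector[OF E _ B(1)] w(2) by blast
  then show ?case
    by (intro exI[of _ "z(m := a)"] bexI[of _ u]) (auto simp: E_def less_Suc_eq)
qed

text \<open>Nonzero eigenvectors for distinct eigenvalues are independent, so a finite-dimensional
  space cannot contain infinitely many. This is how strings of raised or lowered vectors are seen to
  end.\<close>

lemma distinct_eigenvalues_vanish:
  assumes S: "subspace S" and T: "operator_on S T"
    and B: "finite B" "S \<subseteq> span B"
    and u: "\<And>k. u k \<in> S" "\<And>k. T (u k) = z k *s u k" and z: "inj z"
  shows "\<exists>k::nat. u k = 0"
proof (rule ccontr)
  assume "\<not> ?thesis"
  then have ne: "u k \<noteq> 0" for k by blast
  have indep: "c k = 0" if "(\<Sum>k<N. c k *s u k) = 0" "k < N" for c N k
    using that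
  proof (induction N arbitrary: c k)
    case (Suc N)
    \<comment> \<open>Applying \<open>T\<close> and subtracting \<open>z N\<close> times the
      relation removes the last term and leaves a shorter relation.\<close>
    have "T (\<Sum>k<Suc N. c k *s u k) = (\<Sum>k<Suc N. T (c k *s u k))"
      using u(1) by (intro operator_on_sum[OF T S] subspace_scale[OF S])
    then have "(\<Sum>k<Suc N. (z k * c k) *s u k) = 0"
      using Suc.prems u by (simp add: operator_onD[OF T] operator_on_zero[OF T S] mult.commute)
    moreover have "(\<Sum>k<Suc N. (z N * c k) *s u k) = z N *s (\<Sum>k<Suc N. c k *s u k)"
      by (simp only: scale_sum_right scale_scale)
    ultimately have "(\<Sum>k<Suc N. (z k * c k) *s u k) - (\<Sum>k<Suc N. (z N * c k) *s u k) = 0"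
      using Suc.prems by simp
    then have "(\<Sum>k<N. ((z k - z N) * c k) *s u k) = 0"
      unfolding sum_subtractf[symmetric] scale_left_diff_distrib[symmetric] left_diff_distrib[symmetric]
      by simp
    then have "(z k - z N) * c k = 0" if "k < N" for k
      using Suc.IH[of "\<lambda>k. (z k - z N) * c k"] that by blast
    then have small: "c k = 0" if "k < N" for k
      using that injD[OF z, of k N] by fastforce
    then have "c N *s u N = 0"
      using Suc.prems(1) by simp
    then show ?case
      using small Suc.prems(2) ne by (auto simp: less_Suc_eq)
  qed simp
  have "u k \<in> span B" for k
    using u(1) B by blast
  from dependent_sequence[OF B(1), of u, OF this]
  obtain N c where "(\<Sum>k\<le>N. c k *s u k) = 0" "\<exists>k\<le>N. c k \<noteq> 0" by blast
  then show False
    using indep[of c "Suc N"] by (auto simp: lessThan_Suc_atMost less_Suc_eq_le)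
qed

end

section \<open>Casimir eigenvalues of highest weight\<close>

text \<open>The commutators are those of the matrix units of gl(n), while \<open>trace\<close> lets
  the identity act by zero: \<open>e i j\<close> stands for the matrix unit with its trace part
  removed. Modules of traceless matrices thus keep the simple relations of gl(n), and weights are
  tuples of n numbers with sum zero.\<close>

locale gl_module = complex_vector_space scale
  for scale :: "complex \<Rightarrow> 'v::ab_group_add \<Rightarrow> 'v" (infixr \<open>*s\<close> 75) +
  fixes S :: "'v set" and n :: nat and e :: "nat \<Rightarrow> nat \<Rightarrow> 'v \<Rightarrow> 'v"
  assumes S: "subspace S"
    and op: "\<And>i j. i < n \<Longrightarrow> j < n \<Longrightarrow> operator_on S (e i j)"
    and comm: "\<And>i j k l v. i < n \<Longrightarrow> j < n \<Longrightarrow> k < n \<Longrightarrow> l < n \<Longrightarrow> v \<in> S \<Longrightarrow>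
      e i j (e k l v) - e k l (e i j v) = (if j = k then e i l v else 0) - (if l = i then e k j v else 0)"
    and trace: "\<And>v. v \<in> S \<Longrightarrow> (\<Sum>i<n. e i i v) = 0"
begin

definition casimir :: "'v \<Rightarrow> 'v" where
  "casimir v = (\<Sum>i<n. \<Sum>j<n. e i j (e j i v))"

lemma e_closed: "i < n \<Longrightarrow> j < n \<Longrightarrow> v \<in> S \<Longrightarrow> e i j v \<in> S"
  using op operator_onD(1) by blast

lemma e_zero: "i < n \<Longrightarrow> j < n \<Longrightarrow> e i j 0 = 0"
  using op operator_on_zero S by blast

lemma e_scale: "i < n \<Longrightarrow> j < n \<Longrightarrow> v \<in> S \<Longrightarrow> e i j (a *s v) = a *s e i j v"
  using op operator_onD(3) by blast

lemma e_add: "i < n \<Longrightarrow> j < n \<Longrightarrow> v \<in> S \<Longrightarrow> w \<in> S \<Longrightarrow> e i j (v + w) = e i j v + e i j w"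
  using op operator_onD(2) by blast

lemma e_swap:
  assumes "i < n" "j < n" "k < n" "l < n" "v \<in> S"
  shows "e i j (e k l v) = e k l (e i j v) + (if j = k then e i l v else 0) - (if l = i then e k j v else 0)"
  using comm[OF assms] by (simp add: algebra_simps)

lemma operator_casimir: "operator_on S casimir"
proof (rule operator_onI)
  show "casimir v \<in> S" if "v \<in> S" for v
    unfolding casimir_def using that by (intro subspace_sum[OF S] e_closed) auto
  show "casimir (v + w) = casimir v + casimir w" if "v \<in> S" "w \<in> S" for v w
    unfolding casimir_def using that by (simp add: e_add e_closed sum.distrib)
  show "casimir (a *s v) = a *s casimir v" if "v \<in> S" for a v
    unfolding casimir_def using that by (simp add: e_scale e_closed scale_sum_right)
qed

text \<open>Commuting a summand with \<open>e k l\<close> produces four families of terms, each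
  supported on one equation between indices. Summed over i and j, the first cancels the fourth and
  the second the third.\<close>

lemma casimir_commute:
  assumes "k < n" "l < n" "v \<in> S"
  shows "casimir (e k l v) = e k l (casimir v)"
proof -
  have "e i j (e j i (e k l v)) - e k l (e i j (e j i v)) =
      (if i = k then e k j (e j l v) else 0) - (if j = l then e i l (e k i v) else 0)
      + ((if j = k then e i l (e k i v) else 0) - (if i = l then e k j (e j l v) else 0))"
    if ij: "i < n" "j < n" for i j
  proof -
    have "e i j (e j i (e k l v)) = e i j (e k l (e j i v)) + ((if i = k then e i j (e j l v) else 0) - (if l = j then e i j (e k i v) else 0))"
    proof -
      let ?u = "(if i = k then e j l v else 0) - (if l = j then e k i v else 0)"
      have u: "?u \<in> S"
        using ij assms by (intro subspace_diff[OF S]) (auto simp: e_closed subspace_0[OF S])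
      have "e j i (e k l v) = e k l (e j i v) + ?u"
        using e_swap[of j i k l v] ij assms by simp
      then have "e i j (e j i (e k l v)) = e i j (e k l (e j i v)) + e i j ?u"
        using ij assms u by (simp add: e_add e_closed)
      moreover have "e i j ?u = (if i = k then e i j (e j l v) else 0) - (if l = j then e i j (e k i v) else 0)"
        using ij assms operator_on_diff[OF op[OF ij] S] by (auto simp: e_zero e_closed subspace_0[OF S])
      ultimately show ?thesis by simp
    qed
    moreover have "e i j (e k l (e j i v)) = e k l (e i j (e j i v)) + (if j = k then e i l (e j i v) else 0) - (if l = i then e k j (e j i v) else 0)"
      using e_swap[of i j k l "e j i v"] ij assms by (simp add: e_closed)
    ultimately show ?thesis
      by auto
  qed
  then have "(\<Sum>i<n. \<Sum>j<n. e i j (e j i (e k l v)) - e k l (e i j (e j i v))) =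
     (\<Sum>i<n. \<Sum>j<n. (if i = k then e k j (e j l v) else 0) - (if j = l then e i l (e k i v) else 0)
      + ((if j = k then e i l (e k i v) else 0) - (if i = l then e k j (e j l v) else 0)))"
    by (intro sum.cong) auto
  also have "\<dots> = 0"
  proof -
    have if_sum: "(\<Sum>j<n. if P then f j else 0) = (if P then \<Sum>j<n. f j else 0)" for P and f :: "nat \<Rightarrow> 'v"
      by simp
    show ?thesis
      using assms by (simp add: sum.distrib sum_subtractf if_sum)
  qed
  finally have "casimir (e k l v) = (\<Sum>i<n. \<Sum>j<n. e k l (e i j (e j i v)))"
    by (simp add: casimir_def sum_subtractf)
  also have "\<dots> = e k l (casimir v)"
  proof -
    have inner: "e k l (\<Sum>j<n. e i j (e j i v)) = (\<Sum>j<n. e k l (e i j (e j i v)))" if "i < n" for i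
      using that assms by (intro operator_on_sum[OF op S] e_closed) auto
    have "e k l (casimir v) = (\<Sum>i<n. e k l (\<Sum>j<n. e i j (e j i v)))"
      unfolding casimir_def using assms
      by (intro operator_on_sum[OF op S] subspace_sum[OF S] e_closed) auto
    then show ?thesis
      using inner by simp
  qed
  finally show ?thesis .
qed

text \<open>A product with i < j reduces to a commutator, which acts by w_i - w_j; one with i > j
  vanishes because its inner factor raises. The second sum is the pairing of the weight with the sum
  of the positive roots.\<close>

lemma casimir_highest_weight:
  assumes v: "v \<in> S"
    and raise: "\<And>i j. i < j \<Longrightarrow> j < n \<Longrightarrow> e i j v = 0"
    and weight: "\<And>i. i < n \<Longrightarrow> e i i v = w i *s v"
  shows "casimir v = ((\<Sum>i<n. (w i)\<^sup>2) + (\<Sum>i<n. \<Sum>j\<in>{i<..<n}. w i - w j)) *s v"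
proof -
  have "e i j (e j i v) = ((if i = j then (w i)\<^sup>2 else 0) + (if j \<in> {i<..<n} then w i - w j else 0)) *s v"
    if ij: "i < n" "j < n" for i j
  proof -
    consider "i = j" | "i < j" | "j < i" by linarith
    then show ?thesis
    proof cases
      case 2
      have "e i j (e j i v) = e j i (e i j v) + e i i v - e j j v"
        using e_swap[of i j j i v] ij 2 v by simp
      also have "\<dots> = (w i - w j) *s v"
        using raise[of i j] 2 weight ij by (simp add: e_zero scale_left_diff_distrib)
      finally show ?thesis
        using ij 2 by simp
    qed (use ij v weight raise in \<open>auto simp: e_scale e_zero power2_eq_square\<close>)
  qed
  then have "casimir v = (\<Sum>i<n. \<Sum>j<n. ((if i = j then (w i)\<^sup>2 else 0) + (if j \<in> {i<..<n} then w i - w j else 0)) *s v)"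
    unfolding casimir_def by (intro sum.cong) auto
  also have "\<dots> = (\<Sum>i<n. \<Sum>j<n. (if i = j then (w i)\<^sup>2 else 0) + (if j \<in> {i<..<n} then w i - w j else 0)) *s v"
    by (simp only: scale_sum_left)
  also have "(\<Sum>i<n. \<Sum>j<n. (if i = j then (w i)\<^sup>2 else 0) + (if j \<in> {i<..<n} then w i - w j else 0))
     = (\<Sum>i<n. (w i)\<^sup>2) + (\<Sum>i<n. \<Sum>j\<in>{i<..<n}. w i - w j)"
  proof -
    have "(\<Sum>j<n. if j \<in> {i<..<n} then w i - w j else 0) = (\<Sum>j\<in>{i<..<n}. w i - w j)" for i
      by (subst sum.inter_restrict[symmetric]) (auto intro!: sum.cong)
    then show ?thesis
      by (simp add: sum.distrib)
  qed
  finally show ?thesis .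
qed

text \<open>Lowering v repeatedly gives vectors f_k, and raising goes back by E f_(k+1) = (k+1)(a -
  b - k) f_k. The f_k have different \<open>e i i\<close>-eigenvalues a - k, so one of them is zero;
  just before the first zero the coefficient must vanish, and a - b = k.\<close>

lemma sl2_weight:
  assumes B: "finite B" "S \<subseteq> span B" and i: "Suc i < n"
    and v: "v \<in> S" "v \<noteq> 0" and raise: "e i (Suc i) v = 0"
    and w: "e i i v = a *s v" "e (Suc i) (Suc i) v = b *s v"
  shows "\<exists>m::nat. a - b = of_nat m"
proof -
  define f where "f k = (e (Suc i) i ^^ k) v" for k
  have f0: "f 0 = v" and fS: "f (Suc k) = e (Suc i) i (f k)" for k
    by (auto simp: f_def)
  have f: "f k \<in> S" for k
    by (induction k) (use v i in \<open>auto simp: f0 fS e_closed\<close>)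
  have hi: "e i i (f k) = (a - of_nat k) *s f k" for k
  proof (induction k)
    case (Suc k)
    have "e i i (f (Suc k)) = e (Suc i) i (e i i (f k)) - f (Suc k)"
      using e_swap[of i i "Suc i" i "f k"] i f by (simp add: fS)
    also have "\<dots> = (a - of_nat (Suc k)) *s f (Suc k)"
    proof -
      have "e (Suc i) i (e i i (f k)) = (a - of_nat k) *s f (Suc k)"
        using Suc i f by (simp add: e_scale fS)
      then show ?thesis
        by (simp add: algebra_simps)
    qed
    finally show ?case .
  qed (simp add: f0 w)
  have hsi: "e (Suc i) (Suc i) (f k) = (b + of_nat k) *s f k" for k
  proof (induction k)
    case (Suc k)
    have "e (Suc i) (Suc i) (f (Suc k)) = e (Suc i) i (e (Suc i) (Suc i) (f k)) + f (Suc k)"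
      using e_swap[of "Suc i" "Suc i" "Suc i" i "f k"] i f by (simp add: fS)
    also have "\<dots> = (b + of_nat (Suc k)) *s f (Suc k)"
    proof -
      have "e (Suc i) i (e (Suc i) (Suc i) (f k)) = (b + of_nat k) *s f (Suc k)"
        using Suc i f by (simp add: e_scale fS)
      then show ?thesis
        by (simp add: algebra_simps)
    qed
    finally show ?case .
  qed (simp add: f0 w)
  have up: "e i (Suc i) (f (Suc k)) = (of_nat (Suc k) * (a - b - of_nat k)) *s f k" for k
  proof (induction k)
    case 0
    show ?case
      using e_swap[of i "Suc i" "Suc i" i v] i v w
      by (simp add: fS f0 raise e_zero scale_left_diff_distrib)
  next
    case (Suc k)
    have "e i (Suc i) (f (Suc (Suc k))) = e (Suc i) i (e i (Suc i) (f (Suc k))) + e i i (f (Suc k)) - e (Suc i) (Suc i) (f (Suc k))"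
      using e_swap[of i "Suc i" "Suc i" i "f (Suc k)"] i f[of "Suc k"] by (simp add: fS[of "Suc k"])
    also have "\<dots> = (of_nat (Suc k) * (a - b - of_nat k)) *s f (Suc k) + (a - of_nat (Suc k)) *s f (Suc k) - (b + of_nat (Suc k)) *s f (Suc k)"
      using Suc.IH i f by (simp add: e_scale hi hsi fS[symmetric])
    also have "\<dots> = (of_nat (Suc k) * (a - b - of_nat k) + (a - of_nat (Suc k)) - (b + of_nat (Suc k))) *s f (Suc k)"
      by (simp only: scale_left_distrib scale_left_diff_distrib)
    also have "of_nat (Suc k) * (a - b - of_nat k) + (a - of_nat (Suc k)) - (b + of_nat (Suc k)) = of_nat (Suc (Suc k)) * (a - b - of_nat (Suc k))"
      by (simp add: algebra_simps)
    finally show ?case .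
  qed
  have "inj (\<lambda>k. a - of_nat k :: complex)"
    by (auto simp: inj_on_def)
  then have "\<exists>k. f k = 0"
    using distinct_eigenvalues_vanish[OF S op[of i i] B f hi] i by simp
  define m where "m = (LEAST k. f k = 0)"
  have "f m = 0"
    unfolding m_def using \<open>\<exists>k. f k = 0\<close> by (rule LeastI_ex)
  moreover from this obtain k where k: "m = Suc k"
    using v f0 by (cases m) auto
  moreover have "f k \<noteq> 0"
    using not_less_Least[of k "\<lambda>k. f k = 0"] k m_def by simp
  ultimately have "of_nat (Suc k) * (a - b - of_nat k) = 0"
    using up[of k] i by (simp add: e_zero del: of_nat_Suc)
  then have "a - b - of_nat k = 0"
    by (simp del: of_nat_Suc)
  then show ?thesis
    by (intro exI[of _ k]) simp
qed

text \<open>\<open>e i (Suc j)\<close> is the commutator of \<open>e i j\<close> with the simple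
  raising operator \<open>e j (Suc j)\<close>.\<close>

lemma raise_from_simple:
  assumes v: "v \<in> S" and simple: "\<And>i. Suc i < n \<Longrightarrow> e i (Suc i) v = 0"
    and "i < j" "j < n"
  shows "e i j v = 0"
  using \<open>i < j\<close> \<open>j < n\<close>
proof (induction j)
  case (Suc j)
  show ?case
  proof (cases "i = j")
    case False
    then have "i < j" "e i j v = 0"
      using Suc by auto
    then show ?thesis
      using comm[of i j j "Suc j" v] simple[of j] Suc.prems v by (simp add: e_zero)
  qed (use simple Suc in auto)
qed simp

text \<open>Inside the Casimir eigenspace, which all \<open>e i j\<close> preserve, a joint
  eigenvector of the diagonal operators is raised as long as possible. Each raising increases the
  eigenvalue of \<open>H\<close> by 1, so in finite dimension the process stops.\<close>

lemma exists_highest_weight_vector: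
  assumes B: "finite B" "S \<subseteq> span B" and v0: "v0 \<in> S" "v0 \<noteq> 0" "casimir v0 = c *s v0"
  shows "\<exists>w. \<exists>v\<in>S. v \<noteq> 0 \<and> casimir v = c *s v \<and> (\<forall>i<n. e i i v = w i *s v)
    \<and> (\<forall>i j. i < j \<longrightarrow> j < n \<longrightarrow> e i j v = 0)"
proof -
  define E where "E = {v \<in> S. casimir v = c *s v}"
  have E: "subspace E"
    unfolding subspace_def E_def
    using subspace_0[OF S] subspace_add[OF S] subspace_scale[OF S] operator_onD[OF operator_casimir]
    by (auto simp: operator_on_zero[OF operator_casimir S] scale_right_distrib mult.commute)
  have eE: "e i j v \<in> E" if "v \<in> E" "i < n" "j < n" for i j v
    using that by (auto simp: E_def e_closed casimir_commute e_scale)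
  have opE: "operator_on E (e i j)" if "i < n" "j < n" for i j
    using that eE by (intro operator_onI) (auto simp: E_def e_add e_scale)
  have BE: "E \<subseteq> span B"
    using B by (auto simp: E_def)
  define joint where "joint z v \<longleftrightarrow> v \<in> E \<and> v \<noteq> 0 \<and> (\<forall>i<n. e i i v = z i *s v)"
    for z :: "nat \<Rightarrow> complex" and v
  have "e i i (e j j u) = e j j (e i i u)" if "i < n" "j < n" "u \<in> E" for i j u
    using comm[of i i j j u] that by (cases "i = j") (auto simp: E_def)
  then obtain z0 v1 where "joint z0 v1"
    using common_eigenvector[OF E B(1) BE, of v0 n "\<lambda>i. e i i"] v0 opE
    unfolding joint_def by (auto simp: E_def)
  \<comment> \<open>The element of the Cartan subalgebra whose commutator with each simple raising operator is that operator.\<close>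
  define H where "H v = (\<Sum>i<n. (- of_nat i) *s e i i v)" for v
  have H_op: "operator_on E H"
  proof (rule operator_onI)
    show "H v \<in> E" if "v \<in> E" for v
      unfolding H_def using that by (intro subspace_sum[OF E] subspace_scale[OF E] eE) auto
    show "H (v + w) = H v + H w" if "v \<in> E" "w \<in> E" for v w
      unfolding H_def using that by (simp add: E_def e_add scale_right_distrib sum.distrib[symmetric])
    show "H (a *s v) = a *s H v" if "v \<in> E" for a v
      unfolding H_def using that by (simp add: E_def e_scale scale_sum_right mult.commute)
  qed
  have H_joint: "H v = (\<Sum>i<n. - of_nat i * z i) *s v" if "joint z v" for z v
    using that unfolding H_def joint_def by (simp add: scale_sum_left)
  have raise_joint: "joint (\<lambda>k. z k + (if k = i then 1 else 0) - (if k = Suc i then 1 else 0)) (e i (Suc i) v)"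
    if "joint z v" "Suc i < n" "e i (Suc i) v \<noteq> 0" for z v i
    unfolding joint_def
  proof (intro conjI allI impI)
    fix k assume k: "k < n"
    have v: "v \<in> S" "e k k v = z k *s v"
      using that k by (auto simp: joint_def E_def)
    show "e k k (e i (Suc i) v) = (z k + (if k = i then 1 else 0) - (if k = Suc i then 1 else 0)) *s e i (Suc i) v"
      using e_swap[of k k i "Suc i" v] v that k
      by (auto simp: e_scale scale_left_distrib scale_left_diff_distrib)
  qed (use that eE in \<open>auto simp: joint_def\<close>)
  have "\<exists>z v. joint z v \<and> (\<forall>i. Suc i < n \<longrightarrow> e i (Suc i) v = 0)"
  proof (rule ccontr)
    assume "\<not> ?thesis"
    then have step: "\<exists>i. Suc i < n \<and> e i (Suc i) v \<noteq> 0" if "joint z v" for z v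
      using that by blast
    \<comment> \<open>A pair consists of a weight and a joint eigenvector of this weight, so that
      iterating a choice function records both.\<close>
    let ?P = "\<lambda>p. joint (fst p) (snd p)"
    have "\<exists>q. ?P q \<and> (\<Sum>i<n. - of_nat i * fst q i) = (\<Sum>i<n. - of_nat i * fst p i) + 1" if p: "?P p" for p
    proof -
      obtain i where i: "Suc i < n" "e i (Suc i) (snd p) \<noteq> 0"
        using step[OF p] by blast
      let ?z = "\<lambda>k. fst p k + (if k = i then 1 else 0) - (if k = Suc i then 1 else 0)"
      \<comment> \<open>The weight gains 1 at i and loses 1 at i + 1, which changes the sum by -i +
        (i + 1) = 1.\<close>
      have "(\<Sum>k<n. - of_nat k * ?z k) =
          (\<Sum>k<n. - of_nat k * fst p k + (if k = i then - of_nat i else 0) + (if k = Suc i then of_nat (Suc i) else 0))"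
        by (intro sum.cong) (auto simp: algebra_simps)
      also have "\<dots> = (\<Sum>k<n. - of_nat k * fst p k) + 1"
        using i by (simp only: sum.distrib) simp
      finally show ?thesis
        using raise_joint[OF p i] by (intro exI[of _ "(?z, e i (Suc i) (snd p))"]) simp
    qed
    then obtain g where g: "?P (g p)" "(\<Sum>i<n. - of_nat i * fst (g p) i) = (\<Sum>i<n. - of_nat i * fst p i) + 1" if "?P p" for p
      by metis
    define q where "q k = (g ^^ k) (z0, v1)" for k
    have q: "?P (q k)" for k
      by (induction k) (use \<open>joint z0 v1\<close> g in \<open>auto simp: q_def\<close>)
    define h where "h k = (\<Sum>i<n. - of_nat i * fst (q k) i)" for k
    have "h (Suc k) = h k + 1" for k
      using g(2)[OF q[of k]] by (simp add: h_def q_def)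
    then have h: "h k = h 0 + of_nat k" for k
      by (induction k) (auto simp: algebra_simps)
    have "inj h"
      by (rule injI) (metis h add_left_cancel of_nat_eq_iff)
    have "snd (q k) \<in> E" "H (snd (q k)) = h k *s snd (q k)" for k
      using q[of k] H_joint[OF q[of k]] by (auto simp: joint_def h_def)
    then have "\<exists>k. snd (q k) = 0"
      using distinct_eigenvalues_vanish[OF E H_op B(1) BE _ _ \<open>inj h\<close>, of "\<lambda>k. snd (q k)"] by blast
    then show False
      using q by (auto simp: joint_def)
  qed
  then obtain z v where v: "joint z v" "\<And>i. Suc i < n \<Longrightarrow> e i (Suc i) v = 0"
    by blast
  then have "v \<in> S" "v \<noteq> 0" "casimir v = c *s v" "\<forall>i<n. e i i v = z i *s v"
    by (auto simp: joint_def E_def)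
  then show ?thesis
    using raise_from_simple[OF _ v(2)] by blast
qed

theorem casimir_eigenvalue:
  assumes B: "finite B" "S \<subseteq> span B" and v0: "v0 \<in> S" "v0 \<noteq> 0" "casimir v0 = c *s v0"
  shows "\<exists>w m. (\<forall>i. Suc i < n \<longrightarrow> w i - w (Suc i) = of_nat (m i)) \<and> (\<Sum>i<n. w i) = 0
    \<and> c = (\<Sum>i<n. (w i)\<^sup>2) + (\<Sum>i<n. \<Sum>j\<in>{i<..<n}. w i - w j)"
proof -
  obtain w v where v: "v \<in> S" "v \<noteq> 0" "casimir v = c *s v" "\<And>i. i < n \<Longrightarrow> e i i v = w i *s v"
    "\<And>i j. i < j \<Longrightarrow> j < n \<Longrightarrow> e i j v = 0"
    using exists_highest_weight_vector[OF B v0] by blast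
  have "\<exists>m::nat. w i - w (Suc i) = of_nat m" if "Suc i < n" for i
    using sl2_weight[OF B that v(1,2)] v(4)[of i] v(4)[of "Suc i"] v(5)[of i "Suc i"] that by simp
  then have "\<exists>m. \<forall>i. Suc i < n \<longrightarrow> w i - w (Suc i) = of_nat (m i)"
    by metis
  moreover have "(\<Sum>i<n. w i) *s v = 0"
    using trace[OF v(1)] v(4) by (simp add: scale_sum_left)
  moreover have "c *s v = ((\<Sum>i<n. (w i)\<^sup>2) + (\<Sum>i<n. \<Sum>j\<in>{i<..<n}. w i - w j)) *s v"
    using casimir_highest_weight[OF v(1) v(5) v(4)] v(3) by simp
  ultimately show ?thesis
    using v(2) by auto
qed

end

section \<open>The eigenvalue formula\<close>

lemma sequence_eqI_differences:
  fixes a b :: "nat \<Rightarrow> 'a::field_char_0"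
  assumes diff: "\<And>i. Suc i < n \<Longrightarrow> a i - a (Suc i) = b i - b (Suc i)"
    and sum: "(\<Sum>i<n. a i) = (\<Sum>i<n. b i)" and "i < n"
  shows "a i = b i"
proof -
  have const: "a i - b i = a 0 - b 0" if "i < n" for i
    using that
  proof (induction i)
    case (Suc i)
    then have "a i - b i = a 0 - b 0" "a i - a (Suc i) = b i - b (Suc i)"
      using diff by auto
    moreover have "a (Suc i) - b (Suc i) = (a i - b i) - ((a i - a (Suc i)) - (b i - b (Suc i)))"
      by (simp add: algebra_simps)
    ultimately show ?case
      by (simp only: diff_self diff_zero)
  qed simp
  have "(\<Sum>i<n. a i - b i) = of_nat n * (a 0 - b 0)"
  proof -
    have "(\<Sum>i<n. a i - b i) = (\<Sum>i<n. a 0 - b 0)"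
      by (rule sum.cong[OF refl]) (rule const, simp)
    then show ?thesis by simp
  qed
  then have "a 0 = b 0"
    using sum \<open>i < n\<close> by (simp add: sum_subtractf)
  then show ?thesis
    using const[OF \<open>i < n\<close>] by simp
qed

text \<open>Index i occurs in n - 1 - i pairs as the smaller and in i pairs as the larger one. The
  difference n - 1 - 2i is twice the i-th coordinate of half the sum of the positive roots.\<close>

lemma sum_pair_differences:
  fixes w :: "nat \<Rightarrow> 'a::comm_ring_1"
  shows "(\<Sum>i<n. \<Sum>j\<in>{i<..<n}. w i - w j) = (\<Sum>i<n. (of_nat n - 1 - 2 * of_nat i) * w i)"
proof (induction n)
  case (Suc n)
  have "{i<..<Suc n} = insert n {i<..<n}" if "i < n" for i
    using that by auto
  then have "(\<Sum>i<n. \<Sum>j\<in>{i<..<Suc n}. w i - w j) = (\<Sum>i<n. (w i - w n) + (\<Sum>j\<in>{i<..<n}. w i - w j))"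
    by (intro sum.cong) simp_all
  moreover have "{n<..<Suc n} = {}"
    by auto
  ultimately have "(\<Sum>i<Suc n. \<Sum>j\<in>{i<..<Suc n}. w i - w j) = (\<Sum>i<n. w i) - of_nat n * w n + (\<Sum>i<n. \<Sum>j\<in>{i<..<n}. w i - w j)"
    unfolding sum.lessThan_Suc by (simp add: sum.distrib) (simp add: sum_subtractf)
  also have "\<dots> = (\<Sum>i<n. w i + (of_nat n - 1 - 2 * of_nat i) * w i) - of_nat n * w n"
    unfolding Suc by (simp add: sum.distrib)
  also have "\<dots> = (\<Sum>i<Suc n. (of_nat (Suc n) - 1 - 2 * of_nat i) * w i)"
    by (simp add: algebra_simps)
  finally show ?case .
qed simp

text \<open>
  The point \<open>y\<close> is the shifted weight in the coordinates of the diagonal matrices, that is,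
  the highest weight plus half the sum of the positive roots.
\<close>

lemma eigval_of_weight:
  fixes w :: "nat \<Rightarrow> complex"
  assumes l: "l \<ge> 1" and \<gamma>: "\<gamma> > 0"
    and diff: "\<And>i. i < l \<Longrightarrow> w i - w (Suc i) = of_nat (\<nu> (Suc i)) - 1"
    and sum: "(\<Sum>i<l + 1. w i) = 0"
  shows "of_real (eigval l \<gamma> \<nu>) = of_real (1 / (2 * (real l + 1) * \<gamma>)) *
    ((\<Sum>i<l + 1. (w i)\<^sup>2) + (\<Sum>i<l + 1. \<Sum>j\<in>{i<..<l + 1}. w i - w j))"
proof -
  define n where "n = l + 1"
  \<comment> \<open>The j-th fundamental weight has coordinates 1 - j/n for i < j and -j/n
    otherwise; \<open>y\<close> is the combination of these weights with coefficients
    \<open>\<nu> j\<close>.\<close>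
  define y where "y i = (\<Sum>j=1..l. ((if i < j then real n else 0) - real j) * real (\<nu> j)) / real n" for i
  define \<rho> where "\<rho> i = (real l - 2 * real i) / 2" for i
  have n: "real n = real l + 1" "real n \<noteq> 0"
    unfolding n_def by simp_all
  have y_diff: "y i - y (Suc i) = real (\<nu> (Suc i))" if "i < l" for i
  proof -
    have "y i - y (Suc i) = (\<Sum>j=1..l. (if j = Suc i then real n * real (\<nu> j) else 0)) / real n"
      unfolding y_def diff_divide_distrib[symmetric] sum_subtractf[symmetric]
      by (intro arg_cong2[where f="(/)"] sum.cong) (auto simp: algebra_simps)
    then show ?thesis
      using that n by simp
  qed
  have y_sum: "(\<Sum>i<n. y i) = 0"
  proof -
    have "(\<Sum>i<n. y i) = (\<Sum>i<n. \<Sum>j=1..l. ((if i < j then real n else 0) - real j) * real (\<nu> j)) / real n"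
      unfolding y_def by (simp add: sum_divide_distrib)
    also have "\<dots> = (\<Sum>j=1..l. (\<Sum>i<n. (if i < j then real n else 0) - real j) * real (\<nu> j)) / real n"
      by (subst sum.swap) (simp add: sum_distrib_right)
    also have "(\<Sum>i<n. (if i < j then real n else 0) - real j) = 0" if "j \<in> {1..l}" for j
    proof -
      have "{..<n} \<inter> {i. i < j} = {..<j}"
        using that by (auto simp: n_def)
      then have "(\<Sum>i<n. if i < j then real n else 0) = real j * real n"
        by (simp add: sum.If_cases)
      then show ?thesis
        by (simp add: sum_subtractf)
    qed
    then have "(\<Sum>j=1..l. (\<Sum>i<n. (if i < j then real n else 0) - real j) * real (\<nu> j)) = 0"
      by simp
    finally show ?thesis by simp
  qed
  have \<rho>_sum: "(\<Sum>i<n. \<rho> i) = 0"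
  proof -
    have "(\<Sum>i<m. real l - 2 * real i) = real m * (real l + 1 - real m)" for m
      by (induction m) (auto simp: algebra_simps)
    then have "(\<Sum>i<n. real l - 2 * real i) = 0"
      using n by simp
    then show ?thesis
      by (simp add: \<rho>_def sum_divide_distrib[symmetric])
  qed
  \<comment> \<open>Both tuples have sum zero and the same consecutive differences
    \<open>\<nu> (Suc i) - 1\<close>.\<close>
  have w: "w i = of_real (y i - \<rho> i)" if "i < n" for i
  proof (rule sequence_eqI_differences[OF _ _ that])
    show "w i - w (Suc i) = of_real (y i - \<rho> i) - of_real (y (Suc i) - \<rho> (Suc i))" if "Suc i < n" for i
    proof -
      have "i < l" using that by (simp add: n_def)
      have "complex_of_real (y i - \<rho> i) - of_real (y (Suc i) - \<rho> (Suc i)) = of_real ((y i - y (Suc i)) - 1)"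
        unfolding of_real_diff[symmetric] by (rule arg_cong[where f=of_real]) (simp add: \<rho>_def field_simps)
      then show ?thesis
        using diff[OF \<open>i < l\<close>] y_diff[OF \<open>i < l\<close>] by simp
    qed
    have "(\<Sum>i<n. complex_of_real (y i - \<rho> i)) = of_real ((\<Sum>i<n. y i) - (\<Sum>i<n. \<rho> i))"
      by (simp add: sum_subtractf)
    then show "(\<Sum>i<n. w i) = (\<Sum>i<n. of_real (y i - \<rho> i))"
      using sum[folded n_def] y_sum \<rho>_sum by simp
  qed
  have "(\<Sum>i<n. (w i)\<^sup>2) + (\<Sum>i<n. \<Sum>j\<in>{i<..<n}. w i - w j) = (\<Sum>i<n. (w i)\<^sup>2 + (of_nat n - 1 - 2 * of_nat i) * w i)"
    unfolding sum_pair_differences by (simp add: sum.distrib)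
  \<comment> \<open>Completing the square: with w = y - \<rho>, the expression w^2 + 2 \<rho> w
    equals y^2 - \<rho>^2.\<close>
  also have "\<dots> = (\<Sum>i<n. of_real ((y i)\<^sup>2 - (\<rho> i)\<^sup>2))"
  proof (intro sum.cong refl)
    fix i assume "i \<in> {..<n}"
    then have "(w i)\<^sup>2 + (of_nat n - 1 - 2 * of_nat i) * w i = of_real ((y i - \<rho> i)\<^sup>2 + (real n - 1 - 2 * real i) * (y i - \<rho> i))"
      using w by simp
    also have "real n - 1 - 2 * real i = 2 * \<rho> i"
      using n by (simp add: \<rho>_def)
    also have "(y i - \<rho> i)\<^sup>2 + 2 * \<rho> i * (y i - \<rho> i) = (y i)\<^sup>2 - (\<rho> i)\<^sup>2"
      by (simp add: power2_eq_square algebra_simps)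
    finally show "(w i)\<^sup>2 + (of_nat n - 1 - 2 * of_nat i) * w i = of_real ((y i)\<^sup>2 - (\<rho> i)\<^sup>2)" .
  qed
  also have "\<dots> = of_real ((\<Sum>i<n. (y i)\<^sup>2) - (\<Sum>i<n. (\<rho> i)\<^sup>2))"
    by (simp add: sum_subtractf)
  finally have rhs: "(\<Sum>i<n. (w i)\<^sup>2) + (\<Sum>i<n. \<Sum>j\<in>{i<..<n}. w i - w j) = complex_of_real ((\<Sum>i<n. (y i)\<^sup>2) - (\<Sum>i<n. (\<rho> i)\<^sup>2))" .
  have y_split: "real n * y i = - (\<Sum>j=1..i. real j * real (\<nu> j)) + (\<Sum>j=Suc i..l. (real l + 1 - real j) * real (\<nu> j))"
    if "i \<le> l" for i
  proof -
    have split: "{1..l} = {1..i} \<union> {Suc i..l}" and disj: "{1..i} \<inter> {Suc i..l} = {}"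
      using that by auto
    have "real n * y i = (\<Sum>j\<in>{1..l}. ((if i < j then real n else 0) - real j) * real (\<nu> j))"
      using n by (simp add: y_def)
    also have "\<dots> = (\<Sum>j=1..i. ((if i < j then real n else 0) - real j) * real (\<nu> j))
        + (\<Sum>j=Suc i..l. ((if i < j then real n else 0) - real j) * real (\<nu> j))"
      unfolding split by (rule sum.union_disjoint[OF _ _ disj]) simp_all
    also have "(\<Sum>j=1..i. ((if i < j then real n else 0) - real j) * real (\<nu> j)) = (\<Sum>j=1..i. - (real j * real (\<nu> j)))"
      by (rule sum.cong) auto
    also have "(\<Sum>j=Suc i..l. ((if i < j then real n else 0) - real j) * real (\<nu> j)) = (\<Sum>j=Suc i..l. (real l + 1 - real j) * real (\<nu> j))"
      by (rule sum.cong) (auto simp: n)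
    finally show ?thesis
      by (simp add: sum_negf)
  qed
  \<comment> \<open>The squares of n y_0, of n y_(k-1) for k = 2, ..., l, and of n y_l are the three
    kinds of squares in the formula; the shift from k to k - 1 comes from counting coordinates from
    0.\<close>
  have "(\<Sum>i\<in>{1..<l}. (real n * y i)\<^sup>2) = (\<Sum>k=2..l. (real n * y (k - 1))\<^sup>2)"
    by (rule sum.reindex_bij_witness[of _ "\<lambda>k. k - 1" Suc]) auto
  also have "\<dots> = (\<Sum>k=2..l. (- (\<Sum>j=1..k-1. real j * real (\<nu> j)) + (\<Sum>j=k..l. (real l + 1 - real j) * real (\<nu> j)))\<^sup>2)"
    by (intro sum.cong refl) (auto simp: y_split Suc_diff_le)
  finally have inner: "(\<Sum>i\<in>{1..<l}. (real n * y i)\<^sup>2) = (\<Sum>k=2..l. (- (\<Sum>j=1..k-1. real j * real (\<nu> j)) + (\<Sum>j=k..l. (real l + 1 - real j) * real (\<nu> j)))\<^sup>2)" .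
  have "(real n)\<^sup>2 * (\<Sum>i<n. (y i)\<^sup>2) = (\<Sum>i<Suc l. (real n * y i)\<^sup>2)"
    by (simp add: sum_distrib_left power_mult_distrib n_def distrib_left)
  also have "\<dots> = (real n * y 0)\<^sup>2 + (\<Sum>i\<in>{1..<l}. (real n * y i)\<^sup>2) + (real n * y l)\<^sup>2"
  proof -
    have "{..<Suc l} = insert 0 (insert l {1..<l})"
      using l by auto
    then show ?thesis
      using l by simp
  qed
  finally have Y: "(real n)\<^sup>2 * (\<Sum>i<n. (y i)\<^sup>2) = (\<Sum>j=1..l. (real l + 1 - real j) * real (\<nu> j))\<^sup>2
      + (\<Sum>k=2..l. (- (\<Sum>j=1..k-1. real j * real (\<nu> j)) + (\<Sum>j=k..l. (real l + 1 - real j) * real (\<nu> j)))\<^sup>2)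
      + (\<Sum>j=1..l. real j * real (\<nu> j))\<^sup>2"
    unfolding inner by (simp add: y_split)
  \<comment> \<open>Since \<open>\<rho> i\<close> is (l - 2i)/2, the subtracted term of the formula
    is n^2 times the squared length of \<rho>.\<close>
  have "(\<Sum>k=1..l+1. (real l - 2 * (real k - 1))\<^sup>2 * (real l + 1)\<^sup>2) = (\<Sum>i<n. (real l - 2 * real i)\<^sup>2 * (real n)\<^sup>2)"
    by (rule sum.reindex_bij_witness[of _ Suc "\<lambda>k. k - 1"]) (auto simp: n_def of_nat_diff)
  also have "\<dots> = 4 * ((real n)\<^sup>2 * (\<Sum>i<n. (\<rho> i)\<^sup>2))"
    by (simp add: \<rho>_def sum_distrib_left power_divide mult.commute)
  finally have R: "1 / 4 * (\<Sum>k=1..l+1. (real l - 2 * (real k - 1))\<^sup>2 * (real l + 1)\<^sup>2) = (real n)\<^sup>2 * (\<Sum>i<n. (\<rho> i)\<^sup>2)"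
    by simp
  have "eigval l \<gamma> \<nu> = 1 / (2 * (real n) ^ 3 * \<gamma>) * ((real n)\<^sup>2 * (\<Sum>i<n. (y i)\<^sup>2) - (real n)\<^sup>2 * (\<Sum>i<n. (\<rho> i)\<^sup>2))"
    by (simp only: eigval_def R flip: Y) (simp add: n)
  also have "\<dots> = 1 / (2 * real n * \<gamma>) * ((\<Sum>i<n. (y i)\<^sup>2) - (\<Sum>i<n. (\<rho> i)\<^sup>2))"
  proof -
    have "1 / (2 * (real n) ^ 3 * \<gamma>) * ((real n)\<^sup>2 * A - (real n)\<^sup>2 * B) = 1 / (2 * real n * \<gamma>) * (A - B)" for A B
    proof -
      have "(real n)\<^sup>2 * A - (real n)\<^sup>2 * B = (real n)\<^sup>2 * (A - B)"
        by (simp add: algebra_simps)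
      then show ?thesis
        using n(2) by (simp add: power3_eq_cube power2_eq_square)
    qed
    then show ?thesis .
  qed
  finally show ?thesis
    using rhs n by (simp add: n_def)
qed

section \<open>Approximately invariant means\<close>

text \<open>Hall's theorem. If some nonempty proper subset J has exactly as many neighbours as
  elements, J is matched first; the rest still satisfies the condition after the neighbours of J are
  removed, as seen by adding J to a subset. Without such a J every nonempty proper subset has a
  neighbour to spare, so any single pair can be matched and its value removed.\<close>

lemma marriage:
  fixes N :: "'a \<Rightarrow> 'b set"
  assumes "finite I" and "\<And>i. i \<in> I \<Longrightarrow> finite (N i)"
    and "\<And>J. J \<subseteq> I \<Longrightarrow> card J \<le> card (\<Union>(N ` J))"
  shows "\<exists>f. inj_on f I \<and> (\<forall>i\<in>I. f i \<in> N i)"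
  using assms
proof (induction "card I" arbitrary: I N rule: less_induct)
  case less
  note fin = \<open>finite I\<close> and finN = less.prems(2) and hall = less.prems(3)
  show ?case
  proof (cases "I = {}")
    case False
    show ?thesis
    proof (cases "\<exists>J. J \<subset> I \<and> J \<noteq> {} \<and> card (\<Union>(N ` J)) = card J")
      case True
      then obtain J where J: "J \<subset> I" "J \<noteq> {}" "card (\<Union>(N ` J)) = card J" by blast
      have finJ: "finite J" "finite (I - J)" and finNJ: "finite (\<Union>(N ` J))"
        using J fin finN by (auto dest: finite_subset)
      have "card J < card I"
        using J fin by (simp add: psubset_card_mono)
      then have "\<exists>f. inj_on f J \<and> (\<forall>i\<in>J. f i \<in> N i)"
        by (rule less.hyps) (use J finJ finN hall in auto)
      then obtain f where f: "inj_on f J" "\<forall>i\<in>J. f i \<in> N i"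
        by blast
      let ?N = "\<lambda>i. N i - \<Union>(N ` J)"
      have "card (I - J) < card I"
        using J fin by (intro psubset_card_mono) auto
      moreover have "card L \<le> card (\<Union>(?N ` L))" if L: "L \<subseteq> I - J" for L
      proof -
        have finL: "finite L"
          using L fin by (auto intro: finite_subset)
        have "card L + card J = card (L \<union> J)"
          using L finL finJ by (subst card_Un_disjoint) auto
        also have "\<dots> \<le> card (\<Union>(N ` (L \<union> J)))"
          using L J by (intro hall) auto
        also have "\<Union>(N ` (L \<union> J)) = \<Union>(?N ` L) \<union> \<Union>(N ` J)"
          by auto
        also have "card \<dots> \<le> card (\<Union>(?N ` L)) + card (\<Union>(N ` J))"
          by (rule card_Un_le)
        finally show ?thesis
          using J by simp
      qed
      ultimately have "\<exists>g. inj_on g (I - J) \<and> (\<forall>i\<in>I - J. g i \<in> ?N i)"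
        by (intro less.hyps) (use finJ finN in auto)
      then obtain g where g: "inj_on g (I - J)" "\<forall>i\<in>I - J. g i \<in> ?N i"
        by blast
      let ?f = "\<lambda>i. if i \<in> J then f i else g i"
      have "inj_on ?f I"
      proof (rule inj_onI)
        fix i j assume ij: "i \<in> I" "j \<in> I" "?f i = ?f j"
        have disj: "f a \<noteq> g b" if "a \<in> J" "b \<in> I - J" for a b
          using f(2) g(2) that by (metis DiffD2 UN_I)
        show "i = j"
          using ij disj[of i j] disj[of j i] f(1) g(1)
          by (cases "i \<in> J"; cases "j \<in> J") (auto simp: inj_on_def)
      qed
      moreover have "\<forall>i\<in>I. ?f i \<in> N i"
        using f g by auto
      ultimately show ?thesis by blast
    next
      case tight: False
      obtain i where i: "i \<in> I" using False by blast
      have "card {i} \<le> card (N i)"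
        using hall[of "{i}"] i by simp
      then obtain x where x: "x \<in> N i"
        by fastforce
      let ?N = "\<lambda>j. N j - {x}"
      have "card L \<le> card (\<Union>(?N ` L))" if L: "L \<subseteq> I - {i}" for L
      proof (cases "L = {}")
        case False
        then have "card L \<noteq> card (\<Union>(N ` L))"
        proof -
          have "L \<subset> I"
            using L i by blast
          then show ?thesis
            using tight \<open>L \<noteq> {}\<close> by metis
        qed
        then have "card L < card (\<Union>(N ` L))"
          using hall[of L] L by force
        moreover have "\<Union>(?N ` L) = \<Union>(N ` L) - {x}"
          by auto
        moreover have "card (\<Union>(N ` L)) - 1 \<le> card (\<Union>(N ` L) - {x})"
          by (simp add: card_Diff_singleton_if)
        ultimately show ?thesis by simp
      qed simp
      moreover have "card (I - {i}) < card I"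
        using fin i by (rule card_Diff1_less)
      ultimately have "\<exists>g. inj_on g (I - {i}) \<and> (\<forall>j\<in>I - {i}. g j \<in> ?N j)"
        by (intro less.hyps) (use fin finN in auto)
      then obtain g where g: "inj_on g (I - {i})" "\<forall>j\<in>I - {i}. g j \<in> ?N j"
        by blast
      let ?f = "g(i := x)"
      have "inj_on ?f I"
        using g by (auto simp: inj_on_def)
      moreover have "\<forall>j\<in>I. ?f j \<in> N j"
        using g x by auto
      ultimately show ?thesis by blast
    qed
  qed simp
qed

section \<open>Minimal nets and averages over them\<close>

definition is_net :: "'a::metric_space set \<Rightarrow> real \<Rightarrow> 'a set \<Rightarrow> bool" where
  "is_net K e E \<longleftrightarrow> finite E \<and> E \<subseteq> K \<and> (\<forall>x\<in>K. \<exists>y\<in>E. dist x y < e)"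

definition is_minimal_net :: "'a::metric_space set \<Rightarrow> real \<Rightarrow> 'a set \<Rightarrow> bool" where
  "is_minimal_net K e E \<longleftrightarrow> is_net K e E \<and> (\<forall>E'. is_net K e E' \<longrightarrow> card E \<le> card E')"

definition net_average :: "'a set \<Rightarrow> ('a \<Rightarrow> complex) \<Rightarrow> complex" where
  "net_average E h = (\<Sum>x\<in>E. h x) / of_nat (card E)"

lemma exists_minimal_net:
  assumes "compact K" "e > 0"
  shows "\<exists>E. is_minimal_net K e E"
proof -
  obtain E where "finite E" "E \<subseteq> K" "K \<subseteq> (\<Union>x\<in>E. ball x e)"
    using compactE_image[OF \<open>compact K\<close>, of K "\<lambda>x. ball x e"] \<open>e > 0\<close> by force
  then have "is_net K e E"
    unfolding is_net_def by (force simp: dist_commute)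
  then show ?thesis
    unfolding is_minimal_net_def by (rule ex_has_least_nat)
qed

text \<open>
  By minimality two minimal nets satisfy the marriage condition for the relation of having
  overlapping balls: points of a net can be exchanged for their neighbours in the other net.
\<close>

lemma minimal_nets_matching:
  assumes E: "is_minimal_net K e E" and E': "is_minimal_net K e E'"
  shows "\<exists>f. bij_betw f E E' \<and> (\<forall>x\<in>E. dist x (f x) < 2 * e)"
proof -
  have fin: "finite E" "finite E'" and sub: "E \<subseteq> K" "E' \<subseteq> K"
    using E E' by (auto simp: is_minimal_net_def is_net_def)
  define N where "N x = {y\<in>E'. \<exists>z\<in>K. dist z x < e \<and> dist z y < e}" for x
  have "card J \<le> card (\<Union>(N ` J))" if J: "J \<subseteq> E" for J
  proof -
    have finN: "finite (\<Union>(N ` J))"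
      using fin J by (auto simp: N_def intro: finite_subset)
    \<comment> \<open>Exchanging J for its neighbours keeps a net: if z was covered by x in J, any
      point of \<open>E'\<close> covering z lies in \<open>N x\<close>. Minimality of
      \<open>E\<close> then gives the marriage condition.\<close>
    have "is_net K e ((E - J) \<union> \<Union>(N ` J))"
      unfolding is_net_def
    proof (intro conjI ballI)
      show "E - J \<union> \<Union>(N ` J) \<subseteq> K"
        using sub by (auto simp: N_def)
      fix z assume z: "z \<in> K"
      then obtain x y where "x \<in> E" "dist z x < e" "y \<in> E'" "dist z y < e"
        using E E' unfolding is_minimal_net_def is_net_def by meson
      then show "\<exists>y\<in>E - J \<union> \<Union>(N ` J). dist z y < e"
        using z by (cases "x \<in> J") (auto simp: N_def)
    qed (use fin finN in auto)
    then have "card E \<le> card ((E - J) \<union> \<Union>(N ` J))"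
      using E by (simp add: is_minimal_net_def)
    also have "\<dots> \<le> card (E - J) + card (\<Union>(N ` J))"
      by (rule card_Un_le)
    also have "card (E - J) = card E - card J"
      using J fin by (meson card_Diff_subset finite_subset)
    finally show ?thesis
      using card_mono[OF fin(1) J] by linarith
  qed
  then obtain f where f: "inj_on f E" "\<forall>x\<in>E. f x \<in> N x"
    using marriage[of E N] fin by (auto simp: N_def)
  have "card E = card E'"
    using E E' by (auto simp: is_minimal_net_def intro: antisym)
  moreover have "f ` E \<subseteq> E'"
    using f(2) by (auto simp: N_def)
  ultimately have "f ` E = E'"
    using f(1) fin by (metis card_image card_subset_eq)
  moreover have "dist x (f x) < 2 * e" if x: "x \<in> E" for x
  proof -
    obtain z where "dist z x < e" "dist z (f x) < e"
      using f(2) x by (auto simp: N_def)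
    then show ?thesis
      using dist_triangle3[of x "f x" z] by linarith
  qed
  ultimately show ?thesis
    using f(1) by (auto simp: bij_betw_def)
qed

lemma net_average_norm_le:
  assumes "\<And>x. x \<in> E \<Longrightarrow> norm (h x) \<le> c" "c \<ge> 0"
  shows "norm (net_average E h) \<le> c"
proof (cases "card E = 0")
  case False
  have "norm (\<Sum>x\<in>E. h x) \<le> (\<Sum>x\<in>E. c)"
    using assms by (intro sum_norm_le) auto
  then show ?thesis
    using False by (simp add: net_average_def norm_divide field_simps)
qed (use assms in \<open>simp add: net_average_def\<close>)

lemma net_average_add: "net_average E (\<lambda>x. f x + g x) = net_average E f + net_average E g"
  by (simp add: net_average_def sum.distrib add_divide_distrib)

lemma net_average_diff: "net_average E (\<lambda>x. f x - g x) = net_average E f - net_average E g"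
  by (simp add: net_average_def sum_subtractf diff_divide_distrib)

lemma net_average_cmult: "net_average E (\<lambda>x. c * f x) = c * net_average E f"
  by (simp add: net_average_def sum_distrib_left)

text \<open>Matched points are closer than 2e, so the averages differ by at most the variation of
  \<open>h\<close> at this scale.\<close>

lemma net_average_minimal_nets:
  assumes E: "is_minimal_net K e E" and E': "is_minimal_net K e E'"
    and h: "\<And>x y. x \<in> K \<Longrightarrow> y \<in> K \<Longrightarrow> dist x y < 2 * e \<Longrightarrow> norm (h x - h y) \<le> c" and "c \<ge> 0"
  shows "norm (net_average E h - net_average E' h) \<le> c"
proof -
  obtain f where f: "bij_betw f E E'" "\<forall>x\<in>E. dist x (f x) < 2 * e"
    using minimal_nets_matching[OF E E'] by blast
  have sub: "E \<subseteq> K" "E' \<subseteq> K"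
    using E E' by (auto simp: is_minimal_net_def is_net_def)
  have "net_average E' h = net_average E (h \<circ> f)"
    using f(1) by (simp add: net_average_def bij_betw_same_card[OF f(1)] sum.reindex_bij_betw[symmetric, OF f(1)])
  then have "net_average E h - net_average E' h = net_average E (\<lambda>x. h x - h (f x))"
    by (simp add: net_average_diff comp_def)
  also have "norm \<dots> \<le> c"
    using f sub \<open>c \<ge> 0\<close> by (intro net_average_norm_le h) (auto simp: bij_betw_def)
  finally show ?thesis .
qed

section \<open>Means on a compact space with a transitive set of isometries\<close>

locale homogeneous_compact =
  fixes K :: "'a::metric_space set" and \<Gamma> :: "('a \<Rightarrow> 'a) set"
  assumes compact: "compact K" and nonempty: "K \<noteq> {}"
    and onto: "\<And>g. g \<in> \<Gamma> \<Longrightarrow> g ` K = K"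
    and isometry: "\<And>g x y. g \<in> \<Gamma> \<Longrightarrow> x \<in> K \<Longrightarrow> y \<in> K \<Longrightarrow> dist (g x) (g y) = dist x y"
    and transitive: "\<And>x y. x \<in> K \<Longrightarrow> y \<in> K \<Longrightarrow> \<exists>g\<in>\<Gamma>. g x = y"
begin

text \<open>One minimal net is chosen for every radius 1/(k+1); the means of one function along
  different choices differ by a null sequence if it is continuous, but they are not claimed to
  converge.\<close>

definition mean :: "nat \<Rightarrow> ('a \<Rightarrow> complex) \<Rightarrow> complex" where
  "mean k = net_average (SOME E. is_minimal_net K (1 / real (Suc k)) E)"

lemma mean_net: "\<exists>E. is_minimal_net K (1 / real (Suc k)) E \<and> mean k = net_average E"
proof -
  have "is_minimal_net K (1 / real (Suc k)) (SOME E. is_minimal_net K (1 / real (Suc k)) E)"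
    by (rule someI_ex, rule exists_minimal_net[OF compact]) simp
  then show ?thesis
    unfolding mean_def by blast
qed

lemma mean_add: "mean k (\<lambda>x. f x + g x) = mean k f + mean k g"
  by (simp add: mean_def net_average_add)

lemma mean_diff: "mean k (\<lambda>x. f x - g x) = mean k f - mean k g"
  by (simp add: mean_def net_average_diff)

lemma mean_cmult: "mean k (\<lambda>x. c * f x) = c * mean k f"
  by (simp add: mean_def net_average_cmult)

lemma mean_zero: "mean k (\<lambda>x. 0) = 0"
  using mean_cmult[of k 0] by simp

lemma mean_sum: "mean k (\<lambda>x. \<Sum>i\<in>I. f i x) = (\<Sum>i\<in>I. mean k (f i))"
  by (induction I rule: infinite_finite_induct) (simp_all add: mean_zero mean_add)

lemma mean_cong:
  assumes "\<And>x. x \<in> K \<Longrightarrow> f x = g x"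
  shows "mean k f = mean k g"
proof -
  obtain E where "is_minimal_net K (1 / real (Suc k)) E" and m: "mean k = net_average E"
    using mean_net by blast
  then have "E \<subseteq> K"
    by (auto simp: is_minimal_net_def is_net_def)
  then show ?thesis
    unfolding m net_average_def using assms by (auto intro!: arg_cong2[where f="(/)"] sum.cong)
qed

lemma mean_norm_le:
  assumes "\<And>x. x \<in> K \<Longrightarrow> norm (h x) \<le> c"
  shows "norm (mean k h) \<le> c"
proof -
  obtain E where E: "is_minimal_net K (1 / real (Suc k)) E" "mean k = net_average E"
    using mean_net by blast
  have "c \<ge> 0"
    using nonempty assms norm_ge_zero order_trans by blast
  with E show ?thesis
    using assms by (auto simp: is_minimal_net_def is_net_def intro!: net_average_norm_le)
qed

lemma Re_mean_ge:
  assumes "\<And>x. x \<in> K \<Longrightarrow> Re (h x) \<ge> c"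
  shows "Re (mean k h) \<ge> c"
proof -
  obtain E where E: "is_minimal_net K (1 / real (Suc k)) E" and m: "mean k = net_average E"
    using mean_net by blast
  then have EK: "finite E" "E \<subseteq> K"
    by (auto simp: is_minimal_net_def is_net_def)
  have "E \<noteq> {}"
    using E nonempty by (auto simp: is_minimal_net_def is_net_def)
  then have pos: "card E > 0"
    using EK by (simp add: card_gt_0_iff)
  have "(\<Sum>x\<in>E. c) \<le> (\<Sum>x\<in>E. Re (h x))"
    using EK assms by (intro sum_mono) auto
  then show ?thesis
    using pos by (simp add: m net_average_def Re_divide_of_nat pos_le_divide_eq mult.commute)
qed

text \<open>An isometry of \<open>K\<close> onto itself carries minimal nets to minimal nets, so
  both terms are averages of \<open>h\<close> over minimal nets of the same radius; uniform
  continuity of \<open>h\<close> makes their difference small.\<close>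

lemma mean_invariant:
  assumes h: "continuous_on K h" and g: "g \<in> \<Gamma>"
  shows "(\<lambda>k. mean k (h \<circ> g) - mean k h) \<longlonglongrightarrow> 0"
proof (rule LIMSEQ_I)
  fix c :: real assume "c > 0"
  then obtain d where d: "d > 0" "\<And>x y. x \<in> K \<Longrightarrow> y \<in> K \<Longrightarrow> dist x y < d \<Longrightarrow> dist (h x) (h y) < c / 2"
    using compact_uniformly_continuous[OF h compact] unfolding uniformly_continuous_on_def
    by (metis half_gt_zero)
  obtain k0 :: nat where k0: "2 / d < real k0"
    using reals_Archimedean2 by blast
  have "norm (mean k (h \<circ> g) - mean k h) < c" if k: "k \<ge> k0" for k
  proof -
    define e where "e = 1 / real (Suc k)"
    have "2 / d < real (Suc k)"
      using k k0 by linarith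
    then have e: "2 * e < d"
      using d(1) by (simp add: e_def field_simps)
    obtain E where E: "is_minimal_net K e E" and m: "mean k = net_average E"
      using mean_net unfolding e_def by blast
    have E': "finite E" "E \<subseteq> K"
      using E by (auto simp: is_minimal_net_def is_net_def)
    have inj: "inj_on g E"
      using isometry[OF g] E'(2) by (force intro!: inj_onI simp: subset_iff)
    have "is_net K e (g ` E)"
      unfolding is_net_def
    proof (intro conjI ballI)
      show "g ` E \<subseteq> K"
        using onto[OF g] E' by blast
      fix y assume "y \<in> K"
      then obtain x where x: "x \<in> K" "y = g x"
        using onto[OF g] by blast
      then obtain z where "z \<in> E" "dist x z < e"
        using E unfolding is_minimal_net_def is_net_def by blast
      then show "\<exists>z\<in>g ` E. dist y z < e"
        using x E' isometry[OF g x(1), of z] by (intro bexI[of _ "g z"]) auto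
    qed (use E' in simp)
    then have gE: "is_minimal_net K e (g ` E)"
      using E card_image[OF inj] by (auto simp: is_minimal_net_def)
    have "net_average E (h \<circ> g) = net_average (g ` E) h"
      using inj by (simp add: net_average_def sum.reindex card_image)
    moreover have "norm (net_average (g ` E) h - net_average E h) \<le> c / 2"
      using d(2) e \<open>c > 0\<close> by (intro net_average_minimal_nets[OF gE E]) (auto simp: dist_norm less_imp_le)
    ultimately show ?thesis
      using \<open>c > 0\<close> by (simp add: m)
  qed
  then show "\<exists>k0. \<forall>k\<ge>k0. norm (mean k (h \<circ> g) - mean k h - 0) < c"
    by auto
qed

text \<open>By transitivity the sets where a translate of \<open>h\<close> is positive cover
  \<open>K\<close>. Finitely many of them already do, and the sum of these translates has a positive
  minimum, which bounds its means from below. By invariance the mean of each translate would tend to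
  zero with that of \<open>h\<close>.\<close>

lemma mean_faithful:
  assumes h: "continuous_on K h" and nonneg: "\<And>x. x \<in> K \<Longrightarrow> h x \<ge> (0::real)"
    and x0: "x0 \<in> K" "h x0 \<noteq> 0"
  shows "\<not> (\<lambda>k. mean k (\<lambda>x. of_real (h x))) \<longlonglongrightarrow> 0"
proof
  assume lim: "(\<lambda>k. mean k (\<lambda>x. of_real (h x))) \<longlonglongrightarrow> 0"
  have cont_g: "continuous_on K g" if "g \<in> \<Gamma>" for g
    unfolding continuous_on_iff using isometry[OF that] by metis
  have cont_hg: "continuous_on K (h \<circ> g)" if "g \<in> \<Gamma>" for g
    using continuous_on_compose[OF cont_g[OF that]] h onto[OF that] by simp
  have "\<exists>U. open U \<and> {x\<in>K. h (g x) > 0} = U \<inter> K" if "g \<in> \<Gamma>" for g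
  proof -
    have "openin (top_of_set K) (K \<inter> (h \<circ> g) -` {0<..})"
      by (intro continuous_openin_preimage_gen[OF cont_hg[OF that]]) simp
    then obtain U where "open U" "K \<inter> (h \<circ> g) -` {0<..} = K \<inter> U"
      unfolding openin_open by blast
    then show ?thesis
      by (intro exI[of _ U]) auto
  qed
  then obtain U where U: "\<And>g. g \<in> \<Gamma> \<Longrightarrow> open (U g)" "\<And>g. g \<in> \<Gamma> \<Longrightarrow> {x\<in>K. h (g x) > 0} = U g \<inter> K"
    by metis
  have "K \<subseteq> \<Union>(U ` \<Gamma>)"
  proof
    fix x assume x: "x \<in> K"
    then obtain g where g: "g \<in> \<Gamma>" "g x = x0"
      using transitive x0 by blast
    then have "x \<in> {x\<in>K. h (g x) > 0}"
      using x x0 nonneg[OF x0(1)] by simp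
    then show "x \<in> \<Union>(U ` \<Gamma>)"
      using U(2)[OF g(1)] g(1) by auto
  qed
  then obtain D where D: "D \<subseteq> \<Gamma>" "finite D" "K \<subseteq> \<Union>(U ` D)"
    using U(1) by (elim compactE_image[OF compact, of \<Gamma> U, rotated]) auto
  let ?H = "\<lambda>x. \<Sum>g\<in>D. h (g x)"
  have "continuous_on K ?H"
    using cont_hg D by (intro continuous_on_sum) (auto simp: comp_def)
  then obtain z where z: "z \<in> K" "\<And>x. x \<in> K \<Longrightarrow> ?H z \<le> ?H x"
    using continuous_attains_inf[OF compact nonempty] by blast
  have hg: "h (g x) \<ge> 0" if "g \<in> D" "x \<in> K" for g x
  proof -
    have "g x \<in> K"
      using onto[of g] that D by blast
    then show ?thesis
      by (rule nonneg)
  qed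
  obtain g where g: "g \<in> D" "z \<in> U g"
    using D z by blast
  then have "z \<in> {x\<in>K. h (g x) > 0}"
    using U(2)[of g] D z by (simp add: subset_iff)
  then have "h (g z) > 0"
    by simp
  then have pos: "?H z > 0"
    using g(1) D(2) hg[OF _ z(1)] by (intro sum_pos2[of D g]) simp_all
  have "(\<lambda>k. mean k (\<lambda>x. of_real (h (g x)))) \<longlonglongrightarrow> 0" if "g \<in> D" for g
  proof -
    have "(\<lambda>k. mean k ((\<lambda>x. of_real (h x)) \<circ> g) - mean k (\<lambda>x. of_real (h x))) \<longlonglongrightarrow> 0"
      using that D h by (intro mean_invariant continuous_on_of_real) auto
    from tendsto_add[OF this lim] show ?thesis
      by (simp add: comp_def)
  qed
  then have "(\<lambda>k. \<Sum>g\<in>D. mean k (\<lambda>x. of_real (h (g x)))) \<longlonglongrightarrow> 0"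
    by (rule tendsto_null_sum)
  then have "(\<lambda>k. mean k (\<lambda>x. of_real (?H x))) \<longlonglongrightarrow> 0"
    by (simp add: mean_sum)
  from tendsto_Re[OF this] have "(\<lambda>k. Re (mean k (\<lambda>x. of_real (?H x)))) \<longlonglongrightarrow> 0"
    by simp
  moreover have "Re (mean k (\<lambda>x. of_real (?H x))) \<ge> ?H z" for k
    by (rule Re_mean_ge) (use z in simp)
  ultimately have "?H z \<le> 0"
    by (intro LIMSEQ_le_const[where X="\<lambda>k. Re (mean k (\<lambda>x. of_real (?H x)))"]) auto
  then show False
    using pos by linarith
qed

end

section \<open>Polynomial functions and the matrix exponential\<close>

text \<open>\<open>bounded_linear\<close> is meant over the reals, so conjugates of matrix entries
  count as polynomials too, as the Stone-Weierstrass theorem requires.\<close>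

inductive cpoly :: "('a::real_normed_vector \<Rightarrow> complex) \<Rightarrow> bool" where
  cpoly_linear: "bounded_linear f \<Longrightarrow> cpoly f"
| cpoly_const: "cpoly (\<lambda>x. c)"
| cpoly_add: "cpoly f \<Longrightarrow> cpoly g \<Longrightarrow> cpoly (\<lambda>x. f x + g x)"
| cpoly_mult: "cpoly f \<Longrightarrow> cpoly g \<Longrightarrow> cpoly (\<lambda>x. f x * g x)"

lemma cpoly_has_derivative:
  "cpoly p \<Longrightarrow> \<exists>p'. (\<forall>x. (p has_derivative p' x) (at x)) \<and> (\<forall>v. cpoly (\<lambda>x. p' x v))"
proof (induction rule: cpoly.induct)
  case (cpoly_linear f)
  then show ?case
    by (intro exI[of _ "\<lambda>x. f"]) (auto intro: bounded_linear_imp_has_derivative cpoly.intros)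
next
  case (cpoly_const c)
  show ?case
    by (intro exI[of _ "\<lambda>x v. 0"]) (auto intro: cpoly.intros)
next
  case (cpoly_add f g)
  then obtain f' g' where "\<forall>x. (f has_derivative f' x) (at x)" "\<forall>v. cpoly (\<lambda>x. f' x v)"
    "\<forall>x. (g has_derivative g' x) (at x)" "\<forall>v. cpoly (\<lambda>x. g' x v)" by blast
  then show ?case
    by (intro exI[of _ "\<lambda>x v. f' x v + g' x v"]) (auto intro!: has_derivative_add cpoly.cpoly_add)
next
  case (cpoly_mult f g)
  then obtain f' g' where "\<forall>x. (f has_derivative f' x) (at x)" "\<forall>v. cpoly (\<lambda>x. f' x v)"
    "\<forall>x. (g has_derivative g' x) (at x)" "\<forall>v. cpoly (\<lambda>x. g' x v)" by blast
  with cpoly_mult.hyps show ?case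
    by (intro exI[of _ "\<lambda>x v. f x * g' x v + f' x v * g x"])
      (auto intro!: has_derivative_mult cpoly.cpoly_add cpoly.cpoly_mult)
qed

lemma cpoly_differentiable:
  assumes "cpoly p"
  shows "p differentiable (at x)" "cpoly (\<lambda>x. frechet_derivative p (at x) v)"
proof -
  obtain p' where p': "\<forall>x. (p has_derivative p' x) (at x)" "\<forall>v. cpoly (\<lambda>x. p' x v)"
    using cpoly_has_derivative[OF assms] by blast
  then show "p differentiable (at x)"
    by (auto simp: differentiable_def)
  have "frechet_derivative p (at x) = p' x" for x
    using p'(1) frechet_derivative_at[of p "p' x" x] by simp
  then show "cpoly (\<lambda>x. frechet_derivative p (at x) v)"
    using p'(2) by simp
qed

lemma cpoly_smooth_on_open:
  assumes "cpoly p" "open U"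
  shows "smooth_on_open p U"
proof -
  have "differentiable_times k p U" if "cpoly p" for k p
    using that
  proof (induction k arbitrary: p)
    case 0
    have "continuous (at x) p" for x
      using cpoly_differentiable(1)[OF 0] by (rule differentiable_imp_continuous_within)
    then show ?case
      by (auto intro: continuous_at_imp_continuous_on)
  qed (simp add: cpoly_differentiable)
  then show ?thesis
    using assms by (simp add: smooth_on_open_def)
qed

lemma cpoly_sum: "(\<And>i. i \<in> I \<Longrightarrow> cpoly (f i)) \<Longrightarrow> cpoly (\<lambda>x. \<Sum>i\<in>I. f i x)"
  by (induction I rule: infinite_finite_induct) (auto intro: cpoly.intros)

lemma cpoly_prod: "(\<And>i. i \<in> I \<Longrightarrow> cpoly (f i)) \<Longrightarrow> cpoly (\<lambda>x. \<Prod>i\<in>I. f i x)"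
  by (induction I rule: infinite_finite_induct) (auto intro: cpoly.intros)

lemma bounded_linear_entry: "bounded_linear (\<lambda>A :: 'n::finite cmat. A $ i $ j)"
  by (intro bounded_linear_compose[OF bounded_linear_vec_nth bounded_linear_vec_nth])

lemma cpoly_entry: "cpoly (\<lambda>A :: 'n::finite cmat. A $ i $ j)"
  by (intro cpoly_linear bounded_linear_entry)

lemma cpoly_det:
  fixes M :: "'a::real_normed_vector \<Rightarrow> 'n::finite cmat"
  assumes "\<And>i j. cpoly (\<lambda>x. M x $ i $ j)"
  shows "cpoly (\<lambda>x. det (M x))"
  unfolding det_def by (intro cpoly_sum cpoly_mult cpoly_prod cpoly_const assms)

lemma has_vector_derivative_vecI:
  fixes f :: "real \<Rightarrow> 'a::real_normed_vector ^ 'n::finite"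
  assumes "\<And>i. ((\<lambda>t. f t $ i) has_vector_derivative f' $ i) F"
  shows "(f has_vector_derivative f') F"
proof -
  have "bounded_linear (\<lambda>x. x *\<^sub>R f')"
    by (rule bounded_linear_scaleR_left)
  with assms show ?thesis
    unfolding has_vector_derivative_def has_derivative_def
    by (auto intro!: vec_tendstoI)
qed

section \<open>The matrix product and the exponential\<close>

lemma bounded_bilinear_matrix_mult:
  "bounded_bilinear ((**) :: 'n::finite cmat \<Rightarrow> 'n cmat \<Rightarrow> 'n cmat)"
  unfolding bilinear_conv_bounded_bilinear[symmetric] bilinear_def
  by (auto intro!: linearI simp: vec_eq_iff matrix_matrix_mult_def sum.distrib algebra_simps scaleR_sum_right)

interpretation matrix_mult: bounded_bilinear "(**) :: 'n::finite cmat \<Rightarrow> 'n cmat \<Rightarrow> 'n cmat"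
  by (rule bounded_bilinear_matrix_mult)

lemma scaleR_entry: "(r *\<^sub>R A) $ i $ j = of_real r * (A :: 'n::finite cmat) $ i $ j"
  by (simp add: scaleR_conv_of_real[where 'a=complex])

lemma matpow_commute: "matpow A k ** A = A ** matpow A k"
  by (induction k) (simp_all add: matrix_mul_assoc[symmetric])

lemma matpow_scaleR: "matpow (t *\<^sub>R A) k = t ^ k *\<^sub>R matpow A k"
  by (induction k) (simp_all add: matrix_mult.scaleR_left matrix_mult.scaleR_right mult.commute)

lemma summable_mexp:
  fixes A :: "'n::finite cmat"
  shows "summable (\<lambda>k. matpow A k /\<^sub>R fact k)"
proof -
  obtain C where C: "C > 0" "\<And>(A :: 'n cmat) (B :: 'n cmat). norm (A ** B) \<le> norm A * norm B * C"
    using matrix_mult.pos_bounded by blast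
  have "norm (matpow A k) \<le> norm (mat 1 :: 'n cmat) * (norm A * C) ^ k" for k
  proof (induction k)
    case (Suc k)
    have "norm (matpow A (Suc k)) \<le> norm A * norm (matpow A k) * C"
      unfolding matpow.simps by (rule C(2))
    also have "\<dots> \<le> norm A * (norm (mat 1 :: 'n cmat) * (norm A * C) ^ k) * C"
      using Suc C(1) by (intro mult_right_mono mult_left_mono) auto
    finally show ?case
      by (simp add: mult_ac)
  qed simp
  then have bound: "norm (matpow A k /\<^sub>R fact k) \<le> norm (mat 1 :: 'n cmat) * (inverse (fact k) * (norm A * C) ^ k)" for k
    by (simp add: field_simps)
  have "summable (\<lambda>k. norm (mat 1 :: 'n cmat) * (inverse (fact k) * (norm A * C) ^ k))"
    by (intro summable_mult summable_exp)
  then show ?thesis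
    by (rule summable_comparison_test'[where N=0]) (rule bound)
qed

lemma mexp_entry: "mexp A $ i $ j = (\<Sum>k. matpow A k $ i $ j / fact k)"
  and summable_mexp_entry: "summable (\<lambda>k. matpow A k $ i $ j / fact k)"
proof -
  have "(\<lambda>k. (matpow A k /\<^sub>R fact k) $ i $ j) sums (mexp A $ i $ j)"
    unfolding mexp_def by (intro bounded_linear.sums[OF bounded_linear_entry] summable_sums summable_mexp)
  then have "(\<lambda>k. matpow A k $ i $ j / fact k) sums (mexp A $ i $ j)"
    by (simp add: scaleR_entry field_simps del: vector_scaleR_component)
  then show "mexp A $ i $ j = (\<Sum>k. matpow A k $ i $ j / fact k)" "summable (\<lambda>k. matpow A k $ i $ j / fact k)"
    by (auto simp: sums_iff)
qed

lemma mexp_zero: "mexp 0 = (mat 1 :: 'n::finite cmat)"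
proof -
  have "matpow (0 :: 'n cmat) k = (if k = 0 then mat 1 else 0)" for k
    by (cases k) (auto simp: matrix_mult.zero_left)
  then have "mexp (0 :: 'n cmat) = (\<Sum>k. if k = 0 then mat 1 else 0)"
    unfolding mexp_def by (intro arg_cong[where f=suminf]) (auto simp: fun_eq_iff)
  also have "\<dots> = mat 1"
    using sums_single[of 0 "\<lambda>_. mat 1 :: 'n cmat"] by (simp add: sums_iff)
  finally show ?thesis .
qed

text \<open>Each entry of the exponential is a power series in t and is differentiated termwise as a
  power series in a complex variable; the shifted coefficients are those of the product with
  \<open>X\<close>.\<close>

lemma mexp_has_vector_derivative:
  fixes X :: "'n::finite cmat"
  shows "((\<lambda>t. mexp (t *\<^sub>R X)) has_vector_derivative (mexp (t *\<^sub>R X) ** X)) (at t)"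
proof (intro has_vector_derivative_vecI)
  fix i j
  define c where "c k = matpow X k $ i $ j / fact k" for k
  have entry: "mexp (s *\<^sub>R X) $ i $ j = (\<Sum>k. c k * of_real s ^ k)" "summable (\<lambda>k. c k * of_real s ^ k)" for s :: real
    unfolding mexp_entry c_def using summable_mexp_entry[of "s *\<^sub>R X" i j]
    by (simp_all add: matpow_scaleR scaleR_entry mult.commute del: vector_scaleR_component)
  \<comment> \<open>Convergence at the real point |z| + 1 implies convergence at \<open>z\<close>,
    which has smaller modulus.\<close>
  have "summable (\<lambda>k. c k * z ^ k)" for z :: complex
    using entry(2)[of "norm z + 1"]
    by (rule powser_inside) (simp del: of_real_add)
  then have "((\<lambda>z. \<Sum>k. c k * z ^ k) has_field_derivative (\<Sum>k. diffs c k * of_real t ^ k)) (at (of_real t))"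
    by (intro termdiffs_strong_converges_everywhere)
  then have "((\<lambda>s. mexp (s *\<^sub>R X) $ i $ j) has_vector_derivative (\<Sum>k. diffs c k * of_real t ^ k)) (at t)"
    unfolding entry by (rule has_vector_derivative_real_field)
  moreover have "diffs c k * of_real t ^ k = (\<Sum>l\<in>UNIV. (matpow (t *\<^sub>R X) k $ i $ l / fact k) * X $ l $ j)" for k
  proof -
    have "diffs c k = matpow X (Suc k) $ i $ j / fact k"
      by (simp add: diffs_def c_def del: matpow.simps of_nat_Suc)
    also have "matpow X (Suc k) = matpow X k ** X"
      by (simp add: matpow_commute)
    finally show ?thesis
      by (simp add: matpow_scaleR matrix_matrix_mult_def scaleR_entry sum_distrib_right sum_distrib_left sum_divide_distrib
          mult_ac del: vector_scaleR_component)
  qed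
  moreover have "(\<Sum>k. \<Sum>l\<in>UNIV. (matpow (t *\<^sub>R X) k $ i $ l / fact k) * X $ l $ j) = (mexp (t *\<^sub>R X) ** X) $ i $ j"
  proof -
    have "(\<Sum>k. \<Sum>l\<in>UNIV. (matpow (t *\<^sub>R X) k $ i $ l / fact k) * X $ l $ j) = (\<Sum>l\<in>UNIV. \<Sum>k. (matpow (t *\<^sub>R X) k $ i $ l / fact k) * X $ l $ j)"
      by (intro suminf_sum summable_mult2 summable_mexp_entry)
    also have "\<dots> = (\<Sum>l\<in>UNIV. mexp (t *\<^sub>R X) $ i $ l * X $ l $ j)"
      unfolding mexp_entry by (intro sum.cong refl suminf_mult2[symmetric] summable_mexp_entry)
    finally show ?thesis
      by (simp add: matrix_matrix_mult_def)
  qed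
  ultimately show "((\<lambda>s. mexp (s *\<^sub>R X) $ i $ j) has_vector_derivative (mexp (t *\<^sub>R X) ** X) $ i $ j) (at t)"
    by simp
qed

lemma curve_has_vector_derivative:
  fixes x X :: "'n::finite cmat"
  shows "((\<lambda>t. x ** mexp (t *\<^sub>R X)) has_vector_derivative (x ** mexp (t *\<^sub>R X) ** X)) (at t)"
  using bounded_linear.has_vector_derivative[OF matrix_mult.bounded_linear_right mexp_has_vector_derivative]
  by (simp add: matrix_mul_assoc)

section \<open>Elementary matrices and the derivative of the determinant\<close>

definition elem_mat :: "'n \<Rightarrow> 'n \<Rightarrow> complex \<Rightarrow> 'n::finite cmat" where
  "elem_mat a b c = (\<chi> i j. if i = a \<and> j = b then c else 0)"

lemma elem_mat_entry [simp]: "elem_mat a b c $ i $ j = (if i = a \<and> j = b then c else 0)"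
  by (simp add: elem_mat_def)

lemma elem_mat_decompose: "A = (\<Sum>a\<in>UNIV. \<Sum>b\<in>UNIV. elem_mat a b (A $ a $ b))"
proof -
  have "(\<Sum>a\<in>UNIV. \<Sum>b\<in>UNIV. if i = a \<and> j = b then A $ a $ b else 0) = (\<Sum>a\<in>UNIV. if i = a then A $ a $ j else 0)" for i j
    by (intro sum.cong) auto
  then show ?thesis
    by (simp add: vec_eq_iff)
qed

lemma mult_elem_mat_entry:
  "(A ** elem_mat a b c) $ i $ j = (if j = b then A $ i $ a * c else 0)"
  by (simp add: matrix_matrix_mult_def if_distrib[of "\<lambda>x. _ * x"] cong: if_cong)

lemma det_id_plus_elem_mat: "det (mat 1 + elem_mat a b c :: 'a::finite cmat) = 1 + (if a = b then c else 0)"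
proof (cases "a = b")
  case True
  have "det (mat 1 + elem_mat a b c) = (\<Prod>i\<in>UNIV. (mat 1 + elem_mat a b c) $ i $ i)"
    using True by (intro det_diagonal) (auto simp: mat_def)
  also have "\<dots> = (\<Prod>i\<in>UNIV. if i = a then 1 + c else 1)"
    using True by (intro prod.cong) (auto simp: mat_def)
  finally show ?thesis
    using True by simp
next
  case False
  have "(mat 1 + elem_mat a b c) = (\<chi> k. if k = a then row a (mat 1) + vector_scalar_mult c (row b (mat 1)) else row k (mat 1))"
    using False by (auto simp: vec_eq_iff mat_def row_def)
  then have "det (mat 1 + elem_mat a b c) = det (mat 1 :: 'a cmat)"
    using det_row_operation[OF False, of "mat 1" c] by simp
  then show ?thesis
    using False by simp
qed

lemma det_line_has_vector_derivative:
  fixes B V :: "'n::finite cmat"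
  assumes "(det has_derivative G) (at B)"
  shows "((\<lambda>t::real. det (B + t *\<^sub>R V)) has_vector_derivative G V) (at 0)"
proof -
  have line: "((\<lambda>t::real. B + t *\<^sub>R V) has_vector_derivative V) (at 0)"
    by (auto intro!: derivative_eq_intros)
  have "(det has_derivative G) (at (B + (0::real) *\<^sub>R V))"
    using assms by simp
  then show ?thesis
    using vector_derivative_diff_chain_within[OF line, of det G] has_derivative_at_withinI
    by (auto simp: comp_def)
qed

text \<open>Jacobi's formula, from det(A + t A Z) = det A det(1 + t Z). That the derivative at the
  identity is the trace has to be checked only on elementary matrices, by additivity.\<close>

lemma det_derivative_along_mult:
  fixes A Z :: "'n::finite cmat"
  assumes F: "(det has_derivative F) (at A)"
  shows "F (A ** Z) = det A * trace Z"
proof -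
  obtain G where G: "(det has_derivative G) (at (mat 1 :: 'n cmat))"
    using cpoly_has_derivative[OF cpoly_det[of "\<lambda>x :: 'n cmat. x", OF cpoly_entry]] by blast
  interpret G: bounded_linear G
    using G by (rule has_derivative_bounded_linear)
  have elem: "G (elem_mat a b c) = (if a = b then c else 0)" for a b c
  proof -
    have "det (mat 1 + t *\<^sub>R elem_mat a b c) = 1 + t *\<^sub>R (if a = b then c else 0)" for t :: real
    proof -
      have "t *\<^sub>R elem_mat a b c = elem_mat a b (t *\<^sub>R c)"
        by (simp add: vec_eq_iff)
      then show ?thesis
        by (simp add: det_id_plus_elem_mat)
    qed
    moreover have "((\<lambda>t::real. 1 + t *\<^sub>R (if a = b then c else 0)) has_vector_derivative (if a = b then c else 0)) (at 0)"
      by (auto intro!: derivative_eq_intros)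
    ultimately show ?thesis
      using vector_derivative_unique_at[OF det_line_has_vector_derivative[OF G, of "elem_mat a b c"]] by simp
  qed
  have GZ: "G Z = trace Z"
    by (subst elem_mat_decompose[of Z]) (simp add: G.sum elem trace_def)
  have "((\<lambda>t::real. det A * det (mat 1 + t *\<^sub>R Z)) has_vector_derivative det A * G Z) (at 0)"
    using bounded_linear.has_vector_derivative[OF bounded_linear_mult_right det_line_has_vector_derivative[OF G]] .
  moreover have "det A * det (mat 1 + t *\<^sub>R Z) = det (A + t *\<^sub>R (A ** Z))" for t :: real
    by (simp add: det_mul[symmetric] matrix_add_ldistrib matrix_mult.scaleR_right)
  ultimately show ?thesis
    using vector_derivative_unique_at[OF det_line_has_vector_derivative[OF F, of "A ** Z"]] GZ by simp
qed

section \<open>The Lie algebra and its Killing form\<close>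

lemma ctranspose_entry [simp]: "ctranspose A $ i $ j = cnj (A $ j $ i)"
  by (simp add: ctranspose_def)

lemma ctranspose_mult: "ctranspose (A ** B) = ctranspose B ** ctranspose A"
  by (simp add: vec_eq_iff matrix_matrix_mult_def mult.commute)

lemma ctranspose_ctranspose [simp]: "ctranspose (ctranspose A) = A"
  by (simp add: vec_eq_iff)

lemma ctranspose_one [simp]: "ctranspose (mat 1) = mat 1"
  by (auto simp: vec_eq_iff mat_def)

lemma linear_ctranspose: "linear ctranspose"
  by (intro linearI) (simp_all add: vec_eq_iff)

lemma bounded_linear_ctranspose: "bounded_linear (ctranspose :: 'n::finite cmat \<Rightarrow> 'n cmat)"
  using linear_ctranspose by (simp add: linear_conv_bounded_linear)

lemma trace_ctranspose: "trace (ctranspose A) = cnj (trace A)"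
  by (simp add: trace_def)

lemma det_ctranspose: "det (ctranspose A) = cnj (det A)"
proof -
  have "ctranspose A = transpose (\<chi> i j. cnj (A $ i $ j))"
    by (simp add: vec_eq_iff transpose_def)
  then have "det (ctranspose A) = det (\<chi> i j. cnj (A $ i $ j))"
    by (simp add: det_transpose)
  then show ?thesis
    by (simp add: det_def)
qed

lemma linear_trace: "linear (trace :: 'n::finite cmat \<Rightarrow> complex)"
  by (intro linearI) (simp_all add: trace_def sum.distrib scaleR_sum_right)

text \<open>The ambient Euclidean product is the real Hilbert-Schmidt product. Hence translations by
  elements of \<open>SU\<close> are isometries, and the Killing form can be compared with it on
  \<open>su\<close>.\<close>

lemma inner_cmat: "A \<bullet> B = Re (trace (A ** ctranspose B))" for A B :: "'n::finite cmat"
  by (simp add: inner_vec_def trace_def matrix_matrix_mult_def inner_complex_def)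

lemma SU_one: "mat 1 \<in> SU"
  by (simp add: SU_def)

lemma mult_unitary:
  assumes "B ** ctranspose B = mat 1"
  shows "A ** B ** ctranspose (A ** B) = A ** ctranspose A"
proof -
  have "A ** B ** ctranspose (A ** B) = A ** (B ** ctranspose B) ** ctranspose A"
    by (simp add: ctranspose_mult matrix_mul_assoc)
  then show ?thesis
    by (simp add: assms)
qed

lemma SU_mult: "A \<in> SU \<Longrightarrow> B \<in> SU \<Longrightarrow> A ** B \<in> SU"
  by (simp add: SU_def mult_unitary det_mul)

lemma SU_ctranspose_mult: "A \<in> SU \<Longrightarrow> ctranspose A ** A = mat 1"
  by (simp add: SU_def matrix_left_right_inverse)

lemma SU_ctranspose: "A \<in> SU \<Longrightarrow> ctranspose A \<in> SU"
  using SU_ctranspose_mult[of A] by (simp add: SU_def det_ctranspose)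

lemma SU_mult_iff: "B \<in> SU \<Longrightarrow> A ** B \<in> SU \<longleftrightarrow> A \<in> SU"
  by (simp add: SU_def mult_unitary det_mul)

lemma norm_mult_SU: "B \<in> SU \<Longrightarrow> norm (A ** B) = norm A"
  for A B :: "'n::finite cmat"
  by (simp add: norm_eq_sqrt_inner inner_cmat SU_def mult_unitary)

lemma compact_SU: "compact (SU :: 'n::finite cmat set)"
proof -
  have "norm A = sqrt (real CARD('n))" if "A \<in> SU" for A :: "'n cmat"
    using that by (simp add: norm_eq_sqrt_inner inner_cmat SU_def trace_I)
  then have "bounded (SU :: 'n cmat set)"
    by (intro boundedI[of _ "sqrt (real CARD('n))"]) simp
  moreover have "continuous_on UNIV (\<lambda>A :: 'n cmat. A ** ctranspose A)"
    by (intro matrix_mult.continuous_on linear_continuous_on bounded_linear_ctranspose continuous_intros)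
  then have "closed {A :: 'n cmat. A ** ctranspose A = mat 1}"
    by (intro closed_Collect_eq continuous_intros)
  moreover have "continuous_on UNIV (det :: 'n cmat \<Rightarrow> complex)"
    using cpoly_differentiable(1)[OF cpoly_det[of "\<lambda>A :: 'n cmat. A", OF cpoly_entry]]
    by (auto intro: continuous_at_imp_continuous_on differentiable_imp_continuous_within)
  then have "closed {A :: 'n cmat. det A = 1}"
    by (intro closed_Collect_eq continuous_intros)
  ultimately show ?thesis
    unfolding SU_def compact_eq_bounded_closed by (auto simp: Collect_conj_eq intro: closed_Int)
qed

definition su :: "'n::finite cmat set" where
  "su = {X. ctranspose X = - X \<and> trace X = 0}"

lemma subspace_su: "subspace su"
  unfolding su_def subspace_def
  by (auto simp: linear_add[OF linear_ctranspose] linear_scale[OF linear_ctranspose] linear_0[OF linear_ctranspose]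
      linear_add[OF linear_trace] linear_scale[OF linear_trace] linear_0[OF linear_trace])

lemma ctranspose_curve_has_vector_derivative:
  "((\<lambda>t. ctranspose (mexp (t *\<^sub>R X))) has_vector_derivative ctranspose (mexp (t *\<^sub>R X) ** X)) (at t)"
  by (rule bounded_linear.has_vector_derivative[OF bounded_linear_ctranspose mexp_has_vector_derivative])

lemma unitary_curve_has_vector_derivative:
  "((\<lambda>t. mexp (t *\<^sub>R X) ** ctranspose (mexp (t *\<^sub>R X))) has_vector_derivative
     mexp (t *\<^sub>R X) ** (ctranspose X + X) ** ctranspose (mexp (t *\<^sub>R X))) (at t)"
  using matrix_mult.has_vector_derivative[OF mexp_has_vector_derivative[of X t] ctranspose_curve_has_vector_derivative]
  by (simp add: ctranspose_mult matrix_mul_assoc matrix_mult.add_left matrix_mult.add_right)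

lemma det_curve_has_vector_derivative:
  fixes X :: "'n::finite cmat"
  shows "((\<lambda>t. det (mexp (t *\<^sub>R X))) has_vector_derivative det (mexp (t *\<^sub>R X)) * trace X) (at t)"
proof -
  obtain F where F: "(det has_derivative F) (at (mexp (t *\<^sub>R X)))"
    using cpoly_has_derivative[OF cpoly_det[of "\<lambda>x :: 'n cmat. x", OF cpoly_entry]] by blast
  have "((det \<circ> (\<lambda>t. mexp (t *\<^sub>R X))) has_vector_derivative F (mexp (t *\<^sub>R X) ** X)) (at t)"
    by (rule vector_derivative_diff_chain_within[OF mexp_has_vector_derivative has_derivative_at_withinI[OF F]])
  then show ?thesis
    by (simp add: comp_def det_derivative_along_mult[OF F])
qed

text \<open>Differentiating the two defining equations of the group at t = 0 gives one inclusion.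
  Conversely, for \<open>X\<close> in \<open>su\<close> both left-hand sides have derivative zero
  along the exponential curve and so keep their values at t = 0.\<close>

lemma lie_algebra_SU: "lie_algebra SU = (su :: 'n::finite cmat set)"
proof (intro equalityI subsetI)
  fix X :: "'n cmat" assume "X \<in> lie_algebra SU"
  then have SU: "mexp (t *\<^sub>R X) \<in> SU" for t :: real
    by (simp add: lie_algebra_def)
  have "((\<lambda>t::real. mat 1) has_vector_derivative ctranspose X + X) (at 0)"
    using unitary_curve_has_vector_derivative[of X 0] SU
    by (simp add: SU_def mexp_zero matrix_mult.add_left matrix_mult.add_right)
  then have "ctranspose X + X = 0"
    using vector_derivative_unique_at has_vector_derivative_const by blast
  moreover have "((\<lambda>t::real. 1) has_vector_derivative trace X) (at 0)"
    using det_curve_has_vector_derivative[of X 0] SU by (simp add: SU_def mexp_zero)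
  then have "trace X = 0"
    using vector_derivative_unique_at has_vector_derivative_const by blast
  ultimately show "X \<in> su"
    by (simp add: su_def eq_neg_iff_add_eq_0)
next
  fix X :: "'n cmat" assume X: "X \<in> su"
  have const: "f t = f 0" if "\<And>t. (f has_vector_derivative 0) (at t)" for f :: "real \<Rightarrow> 'a::real_normed_vector" and t
  proof -
    note deriv = that
    obtain c where "\<And>x. x \<in> UNIV \<Longrightarrow> f x = c"
      by (rule has_vector_derivative_zero_constant[of UNIV f]) (use deriv in auto)
    then show ?thesis by simp
  qed
  have unitary: "mexp (t *\<^sub>R X) ** ctranspose (mexp (t *\<^sub>R X)) = mat 1" for t :: real
    using const[of "\<lambda>t. mexp (t *\<^sub>R X) ** ctranspose (mexp (t *\<^sub>R X))" t] unitary_curve_has_vector_derivative[of X] X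
    by (simp add: su_def mexp_zero matrix_mult.zero_left matrix_mult.zero_right)
  have "det (mexp (t *\<^sub>R X)) = 1" for t :: real
    using const[of "\<lambda>t. det (mexp (t *\<^sub>R X))" t] det_curve_has_vector_derivative[of X] X
    by (simp add: su_def mexp_zero)
  with unitary show "X \<in> lie_algebra SU"
    by (simp add: lie_algebra_def SU_def)
qed

lemma mexp_in_SU: "X \<in> su \<Longrightarrow> mexp (t *\<^sub>R X) \<in> SU"
  using lie_algebra_SU by (auto simp: lie_algebra_def)

section \<open>Orthonormal bases and traces\<close>

definition orthonormal :: "'a::real_inner set \<Rightarrow> bool" where
  "orthonormal C \<longleftrightarrow> (\<forall>x\<in>C. \<forall>y\<in>C. x \<bullet> y = (if x = y then 1 else 0))"

lemma orthonormal_expansion: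
  assumes C: "finite C" "orthonormal C" and v: "v \<in> span C"
  shows "v = (\<Sum>c\<in>C. (v \<bullet> c) *\<^sub>R c)"
proof -
  let ?w = "v - (\<Sum>c\<in>C. (v \<bullet> c) *\<^sub>R c)"
  have "?w \<bullet> d = 0" if "d \<in> C" for d
  proof -
    have "(\<Sum>c\<in>C. (v \<bullet> c) * (c \<bullet> d)) = (\<Sum>c\<in>C. if c = d then v \<bullet> c else 0)"
      using C that by (intro sum.cong) (auto simp: orthonormal_def)
    then show ?thesis
      using C that by (simp add: inner_diff_left inner_sum_left)
  qed
  then have "orthogonal ?w d" if "d \<in> span C" for d
    using orthogonal_to_span[OF that, of ?w] by (simp add: orthogonal_def inner_commute)
  moreover have "?w \<in> span C"
    by (intro span_diff[OF v] span_sum span_scale span_base)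
  ultimately have "?w = 0"
    using orthogonal_self by blast
  then show ?thesis by simp
qed

lemma orthonormal_independent:
  assumes "orthonormal C"
  shows "independent C"
proof (rule pairwise_orthogonal_independent)
  show "pairwise orthogonal C"
    using assms by (auto simp: orthonormal_def pairwise_def orthogonal_def)
  show "0 \<notin> C"
    using assms by (force simp: orthonormal_def)
qed

text \<open>The trace is defined through an arbitrary basis \<open>B\<close>. Expanding each b over
  the orthonormal \<open>C\<close> and exchanging the sums turns the diagonal coefficients over
  \<open>B\<close> into inner products over \<open>C\<close>.\<close>

lemma trace_on_orthonormal:
  fixes V :: "'a::euclidean_space set"
  assumes C: "finite C" "orthonormal C" "span C = V"
    and T: "linear T" "\<And>v. v \<in> V \<Longrightarrow> T v \<in> V"
  shows "trace_on V T = (\<Sum>c\<in>C. T c \<bullet> c)"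
proof -
  define B where "B = (SOME B. is_basis V B)"
  have "is_basis V C"
    using C orthonormal_independent span_superset by (auto simp: is_basis_def)
  then have "is_basis V B"
    unfolding B_def by (rule someI)
  then have B: "B \<subseteq> V" "independent B" "span B = V"
    by (auto simp: is_basis_def)
  have finB: "finite B"
    using B(2) by (rule independent_imp_finite)
  have TC: "T c \<in> span B" if "c \<in> C" for c
    using T(2)[of c] that B(3) C(3) span_base by blast
  have "representation B (T b) b = (\<Sum>c\<in>C. (b \<bullet> c) * representation B (T c) b)" if "b \<in> B" for b
  proof -
    have "b = (\<Sum>c\<in>C. (b \<bullet> c) *\<^sub>R c)"
      using orthonormal_expansion[OF C(1,2), of b] C(3) B(1) that by auto
    then have "T b = (\<Sum>c\<in>C. (b \<bullet> c) *\<^sub>R T c)"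
      using linear_sum[OF T(1), of "\<lambda>c. (b \<bullet> c) *\<^sub>R c" C] by (simp add: linear_scale[OF T(1)])
    then have "representation B (T b) = representation B (\<Sum>c\<in>C. (b \<bullet> c) *\<^sub>R T c)"
      by simp
    also have "\<dots> = (\<lambda>v. \<Sum>c\<in>C. representation B ((b \<bullet> c) *\<^sub>R T c) v)"
      using B(2) TC by (intro representation_sum span_scale) auto
    finally show ?thesis
      using B(2) TC by (simp add: representation_scale)
  qed
  then have "trace_on V T = (\<Sum>b\<in>B. \<Sum>c\<in>C. (b \<bullet> c) * representation B (T c) b)"
    by (simp add: trace_on_def B_def[symmetric])
  also have "\<dots> = (\<Sum>c\<in>C. (\<Sum>b\<in>B. representation B (T c) b *\<^sub>R b) \<bullet> c)"
    by (subst sum.swap) (simp add: inner_sum_left mult.commute)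
  also have "\<dots> = (\<Sum>c\<in>C. T c \<bullet> c)"
    using sum_representation_eq[OF B(2) TC finB] by (intro sum.cong) auto
  finally show ?thesis .
qed

section \<open>Complexification of the Lie algebra and the completeness relation\<close>

definition skew_part :: "'n::finite cmat \<Rightarrow> 'n cmat" where
  "skew_part Z = (1/2) *\<^sub>R (Z - ctranspose Z)"

text \<open>This is -i times the Hermitian part, so that it is skew-Hermitian as well: a traceless Z
  is A + iB with both A and B in \<open>su\<close>.\<close>

definition herm_part :: "'n::finite cmat \<Rightarrow> 'n cmat" where
  "herm_part Z = (\<chi> i j. - \<i> / 2 * (Z $ i $ j + cnj (Z $ j $ i)))"

lemma skew_herm_decompose: "Z $ i $ j = skew_part Z $ i $ j + \<i> * herm_part Z $ i $ j"
  by (simp add: skew_part_def herm_part_def scaleR_entry del: vector_scaleR_component)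
    (simp add: field_simps)

lemma skew_part_in_su: "trace Z = 0 \<Longrightarrow> skew_part Z \<in> su"
proof -
  assume "trace Z = 0"
  moreover have "trace (skew_part Z) = (1/2) *\<^sub>R (trace Z - cnj (trace Z))"
    unfolding skew_part_def by (simp add: linear_scale[OF linear_trace] linear_diff[OF linear_trace] trace_ctranspose)
  ultimately show ?thesis
    by (simp add: su_def) (simp add: vec_eq_iff skew_part_def scaleR_diff_right)
qed

lemma herm_part_in_su: "trace Z = 0 \<Longrightarrow> herm_part Z \<in> su"
proof -
  assume "trace Z = 0"
  moreover have "trace (herm_part Z) = - \<i> / 2 * (trace Z + cnj (trace Z))"
    unfolding trace_def cnj_sum sum.distrib[symmetric] sum_distrib_left by (simp add: herm_part_def)
  ultimately show ?thesis
    by (simp add: su_def) (simp add: vec_eq_iff herm_part_def)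
qed

text \<open>The trace part is removed so that the unit lies in the complexification of
  \<open>su\<close>.\<close>

definition tl_unit :: "'n::finite \<Rightarrow> 'n \<Rightarrow> 'n cmat" where
  "tl_unit a b = elem_mat a b 1 - (if a = b then mat (1 / of_nat CARD('n)) else 0)"

lemma tl_unit_entry:
  "tl_unit a b $ i $ j = (if i = a \<and> j = b then 1 else 0) - (if a = b \<and> i = j then 1 / of_nat CARD('n) else 0)"
  for a :: "'n::finite"
  by (simp add: tl_unit_def mat_def)

lemma trace_tl_unit: "trace (tl_unit a b) = 0"
proof -
  have "(\<Sum>i\<in>UNIV. if i = a \<and> i = b then 1 else 0) = (if a = b then 1 else (0::complex))"
    by (cases "a = b") (auto intro!: sum.neutral)
  then show ?thesis
    by (simp add: trace_def tl_unit_entry sum_subtractf)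
qed

lemma trace_mult_su_real:
  assumes "X \<in> su" "Y \<in> su"
  shows "trace (X ** Y) = of_real (- (X \<bullet> Y))"
proof -
  have "cnj (trace (X ** Y)) = trace (Y ** X)"
    using assms unfolding trace_ctranspose[symmetric] ctranspose_mult
    by (simp add: su_def matrix_mult.minus_left matrix_mult.minus_right)
  then have "cnj (trace (X ** Y)) = trace (X ** Y)"
    using trace_mul_sym[of Y X] by simp
  then have "trace (X ** Y) = of_real (Re (trace (X ** Y)))"
    by (simp add: complex_eq_iff)
  also have "Re (trace (X ** Y)) = - (X \<bullet> Y)"
    using assms by (simp add: inner_cmat su_def matrix_mult.minus_right linear_neg[OF linear_trace])
  finally show ?thesis .
qed

text \<open>On \<open>su\<close> the form Tr(XY) is minus the inner product, so there this is the
  orthonormal expansion. Both sides are complex linear in \<open>Z\<close>, and a traceless matrix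
  is A + iB with A and B in \<open>su\<close>.\<close>

lemma traceless_expansion:
  assumes C: "finite C" "orthonormal C" "span C = su" and Z: "trace Z = 0"
  shows "Z $ i $ j = - (\<Sum>c\<in>C. trace (Z ** c) * c $ i $ j)"
proof -
  have Csu: "c \<in> su" if "c \<in> C" for c
    using that C(3) span_base by blast
  have expand: "X $ i $ j = - (\<Sum>c\<in>C. trace (X ** c) * c $ i $ j)" if X: "X \<in> su" for X
  proof -
    have "X $ i $ j = (\<Sum>c\<in>C. (X \<bullet> c) *\<^sub>R c) $ i $ j"
      using orthonormal_expansion[OF C(1,2), of X] X C(3) by simp
    also have "\<dots> = (\<Sum>c\<in>C. of_real (X \<bullet> c) * c $ i $ j)"
      by (simp add: scaleR_entry del: vector_scaleR_component)
    also have "\<dots> = (\<Sum>c\<in>C. - (trace (X ** c) * c $ i $ j))"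
      using trace_mult_su_real[OF X Csu] by (intro sum.cong) auto
    finally show ?thesis
      by (simp add: sum_negf)
  qed
  have tr: "trace (Z ** c) = trace (skew_part Z ** c) + \<i> * trace (herm_part Z ** c)" for c
    unfolding trace_def matrix_matrix_mult_def
    by (simp add: skew_herm_decompose[of Z] sum.distrib sum_distrib_left distrib_right mult.assoc)
  have "Z $ i $ j = - (\<Sum>c\<in>C. trace (skew_part Z ** c) * c $ i $ j) + \<i> * (- (\<Sum>c\<in>C. trace (herm_part Z ** c) * c $ i $ j))"
    by (subst skew_herm_decompose) (simp only: expand[OF skew_part_in_su[OF Z]] expand[OF herm_part_in_su[OF Z]])
  then show ?thesis
    by (simp add: tr sum.distrib sum_distrib_left distrib_right mult.assoc)
qed

text \<open>The completeness (Fierz) relation of su(n), obtained by expanding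
  \<open>tl_unit l k\<close>: its trace against a traceless \<open>c\<close> picks out the entry
  \<open>c $ k $ l\<close>.\<close>

lemma orthonormal_completeness:
  assumes C: "finite C" "orthonormal C" "span C = su"
  shows "(\<Sum>c\<in>C. c $ k $ l * c $ i $ j) = - tl_unit l k $ i $ j"
proof -
  have "trace (tl_unit l k ** c) = c $ k $ l" if "c \<in> C" for c
  proof -
    have "trace c = 0"
      using that C(3) span_base by (auto simp: su_def)
    have "trace (tl_unit l k ** c) = (\<Sum>a\<in>UNIV. \<Sum>b\<in>UNIV. (if a = l then if b = k then c $ b $ a else 0 else 0)
        - (if a = b then if l = k then c $ b $ a / of_nat CARD('a) else 0 else 0))"
      unfolding trace_def matrix_matrix_mult_def
      by (simp, intro sum.cong refl) (auto simp: tl_unit_entry algebra_simps)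
    also have "\<dots> = (\<Sum>a\<in>UNIV. (if a = l then c $ k $ a else 0) - (if l = k then c $ a $ a / of_nat CARD('a) else 0))"
      by (intro sum.cong refl) (simp add: sum_subtractf)
    also have "\<dots> = c $ k $ l - (if l = k then trace c / of_nat CARD('a) else 0)"
      by (simp add: sum_subtractf trace_def sum_divide_distrib)
    finally show ?thesis
      using \<open>trace c = 0\<close> by simp
  qed
  then show ?thesis
    using traceless_expansion[OF C trace_tl_unit, of l k i j] by simp
qed

text \<open>This contracts the completeness relation with \<open>A\<close> and \<open>B\<close>; the
  first term comes from the trace part of \<open>tl_unit\<close>, the second from the elementary
  matrix.\<close>

lemma sum_trace_orthonormal:
  fixes A B :: "'n::finite cmat"
  assumes C: "finite C" "orthonormal C" "span C = su"
  shows "(\<Sum>c\<in>C. trace (A ** c ** B ** c)) = trace (A ** B) / of_nat CARD('n) - trace A * trace B"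
proof -
  have "(\<Sum>c\<in>C. trace (A ** c ** B ** c)) =
      (\<Sum>c\<in>C. \<Sum>p\<in>UNIV. \<Sum>k\<in>UNIV. \<Sum>j\<in>UNIV. \<Sum>i\<in>UNIV. A $ p $ i * B $ j $ k * (c $ k $ p * c $ i $ j))"
    unfolding trace_def matrix_matrix_mult_def
    by (simp add: sum_distrib_right) (intro sum.cong refl, simp add: mult_ac)
  also have "\<dots> = (\<Sum>p\<in>UNIV. \<Sum>k\<in>UNIV. \<Sum>j\<in>UNIV. \<Sum>i\<in>UNIV. A $ p $ i * B $ j $ k * (\<Sum>c\<in>C. c $ k $ p * c $ i $ j))"
    by (simp only: sum.swap[of _ _ C] sum_distrib_left)
  also have "\<dots> = (\<Sum>p\<in>UNIV. \<Sum>k\<in>UNIV. \<Sum>j\<in>UNIV. \<Sum>i\<in>UNIV. A $ p $ i * B $ j $ k * (- tl_unit p k $ i $ j))"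
    by (simp only: orthonormal_completeness[OF C])
  also have "\<dots> = (\<Sum>p\<in>UNIV. \<Sum>k\<in>UNIV. \<Sum>j\<in>UNIV. \<Sum>i\<in>UNIV.
      (if i = j then if p = k then A $ p $ i * B $ j $ k / of_nat CARD('n) else 0 else 0)
      - (if i = p then if j = k then A $ p $ i * B $ j $ k else 0 else 0))"
    by (intro sum.cong refl) (auto simp: tl_unit_entry algebra_simps)
  also have "\<dots> = (\<Sum>p\<in>UNIV. \<Sum>k\<in>UNIV. (if p = k then \<Sum>j\<in>UNIV. A $ p $ j * B $ j $ k / of_nat CARD('n) else 0)
      - A $ p $ p * B $ k $ k)"
  proof -
    have if_sum: "(\<Sum>j\<in>UNIV. if P then f j else 0) = (if P then \<Sum>j\<in>UNIV. f j else 0)" for P and f :: "'n \<Rightarrow> complex"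
      by simp
    show ?thesis
      by (simp add: sum_subtractf if_sum)
  qed
  also have "\<dots> = trace (A ** B) / of_nat CARD('n) - trace A * trace B"
    unfolding trace_def matrix_matrix_mult_def by (simp add: sum_subtractf sum_divide_distrib sum_product)
  finally show ?thesis .
qed

section \<open>The Killing form\<close>

lemma ad_in_su: "X \<in> su \<Longrightarrow> Y \<in> su \<Longrightarrow> ad X Y \<in> su"
  unfolding su_def ad_def
  by (simp add: linear_diff[OF linear_ctranspose] linear_diff[OF linear_trace] ctranspose_mult
      matrix_mult.minus_left matrix_mult.minus_right trace_mul_sym[of Y X])

lemma linear_ad: "linear (ad X)"
  by (intro linearI) (simp_all add: ad_def matrix_mult.add_left matrix_mult.add_right
      matrix_mult.scaleR_left matrix_mult.scaleR_right scaleR_diff_right)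

lemma exists_orthonormal_su: "\<exists>C :: 'n::finite cmat set. finite C \<and> orthonormal C \<and> span C = su"
proof -
  obtain C :: "'n cmat set" where C: "pairwise orthogonal C" "\<And>x. x \<in> C \<Longrightarrow> norm x = 1" "independent C" "span C = su"
    using orthonormal_basis_subspace[OF subspace_su] by metis
  then have "orthonormal C"
    by (auto simp: orthonormal_def pairwise_def orthogonal_def norm_eq_1)
  with C show ?thesis
    using independent_imp_finite by blast
qed

text \<open>Over an orthonormal basis the trace of ad X ad Y becomes four sums of the kind treated
  in \<open>sum_trace_orthonormal\<close>. The terms with 1/n cancel, those with Tr X Tr Y vanish,
  and the factors Tr 1 = n leave 2n Tr(XY).\<close>

lemma killing_SU:
  fixes X Y :: "'n::finite cmat"
  assumes X: "X \<in> su" and Y: "Y \<in> su"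
  shows "killing SU X Y = - 2 * real CARD('n) * (X \<bullet> Y)"
proof -
  obtain C :: "'n cmat set" where C: "finite C" "orthonormal C" "span C = su"
    using exists_orthonormal_su by blast
  have "killing SU X Y = (\<Sum>c\<in>C. (ad X (ad Y c)) \<bullet> c)"
    unfolding killing_def lie_algebra_SU
    using trace_on_orthonormal[OF C linear_compose[OF linear_ad[of Y] linear_ad[of X]]] ad_in_su X Y by (auto simp: comp_def)
  \<comment> \<open>The inserted factors \<open>mat 1\<close> bring all four terms into the shape A
    c B c.\<close>
  also have "\<dots> = (\<Sum>c\<in>C. - Re (trace (X ** Y ** c ** mat 1 ** c) - trace (X ** c ** Y ** c) - trace (Y ** c ** X ** c) + trace (mat 1 ** c ** (Y ** X) ** c)))"
  proof (intro sum.cong refl)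
    fix c assume "c \<in> C"
    then have c: "ctranspose c = - c"
      using C(3) span_base by (auto simp: su_def)
    have "ad X (ad Y c) ** c = X ** Y ** c ** mat 1 ** c - X ** c ** Y ** c - Y ** c ** X ** c + mat 1 ** c ** (Y ** X) ** c"
      by (simp add: ad_def matrix_mult.diff_left matrix_mult.diff_right matrix_mul_assoc)
    then show "ad X (ad Y c) \<bullet> c = - Re (trace (X ** Y ** c ** mat 1 ** c) - trace (X ** c ** Y ** c) - trace (Y ** c ** X ** c) + trace (mat 1 ** c ** (Y ** X) ** c))"
      by (simp add: inner_cmat c matrix_mult.minus_right linear_neg[OF linear_trace] linear_diff[OF linear_trace] linear_add[OF linear_trace])
  qed
  also have "\<dots> = - Re ((\<Sum>c\<in>C. trace (X ** Y ** c ** mat 1 ** c)) - (\<Sum>c\<in>C. trace (X ** c ** Y ** c))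
      - (\<Sum>c\<in>C. trace (Y ** c ** X ** c)) + (\<Sum>c\<in>C. trace (mat 1 ** c ** (Y ** X) ** c)))"
    by (simp add: sum_negf sum.distrib sum_subtractf)
  also have "\<dots> = 2 * real CARD('n) * Re (trace (X ** Y))"
  proof -
    have "trace X = 0" "trace Y = 0" "trace (Y ** X) = trace (X ** Y)"
      using X Y trace_mul_sym by (auto simp: su_def)
    then show ?thesis
      by (simp only: sum_trace_orthonormal[OF C]) (simp add: trace_I algebra_simps)
  qed
  finally show ?thesis
    by (simp add: trace_mult_su_real[OF X Y])
qed

section \<open>Orthonormal bases for the metric\<close>

context
  fixes \<gamma> :: real and g :: "'n::finite cmat \<Rightarrow> 'n cmat \<Rightarrow> real"
  assumes \<gamma>: "\<gamma> > 0" and g: "g = (\<lambda>X Y. - \<gamma> * killing SU X Y)"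
begin

text \<open>By \<open>killing_SU\<close>, g is the ambient inner product times 2n \<gamma>; the
  square root of this factor is the scaling.\<close>

lemma orthonormal_basis_scaled:
  assumes "B \<subseteq> su"
  shows "(\<forall>X\<in>B. \<forall>Y\<in>B. g X Y = (if X = Y then 1 else 0)) \<longleftrightarrow>
    orthonormal ((*\<^sub>R) (sqrt (2 * real CARD('n) * \<gamma>)) ` B)"
proof -
  have "g X Y = (sqrt (2 * real CARD('n) * \<gamma>) *\<^sub>R X) \<bullet> (sqrt (2 * real CARD('n) * \<gamma>) *\<^sub>R Y)"
    if "X \<in> B" "Y \<in> B" for X Y
    using that assms \<gamma> by (auto simp: g killing_SU subset_iff)
  then show ?thesis
    using \<gamma> by (auto simp: orthonormal_def)
qed

lemma span_scaled:
  "finite B \<Longrightarrow> span ((*\<^sub>R) (sqrt (2 * real CARD('n) * \<gamma>)) ` B) = span B" for B :: "'n cmat set"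
  using \<gamma> span_image_scale[of B "\<lambda>_. sqrt (2 * real CARD('n) * \<gamma>)"] by simp

lemma exists_orthonormal_basis: "\<exists>B. orthonormal_basis (lie_algebra SU) g B"
proof -
  obtain C :: "'n cmat set" where C: "finite C" "orthonormal C" "span C = su"
    using exists_orthonormal_su by blast
  define r where "r = sqrt (2 * real CARD('n) * \<gamma>)"
  have r: "r > 0"
    using \<gamma> by (simp add: r_def)
  define B where "B = (*\<^sub>R) (1 / r) ` C"
  have rB: "(*\<^sub>R) r ` B = C"
    using r by (auto simp: B_def image_image)
  have span: "span B = su"
    using span_scaled[of B] C rB by (simp add: r_def B_def)
  then have "B \<subseteq> su"
    using span_superset by blast
  moreover have "independent B"
  proof (rule pairwise_orthogonal_independent)
    show "pairwise orthogonal B"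
      using C(2) by (auto simp: B_def orthonormal_def pairwise_def orthogonal_def)
    show "0 \<notin> B"
      using C(2) r by (force simp: B_def orthonormal_def)
  qed
  ultimately show ?thesis
    unfolding orthonormal_basis_def is_basis_def lie_algebra_SU
    using span C(2) rB orthonormal_basis_scaled[of B] by (auto simp: r_def)
qed

lemma orthonormal_basis_completeness:
  assumes B: "orthonormal_basis (lie_algebra SU) g B"
  shows "finite B" "B \<subseteq> su"
    "(\<Sum>X\<in>B. X $ k $ l * X $ i $ j) = of_real (1 / (2 * real CARD('n) * \<gamma>)) * - tl_unit l k $ i $ j"
proof -
  define r where "r = sqrt (2 * real CARD('n) * \<gamma>)"
  have r: "r > 0" "r\<^sup>2 = 2 * real CARD('n) * \<gamma>"
    using \<gamma> by (auto simp: r_def)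
  show fin: "finite B" and sub: "B \<subseteq> su"
    using B independent_imp_finite by (auto simp: orthonormal_basis_def is_basis_def lie_algebra_SU)
  have "orthonormal ((*\<^sub>R) r ` B)"
    using B orthonormal_basis_scaled[OF sub] by (auto simp: orthonormal_basis_def r_def)
  moreover have "span ((*\<^sub>R) r ` B) = su"
    using B span_scaled[OF fin] by (auto simp: orthonormal_basis_def is_basis_def lie_algebra_SU r_def)
  ultimately have "(\<Sum>c\<in>(*\<^sub>R) r ` B. c $ k $ l * c $ i $ j) = - tl_unit l k $ i $ j"
    using fin by (intro orthonormal_completeness) auto
  moreover have "(\<Sum>c\<in>(*\<^sub>R) r ` B. c $ k $ l * c $ i $ j) = (\<Sum>X\<in>B. (r *\<^sub>R X) $ k $ l * (r *\<^sub>R X) $ i $ j)"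
    using r by (subst sum.reindex) (auto simp: inj_on_def)
  moreover have "\<dots> = of_real (r\<^sup>2) * (\<Sum>X\<in>B. X $ k $ l * X $ i $ j)"
    by (simp add: scaleR_entry sum_distrib_left power2_eq_square mult_ac del: vector_scaleR_component)
  ultimately have "of_real (r\<^sup>2) * (\<Sum>X\<in>B. X $ k $ l * X $ i $ j) = - tl_unit l k $ i $ j"
    by simp
  moreover have "complex_of_real (r\<^sup>2) \<noteq> 0"
    using r(1) by simp
  ultimately have "(\<Sum>X\<in>B. X $ k $ l * X $ i $ j) = - tl_unit l k $ i $ j / of_real (r\<^sup>2)"
    by (simp add: field_simps)
  then show "(\<Sum>X\<in>B. X $ k $ l * X $ i $ j) = of_real (1 / (2 * real CARD('n) * \<gamma>)) * - tl_unit l k $ i $ j"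
    unfolding r(2) by simp
qed

end

section \<open>Smooth functions on the group\<close>

text \<open>Openness of \<open>U\<close> matters: derivatives at a point depend on the function in a
  neighbourhood.\<close>

lemma differentiable_times_cong:
  assumes "open U" "\<And>x. x \<in> U \<Longrightarrow> f x = g x" "differentiable_times k f U"
  shows "differentiable_times k g U"
  using assms(2,3)
proof (induction k arbitrary: f g)
  case 0
  then show ?case
    using continuous_on_cong[of U U f g] by simp
next
  case (Suc k)
  have "(g has_derivative frechet_derivative f (at x)) (at x)" if "x \<in> U" for x
  proof -
    have "(f has_derivative frechet_derivative f (at x)) (at x)"
      using Suc.prems(2) that frechet_derivative_works by auto
    then show ?thesis
      by (rule has_derivative_transform_within_open[OF _ \<open>open U\<close> that]) (rule Suc.prems(1))
  qed
  then have g: "g differentiable (at x)" "frechet_derivative f (at x) = frechet_derivative g (at x)" if "x \<in> U" for x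
    using that frechet_derivative_at by (auto simp: differentiable_def)
  moreover have "differentiable_times k (\<lambda>x. frechet_derivative g (at x) v) U" for v
    by (rule Suc.IH[of "\<lambda>x. frechet_derivative f (at x) v"]) (use g Suc.prems(2) in auto)
  ultimately show ?case by simp
qed

lemma differentiable_times_Suc_imp: "differentiable_times (Suc k) f U \<Longrightarrow> differentiable_times k f U"
proof (induction k arbitrary: f)
  case 0
  then show ?case
    by (auto intro!: continuous_at_imp_continuous_on differentiable_imp_continuous_within)
qed simp

lemma differentiable_times_add:
  assumes "open U" "differentiable_times k f U" "differentiable_times k g U"
  shows "differentiable_times k (\<lambda>x. f x + g x) U"
  using assms(2,3)
proof (induction k arbitrary: f g)
  case (Suc k)
  have eq: "frechet_derivative (\<lambda>x. f x + g x) (at x) = (\<lambda>v. frechet_derivative f (at x) v + frechet_derivative g (at x) v)"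
    if "x \<in> U" for x
    using Suc.prems that by (intro frechet_derivative_at[symmetric] has_derivative_add) (auto simp: frechet_derivative_works)
  have sum: "differentiable_times k (\<lambda>x. frechet_derivative f (at x) v + frechet_derivative g (at x) v) U" for v
    using Suc.prems by (intro Suc.IH) auto
  have "differentiable_times k (\<lambda>x. frechet_derivative (\<lambda>x. f x + g x) (at x) v) U" for v
    by (rule differentiable_times_cong[OF \<open>open U\<close> _ sum]) (simp add: eq)
  then show ?case
    using Suc.prems by auto
qed (auto intro: continuous_on_add)

lemma differentiable_times_mult:
  fixes f g :: "'a::real_normed_vector \<Rightarrow> complex"
  assumes "open U" "differentiable_times k f U" "differentiable_times k g U"
  shows "differentiable_times k (\<lambda>x. f x * g x) U"
  using assms(2,3)
proof (induction k arbitrary: f g)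
  case (Suc k)
  have eq: "frechet_derivative (\<lambda>x. f x * g x) (at x) = (\<lambda>v. f x * frechet_derivative g (at x) v + frechet_derivative f (at x) v * g x)"
    if "x \<in> U" for x
    using Suc.prems that by (intro frechet_derivative_at[symmetric] has_derivative_mult) (auto simp: frechet_derivative_works)
  have sum: "differentiable_times k (\<lambda>x. f x * frechet_derivative g (at x) v + frechet_derivative f (at x) v * g x) U" for v
    \<comment> \<open>The product rule involves the factors themselves at order k as well as their
      derivatives.\<close>
    using Suc.prems differentiable_times_Suc_imp[of k f U] differentiable_times_Suc_imp[of k g U]
    by (intro differentiable_times_add[OF \<open>open U\<close>] Suc.IH) auto
  have "differentiable_times k (\<lambda>x. frechet_derivative (\<lambda>x. f x * g x) (at x) v) U" for v
    by (rule differentiable_times_cong[OF \<open>open U\<close> _ sum]) (simp add: eq)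
  then show ?case
    using Suc.prems by auto
qed (auto intro: continuous_on_mult)

lemma smooth_on_open_add: "smooth_on_open f U \<Longrightarrow> smooth_on_open g U \<Longrightarrow> smooth_on_open (\<lambda>x. f x + g x) U"
  by (simp add: smooth_on_open_def differentiable_times_add)

lemma smooth_on_open_mult: "smooth_on_open f U \<Longrightarrow> smooth_on_open g U \<Longrightarrow> smooth_on_open (\<lambda>x. f x * g x) U"
  for f g :: "'a::real_normed_vector \<Rightarrow> complex"
  by (simp add: smooth_on_open_def differentiable_times_mult)

lemma smooth_on_open_sum:
  assumes "open U" "\<And>i. i \<in> I \<Longrightarrow> smooth_on_open (f i) U"
  shows "smooth_on_open (\<lambda>x. \<Sum>i\<in>I. f i x :: complex) U"
  using assms(2)
proof (induction I rule: infinite_finite_induct)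
  case (insert i I)
  then show ?case
    by (simp add: smooth_on_open_add)
qed (auto intro: cpoly_smooth_on_open cpoly_const \<open>open U\<close>)

lemma smooth_on_open_has_derivative:
  assumes "smooth_on_open F U" "x \<in> U"
  shows "(F has_derivative frechet_derivative F (at x)) (at x)"
proof -
  have "differentiable_times (Suc 0) F U"
    using assms(1) by (simp only: smooth_on_open_def)
  then have "F differentiable (at x)"
    using assms(2) by (simp only: differentiable_times.simps)
  then show ?thesis
    by (simp only: frechet_derivative_works)
qed

lemma smooth_on_open_frechet_derivative:
  assumes "smooth_on_open F U"
  shows "smooth_on_open (\<lambda>x. frechet_derivative F (at x) v) U"
proof -
  have "differentiable_times (Suc k) F U" for k
    using assms by (simp only: smooth_on_open_def)
  then have "differentiable_times k (\<lambda>x. frechet_derivative F (at x) v) U" for k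
    by (simp only: differentiable_times.simps)
  then show ?thesis
    using assms unfolding smooth_on_open_def by blast
qed

text \<open>Values off the group are normalised to zero. Then functions that agree on
  \<open>SU\<close> are equal as total functions, and linear algebra applies to them directly.
  Left-invariant derivatives respect the normalisation because their curves never enter or leave
  \<open>SU\<close>.\<close>

definition smooth_SU :: "('n::finite cmat \<Rightarrow> complex) set" where
  "smooth_SU = {f. smooth_on f SU \<and> (\<forall>x. x \<notin> SU \<longrightarrow> f x = 0)}"

definition rst :: "('n::finite cmat \<Rightarrow> complex) \<Rightarrow> 'n cmat \<Rightarrow> complex" where
  "rst f x = (if x \<in> SU then f x else 0)"

lemma rst_smooth_SU: "smooth_on f SU \<Longrightarrow> rst f \<in> smooth_SU"
  unfolding smooth_SU_def smooth_on_def rst_def by auto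

lemma curve_in_SU: "X \<in> su \<Longrightarrow> x ** mexp (t *\<^sub>R X) \<in> SU \<longleftrightarrow> x \<in> SU"
  by (simp add: SU_mult_iff mexp_in_SU)

text \<open>Near t the curve stays in the open set \<open>U\<close>, and it never leaves the group,
  so \<open>f\<close> along it equals the ambient extension \<open>F\<close>, to which the chain
  rule applies.\<close>

lemma smooth_SU_curve:
  assumes F: "smooth_on_open F U" and eq: "\<And>y. y \<in> U \<inter> SU \<Longrightarrow> F y = f y"
    and x: "x \<in> SU" "x ** mexp (t *\<^sub>R X) \<in> U" and X: "X \<in> su"
  shows "((\<lambda>s. f (x ** mexp (s *\<^sub>R X))) has_vector_derivative
    frechet_derivative F (at (x ** mexp (t *\<^sub>R X))) (x ** mexp (t *\<^sub>R X) ** X)) (at t)"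
proof -
  let ?c = "\<lambda>s. x ** mexp (s *\<^sub>R X)"
  have "((F \<circ> ?c) has_vector_derivative frechet_derivative F (at (?c t)) (?c t ** X)) (at t)"
    by (rule vector_derivative_diff_chain_within[OF curve_has_vector_derivative])
      (rule has_derivative_at_withinI[OF smooth_on_open_has_derivative[OF F x(2)]])
  moreover have "continuous_on UNIV ?c"
    using has_vector_derivative_continuous[OF curve_has_vector_derivative]
    by (auto intro: continuous_at_imp_continuous_on)
  then have "open (?c -` U)"
    using F by (intro open_vimage) (auto simp: smooth_on_open_def)
  moreover have "(F \<circ> ?c) s = f (?c s)" if "s \<in> ?c -` U" for s
    using that eq[of "?c s"] x(1) X by (simp add: curve_in_SU)
  ultimately show ?thesis
    using x(2) by (auto intro: has_vector_derivative_transform_within_open)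
qed

lemma left_inv_deriv_local:
  assumes F: "smooth_on_open F U" and eq: "\<And>y. y \<in> U \<inter> SU \<Longrightarrow> F y = f y"
    and x: "x \<in> U \<inter> SU" and X: "X \<in> su"
  shows "left_inv_deriv X f x = frechet_derivative F (at x) (x ** X)"
  unfolding left_inv_deriv_def
  using smooth_SU_curve[OF F eq, of x 0 X] x X
  by (intro vector_derivative_at) (simp add: mexp_zero)

lemma smooth_SU_has_vector_derivative:
  assumes f: "f \<in> smooth_SU" and X: "X \<in> su"
  shows "((\<lambda>s. f (x ** mexp (s *\<^sub>R X))) has_vector_derivative left_inv_deriv X f (x ** mexp (t *\<^sub>R X))) (at t)"
proof (cases "x \<in> SU")
  case True
  let ?y = "x ** mexp (t *\<^sub>R X)"
  have y: "?y \<in> SU"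
    using True X by (simp add: curve_in_SU)
  then obtain U F where F: "?y \<in> U" "smooth_on_open F U" "\<And>y. y \<in> U \<inter> SU \<Longrightarrow> F y = f y"
    using f unfolding smooth_SU_def smooth_on_def by blast
  then show ?thesis
    using smooth_SU_curve[OF F(2,3) True F(1) X] left_inv_deriv_local[OF F(2,3) _ X] y by simp
next
  case False
  then have "f (x ** mexp (s *\<^sub>R X)) = 0" "f (x ** mexp (t *\<^sub>R X) ** mexp (s *\<^sub>R X)) = 0" for s
    using f X by (auto simp: smooth_SU_def curve_in_SU)
  then show ?thesis
    by (simp add: left_inv_deriv_def vector_derivative_at[OF has_vector_derivative_const])
qed

lemma left_inv_derivI:
  assumes "((\<lambda>s. f (x ** mexp (s *\<^sub>R X))) has_vector_derivative d) (at 0)"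
  shows "left_inv_deriv X f x = d"
  unfolding left_inv_deriv_def using assms by (rule vector_derivative_at)

lemma smooth_SU_has_vector_derivative_0:
  assumes f: "f \<in> smooth_SU" and X: "X \<in> su"
  shows "((\<lambda>s. f (x ** mexp (s *\<^sub>R X))) has_vector_derivative left_inv_deriv X f x) (at 0)"
  using smooth_SU_has_vector_derivative[OF assms, of x 0] by (simp add: mexp_zero)

text \<open>An ambient extension of the derivative is the derivative of \<open>F\<close> at y in the
  direction yX. This direction varies with y, so it is split into fixed basis directions whose
  coefficients are linear in y.\<close>

lemma left_inv_deriv_smooth_SU:
  fixes f :: "'n::finite cmat \<Rightarrow> complex"
  assumes f: "f \<in> smooth_SU" and X: "X \<in> su"
  shows "left_inv_deriv X f \<in> smooth_SU"
proof -
  have "\<exists>U G. x \<in> U \<and> smooth_on_open G U \<and> (\<forall>y\<in>U \<inter> SU. G y = left_inv_deriv X f y)" if x: "x \<in> SU" for x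
  proof -
    obtain U F where F: "x \<in> U" "smooth_on_open F U" "\<And>y. y \<in> U \<inter> SU \<Longrightarrow> F y = f y"
      using f x unfolding smooth_SU_def smooth_on_def by blast
    define G where "G y = (\<Sum>b\<in>Basis. of_real ((y ** X) \<bullet> b) * frechet_derivative F (at y) b)" for y
    have "open U"
      using F by (simp add: smooth_on_open_def)
    have "cpoly (\<lambda>y :: 'n cmat. complex_of_real ((y ** X) \<bullet> b))" for b
      by (intro cpoly_linear bounded_linear_compose[OF bounded_linear_of_real]
          bounded_linear_compose[OF bounded_linear_inner_left] matrix_mult.bounded_linear_left)
    then have "smooth_on_open G U"
      unfolding G_def
      by (intro smooth_on_open_sum smooth_on_open_mult smooth_on_open_frechet_derivative F(2) cpoly_smooth_on_open \<open>open U\<close>)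
    moreover have "G y = left_inv_deriv X f y" if y: "y \<in> U \<inter> SU" for y
    proof -
      interpret D: bounded_linear "frechet_derivative F (at y)"
        using smooth_on_open_has_derivative[OF F(2)] y has_derivative_bounded_linear by blast
      have "frechet_derivative F (at y) (y ** X) = frechet_derivative F (at y) (\<Sum>b\<in>Basis. ((y ** X) \<bullet> b) *\<^sub>R b)"
        by (simp add: euclidean_representation)
      also have "\<dots> = G y"
        by (simp add: G_def D.sum D.scaleR scaleR_conv_of_real[where 'a=complex])
      finally show ?thesis
        using left_inv_deriv_local[OF F(2,3) y X] by simp
    qed
    ultimately show ?thesis
      using F(1) by blast
  qed
  moreover have "left_inv_deriv X f x = 0" if "x \<notin> SU" for x
    using f X that by (intro left_inv_derivI) (auto simp: smooth_SU_def curve_in_SU)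
  ultimately show ?thesis
    by (auto simp: smooth_SU_def smooth_on_def)
qed

lemma smooth_SU_continuous_on:
  fixes f :: "'n::finite cmat \<Rightarrow> complex"
  assumes "f \<in> smooth_SU"
  shows "continuous_on SU f"
proof -
  have "continuous (at x within SU) f" if x: "x \<in> SU" for x :: "'n cmat"
  proof -
    obtain U F where F: "x \<in> U" "smooth_on_open F U" "\<And>y. y \<in> U \<inter> SU \<Longrightarrow> F y = f y"
      using assms x unfolding smooth_SU_def smooth_on_def by blast
    have "open U"
      using F by (simp add: smooth_on_open_def)
    have "F \<midarrow>x\<rightarrow> F x"
      using has_derivative_continuous[OF smooth_on_open_has_derivative[OF F(2,1)]] by (simp add: isCont_def)
    then have "(F \<longlongrightarrow> f x) (at x within SU)"
      using F(3)[of x] x F(1) by (auto intro: tendsto_within_subset)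
    moreover have "\<forall>\<^sub>F y in at x within SU. F y = f y"
      using F(1,3) \<open>open U\<close> unfolding eventually_at_topological by blast
    ultimately show ?thesis
      unfolding continuous_within by (rule Lim_transform_eventually)
  qed
  then show ?thesis
    by (simp add: continuous_on_eq_continuous_within)
qed

lemma left_inv_deriv_linear:
  assumes f: "f \<in> smooth_SU"
  shows "\<exists>D. bounded_linear D \<and> (\<forall>X\<in>su. left_inv_deriv X f x = D X)"
proof (cases "x \<in> SU")
  case True
  then obtain U F where F: "x \<in> U" "smooth_on_open F U" "\<And>y. y \<in> U \<inter> SU \<Longrightarrow> F y = f y"
    using f unfolding smooth_SU_def smooth_on_def by blast
  have "bounded_linear (\<lambda>X. frechet_derivative F (at x) (x ** X))"
    by (intro bounded_linear_compose[OF has_derivative_bounded_linear[OF smooth_on_open_has_derivative[OF F(2,1)]]]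
        matrix_mult.bounded_linear_right)
  then show ?thesis
    using left_inv_deriv_local[OF F(2,3)] True F(1) by blast
next
  case False
  then show ?thesis
    using f left_inv_deriv_smooth_SU[OF f] by (intro exI[of _ "\<lambda>_. 0"]) (auto simp: smooth_SU_def)
qed

lemma left_inv_deriv_add_fun:
  assumes "f \<in> smooth_SU" "g \<in> smooth_SU" "X \<in> su"
  shows "left_inv_deriv X (\<lambda>x. f x + g x) = (\<lambda>x. left_inv_deriv X f x + left_inv_deriv X g x)"
  by (intro ext left_inv_derivI has_vector_derivative_add smooth_SU_has_vector_derivative_0 assms)

lemma left_inv_deriv_cmult:
  assumes "f \<in> smooth_SU" "X \<in> su"
  shows "left_inv_deriv X (\<lambda>x. c * f x) = (\<lambda>x. c * left_inv_deriv X f x)"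
  by (intro ext left_inv_derivI has_vector_derivative_mult_right smooth_SU_has_vector_derivative_0 assms)

lemma left_inv_deriv_mult:
  assumes "f \<in> smooth_SU" "g \<in> smooth_SU" "X \<in> su"
  shows "left_inv_deriv X (\<lambda>x. f x * g x) = (\<lambda>x. f x * left_inv_deriv X g x + left_inv_deriv X f x * g x)"
proof (intro ext left_inv_derivI)
  fix x
  show "((\<lambda>s. f (x ** mexp (s *\<^sub>R X)) * g (x ** mexp (s *\<^sub>R X))) has_vector_derivative
      f x * left_inv_deriv X g x + left_inv_deriv X f x * g x) (at 0)"
    using has_vector_derivative_mult[OF smooth_SU_has_vector_derivative_0[OF assms(1,3), of x]
        smooth_SU_has_vector_derivative_0[OF assms(2,3), of x]]
    by (simp add: mexp_zero)
qed

lemma smooth_on_cpoly: "cpoly p \<Longrightarrow> smooth_on p SU"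
  unfolding smooth_on_def by (intro ballI exI[of _ UNIV] exI[of _ p]) (auto intro: cpoly_smooth_on_open)

lemma rst_cpoly_smooth_SU: "cpoly p \<Longrightarrow> rst p \<in> smooth_SU"
  by (intro rst_smooth_SU smooth_on_cpoly)

lemma left_inv_deriv_rst_linear:
  assumes "bounded_linear \<phi>" "X \<in> su"
  shows "left_inv_deriv X (rst \<phi>) = rst (\<lambda>x. \<phi> (x ** X))"
proof (intro ext left_inv_derivI)
  fix x
  have "((\<lambda>s. \<phi> (x ** mexp (s *\<^sub>R X))) has_vector_derivative \<phi> (x ** X)) (at 0)"
    using bounded_linear.has_vector_derivative[OF assms(1) curve_has_vector_derivative[of x X 0]]
    by (simp add: mexp_zero)
  then show "((\<lambda>s. rst \<phi> (x ** mexp (s *\<^sub>R X))) has_vector_derivative rst (\<lambda>x. \<phi> (x ** X)) x) (at 0)"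
    using assms(2) by (simp add: rst_def curve_in_SU)
qed

lemma left_inv_deriv_rst_const:
  assumes "X \<in> su"
  shows "left_inv_deriv X (rst (\<lambda>x. c)) = (\<lambda>x. 0)"
  by (intro ext left_inv_derivI) (simp add: rst_def curve_in_SU assms)

section \<open>Polynomial functions on the group as a module\<close>

definition fscale :: "complex \<Rightarrow> ('a \<Rightarrow> complex) \<Rightarrow> 'a \<Rightarrow> complex" where
  "fscale c f = (\<lambda>x. c * f x)"

lemma fscale_apply: "fscale c f x = c * f x"
  by (simp add: fscale_def)

interpretation fn: complex_vector_space fscale
  by unfold_locales (auto simp: fun_eq_iff fscale_apply algebra_simps)

lemma sum_fun_apply: "(\<Sum>i\<in>I. f i) x = (\<Sum>i\<in>I. f i x)" for f :: "'i \<Rightarrow> 'a \<Rightarrow> complex"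
  by (induction I rule: infinite_finite_induct) auto

definition pol :: "('n::finite cmat \<Rightarrow> complex) set" where
  "pol = rst ` {p. cpoly p}"

lemma pol_smooth_SU: "f \<in> pol \<Longrightarrow> f \<in> smooth_SU"
  unfolding pol_def using rst_cpoly_smooth_SU by blast

lemma pol_rst: "cpoly p \<Longrightarrow> rst p \<in> pol"
  by (simp add: pol_def)

lemma pol_add: "f \<in> pol \<Longrightarrow> g \<in> pol \<Longrightarrow> (\<lambda>x. f x + g x) \<in> pol"
proof -
  assume "f \<in> pol" "g \<in> pol"
  then obtain p q where "cpoly p" "f = rst p" "cpoly q" "g = rst q"
    by (auto simp: pol_def)
  moreover have "(\<lambda>x. rst p x + rst q x) = rst (\<lambda>x. p x + q x)"
    by (auto simp: rst_def)
  ultimately show ?thesis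
    by (simp add: pol_rst cpoly_add)
qed

lemma pol_mult: "f \<in> pol \<Longrightarrow> g \<in> pol \<Longrightarrow> (\<lambda>x. f x * g x) \<in> pol"
proof -
  assume "f \<in> pol" "g \<in> pol"
  then obtain p q where "cpoly p" "f = rst p" "cpoly q" "g = rst q"
    by (auto simp: pol_def)
  moreover have "(\<lambda>x. rst p x * rst q x) = rst (\<lambda>x. p x * q x)"
    by (auto simp: rst_def)
  ultimately show ?thesis
    by (simp add: pol_rst cpoly_mult)
qed

lemma pol_cmult: "f \<in> pol \<Longrightarrow> (\<lambda>x. c * f x) \<in> pol"
proof -
  assume "f \<in> pol"
  then obtain p where "cpoly p" "f = rst p"
    by (auto simp: pol_def)
  moreover have "(\<lambda>x. c * rst p x) = rst (\<lambda>x. c * p x)"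
    by (auto simp: rst_def)
  ultimately show ?thesis
    by (simp add: pol_rst cpoly_mult cpoly_const)
qed

lemma pol_zero: "(\<lambda>x. 0) \<in> pol"
proof -
  have "(\<lambda>x. 0) = rst (\<lambda>x. 0)"
    by (auto simp: rst_def)
  then show ?thesis
    using pol_rst[OF cpoly_const] by metis
qed

lemma pol_sum: "(\<And>i. i \<in> I \<Longrightarrow> f i \<in> pol) \<Longrightarrow> (\<lambda>x. \<Sum>i\<in>I. f i x) \<in> pol"
  by (induction I rule: infinite_finite_induct) (simp_all add: pol_zero pol_add)

lemma subspace_pol: "fn.subspace pol"
  unfolding fn.subspace_def using pol_zero pol_add pol_cmult
  by (auto simp: zero_fun_def plus_fun_def fscale_def)

lemma pol_induct [consumes 1, case_names linear const add mult]:
  assumes "f \<in> pol"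
    and "\<And>\<phi>. bounded_linear \<phi> \<Longrightarrow> P (rst \<phi>)"
    and "\<And>c. P (rst (\<lambda>x. c))"
    and "\<And>f g. f \<in> pol \<Longrightarrow> g \<in> pol \<Longrightarrow> P f \<Longrightarrow> P g \<Longrightarrow> P (\<lambda>x. f x + g x)"
    and "\<And>f g. f \<in> pol \<Longrightarrow> g \<in> pol \<Longrightarrow> P f \<Longrightarrow> P g \<Longrightarrow> P (\<lambda>x. f x * g x)"
  shows "P f"
proof -
  obtain p where "cpoly p" "f = rst p"
    using assms(1) by (auto simp: pol_def)
  have "P (rst p)"
    using \<open>cpoly p\<close>
  proof (induction rule: cpoly.induct)
    case (cpoly_add f g)
    moreover have "rst (\<lambda>x. f x + g x) = (\<lambda>x. rst f x + rst g x)"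
      by (auto simp: rst_def)
    ultimately show ?case
      using assms(4) by (simp add: pol_rst)
  next
    case (cpoly_mult f g)
    moreover have "rst (\<lambda>x. f x * g x) = (\<lambda>x. rst f x * rst g x)"
      by (auto simp: rst_def)
    ultimately show ?case
      using assms(5) by (simp add: pol_rst)
  qed (use assms in auto)
  then show ?thesis
    using \<open>f = rst p\<close> by simp
qed

lemma bounded_linear_mult_right_compose:
  fixes \<phi> :: "'n::finite cmat \<Rightarrow> complex" and X :: "'n cmat"
  assumes "bounded_linear \<phi>"
  shows "bounded_linear (\<lambda>x. \<phi> (x ** X))"
  by (rule bounded_linear_compose[OF assms matrix_mult.bounded_linear_left])

lemma left_inv_deriv_pol:
  assumes "f \<in> pol" "X \<in> su"
  shows "left_inv_deriv X f \<in> pol"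
  using assms(1)
proof (induction rule: pol_induct)
  case (linear \<phi>)
  then show ?case
    by (simp add: left_inv_deriv_rst_linear assms(2) pol_rst cpoly_linear bounded_linear_mult_right_compose)
next
  case (const c)
  show ?case
    by (simp add: left_inv_deriv_rst_const assms(2) pol_zero)
next
  case (add f g)
  then show ?case
    by (simp add: left_inv_deriv_add_fun assms(2) pol_smooth_SU pol_add)
next
  case (mult f g)
  then show ?case
    by (simp add: left_inv_deriv_mult assms(2) pol_smooth_SU pol_add pol_mult)
qed

text \<open>Both sides are derivations in \<open>f\<close>, the left one because the mixed products
  cancel in a commutator. So it suffices to compare them on constants and on linear functionals,
  where a field acts by right multiplication of the argument.\<close>

lemma left_inv_deriv_commutator:
  assumes "f \<in> pol" and XY: "X \<in> su" "Y \<in> su"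
  shows "left_inv_deriv X (left_inv_deriv Y f) x - left_inv_deriv Y (left_inv_deriv X f) x = left_inv_deriv (ad X Y) f x"
  using assms(1)
proof (induction arbitrary: x rule: pol_induct)
  case (linear \<phi>)
  then have bl: "bounded_linear \<phi>" .
  interpret bounded_linear \<phi> by fact
  show ?case
    using bl XY by (simp add: left_inv_deriv_rst_linear ad_in_su bounded_linear_mult_right_compose)
      (simp add: rst_def ad_def matrix_mult.diff_right diff matrix_mul_assoc)
next
  case (const c)
  have zero: "left_inv_deriv Z (\<lambda>x. 0) = (\<lambda>x. 0)" if "Z \<in> su" for Z :: "'n::finite cmat"
    using left_inv_deriv_cmult[of "\<lambda>x. 0" Z 0] that pol_smooth_SU[OF pol_zero] by simp
  show ?case
    using XY by (simp add: left_inv_deriv_rst_const zero ad_in_su)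
next
  case (add f g)
  then show ?case
    using XY by (simp add: left_inv_deriv_add_fun ad_in_su left_inv_deriv_smooth_SU pol_smooth_SU)
      (metis add_diff_add)
next
  case (mult f g)
  note s = pol_smooth_SU[OF mult(1)] pol_smooth_SU[OF mult(2)]
  have p: "left_inv_deriv Z h \<in> pol" "left_inv_deriv Z h \<in> smooth_SU" if "h \<in> {f, g}" "Z \<in> {X, Y}" for h Z
    using that mult XY by (auto intro: left_inv_deriv_pol left_inv_deriv_smooth_SU s)
  have second: "left_inv_deriv Z (left_inv_deriv W (\<lambda>x. f x * g x)) =
     (\<lambda>x. (f x * left_inv_deriv Z (left_inv_deriv W g) x + left_inv_deriv Z f x * left_inv_deriv W g x)
        + (left_inv_deriv W f x * left_inv_deriv Z g x + left_inv_deriv Z (left_inv_deriv W f) x * g x))"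
    if "Z \<in> {X, Y}" "W \<in> {X, Y}" for Z W
  proof -
    have ZW: "Z \<in> su" "W \<in> su"
      using that XY by auto
    show ?thesis
      unfolding left_inv_deriv_mult[OF s ZW(2)]
      using that by (subst left_inv_deriv_add_fun)
        (auto simp: left_inv_deriv_mult[OF _ _ ZW(1)] s p ZW pol_smooth_SU pol_mult mult.hyps)
  qed
  have "left_inv_deriv (ad X Y) (\<lambda>x. f x * g x) x = f x * left_inv_deriv (ad X Y) g x + left_inv_deriv (ad X Y) f x * g x"
    by (simp add: left_inv_deriv_mult[OF s ad_in_su[OF XY]])
  then show ?case
    by (simp add: second mult.IH[symmetric] algebra_simps)
qed

text \<open>The complex linear extension of the derivations from \<open>su\<close> to traceless
  matrices. It provides the raising and lowering operators, which are not derivatives along curves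
  in the group.\<close>

definition cderiv :: "'n::finite cmat \<Rightarrow> ('n cmat \<Rightarrow> complex) \<Rightarrow> 'n cmat \<Rightarrow> complex" where
  "cderiv Z f = (\<lambda>x. left_inv_deriv (skew_part Z) f x + \<i> * left_inv_deriv (herm_part Z) f x)"

lemma cderiv_coefficients:
  fixes f :: "'n::finite cmat \<Rightarrow> complex"
  assumes f: "f \<in> smooth_SU"
  shows "\<exists>\<tau>. \<forall>Z. trace Z = 0 \<longrightarrow> cderiv Z f x = (\<Sum>a\<in>UNIV. \<Sum>b\<in>UNIV. Z $ a $ b * \<tau> a b)"
proof -
  obtain D where D: "bounded_linear D" "\<And>X. X \<in> su \<Longrightarrow> left_inv_deriv X f x = D X"
    using left_inv_deriv_linear[OF f, of x] by blast
  interpret D: bounded_linear D by (rule D(1))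
  \<comment> \<open>\<open>D\<close> is defined on all matrices, so \<open>T\<close> may be
    evaluated at every elementary matrix, traceless or not. Its complex linearity follows once it is
    seen to respect multiplication by i.\<close>
  define T where "T Z = D (skew_part Z) + \<i> * D (herm_part Z)" for Z
  have "skew_part (A + B) = skew_part A + skew_part B" for A B :: "'n cmat"
    by (simp add: skew_part_def linear_add[OF linear_ctranspose] scaleR_add_right scaleR_diff_right)
  moreover have "herm_part (A + B) = herm_part A + herm_part B" for A B :: "'n cmat"
    by (simp add: vec_eq_iff herm_part_def field_simps)
  ultimately have T_add: "T (A + B) = T A + T B" for A B
    by (simp add: T_def D.add algebra_simps)
  have "skew_part 0 = (0 :: 'n cmat)" "herm_part 0 = (0 :: 'n cmat)"
    by (simp_all add: vec_eq_iff skew_part_def herm_part_def)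
  then have "T 0 = 0"
    by (simp add: T_def D.zero)
  then have T_sum: "T (\<Sum>i\<in>I. A i) = (\<Sum>i\<in>I. T (A i))" for A and I :: "'n set"
    by (induction I rule: infinite_finite_induct) (auto simp: T_add)
  have T_scale: "T (r *\<^sub>R A) = of_real r * T A" for r A
  proof -
    have "skew_part (r *\<^sub>R A) = r *\<^sub>R skew_part A"
      by (simp add: skew_part_def linear_scale[OF linear_ctranspose] scaleR_diff_right)
    moreover have "herm_part (r *\<^sub>R A) = r *\<^sub>R herm_part A"
      by (simp add: vec_eq_iff herm_part_def scaleR_conv_of_real[where 'a=complex] algebra_simps)
    ultimately show ?thesis
      by (simp add: T_def D.scaleR scaleR_conv_of_real[where 'a=complex] algebra_simps)
  qed
  have T_i: "T (\<chi> i j. \<i> * A $ i $ j) = \<i> * T A" for A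
  proof -
    have "skew_part (\<chi> i j. \<i> * A $ i $ j) = - herm_part A" "herm_part (\<chi> i j. \<i> * A $ i $ j) = skew_part A"
      by (simp_all add: vec_eq_iff skew_part_def herm_part_def scaleR_conv_of_real[where 'a=complex] algebra_simps)
    then show ?thesis
      by (simp add: T_def D.neg algebra_simps)
  qed
  have T_elem: "T (elem_mat a b c) = c * T (elem_mat a b 1)" for a b c
  proof -
    have "elem_mat a b c = Re c *\<^sub>R elem_mat a b 1 + Im c *\<^sub>R (\<chi> i j. \<i> * elem_mat a b 1 $ i $ j)"
      by (simp add: vec_eq_iff scaleR_conv_of_real[where 'a=complex] complex_eq[of c, symmetric] mult.commute)
    then have "T (elem_mat a b c) = (of_real (Re c) + \<i> * of_real (Im c)) * T (elem_mat a b 1)"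
      by (simp only: T_add T_scale T_i) (simp add: algebra_simps)
    then show ?thesis
      by (simp only: complex_eq[symmetric])
  qed
  have "cderiv Z f x = (\<Sum>a\<in>UNIV. \<Sum>b\<in>UNIV. Z $ a $ b * T (elem_mat a b 1))" if "trace Z = 0" for Z
  proof -
    have "cderiv Z f x = T Z"
      using D(2) skew_part_in_su[OF that] herm_part_in_su[OF that] by (simp add: cderiv_def T_def)
    also have "T Z = T (\<Sum>a\<in>UNIV. \<Sum>b\<in>UNIV. elem_mat a b (Z $ a $ b))"
      by (rule arg_cong[where f=T, OF elem_mat_decompose])
    also have "\<dots> = (\<Sum>a\<in>UNIV. \<Sum>b\<in>UNIV. T (elem_mat a b (Z $ a $ b)))"
      by (subst T_sum, intro sum.cong refl, rule T_sum)
    also have "\<dots> = (\<Sum>a\<in>UNIV. \<Sum>b\<in>UNIV. Z $ a $ b * T (elem_mat a b 1))"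
      by (rule sum.cong[OF refl], rule sum.cong[OF refl], rule T_elem)
    finally show ?thesis .
  qed
  then show ?thesis
    by (intro exI[of _ "\<lambda>a b. T (elem_mat a b 1)"]) simp
qed

lemma skew_herm_unique:
  assumes "X \<in> su" "Y \<in> su" and Z: "\<And>i j. Z $ i $ j = X $ i $ j + \<i> * Y $ i $ j"
  shows "skew_part Z = X" "herm_part Z = Y"
proof -
  have "ctranspose X $ i $ j = (- X) $ i $ j" "ctranspose Y $ i $ j = (- Y) $ i $ j" for i j
    using assms by (auto simp: su_def)
  then have "cnj (X $ j $ i) = - X $ i $ j" "cnj (Y $ j $ i) = - Y $ i $ j" for i j
    by auto
  then show "skew_part Z = X" "herm_part Z = Y"
    by (simp_all add: vec_eq_iff skew_part_def herm_part_def Z scaleR_conv_of_real[where 'a=complex] algebra_simps)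
qed

lemma left_inv_deriv_zero: "f \<in> smooth_SU \<Longrightarrow> left_inv_deriv 0 f x = 0"
  using left_inv_deriv_linear[of f x] subspace_0[OF subspace_su] bounded_linear.linear linear_0 by metis

lemma left_inv_deriv_eq_cderiv:
  assumes "f \<in> smooth_SU" "X \<in> su"
  shows "left_inv_deriv X f = cderiv X f"
proof -
  have "skew_part X = X" "herm_part X = 0"
    using skew_herm_unique[OF assms(2) subspace_0[OF subspace_su], of X] by auto
  then show ?thesis
    using left_inv_deriv_zero[OF assms(1)] by (simp add: cderiv_def)
qed

text \<open>\<open>cderiv_coefficients\<close> expands over elementary matrices. Passing to
  traceless units changes the sum by \<open>trace Z\<close> times the mean \<open>s\<close> of the
  diagonal coefficients, which is zero.\<close>

lemma cderiv_expand:
  fixes f :: "'n::finite cmat \<Rightarrow> complex"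
  assumes f: "f \<in> smooth_SU" and Z: "trace Z = 0"
  shows "cderiv Z f x = (\<Sum>a\<in>UNIV. \<Sum>b\<in>UNIV. Z $ a $ b * cderiv (tl_unit a b) f x)"
proof -
  obtain \<tau> where \<tau>: "\<And>Z. trace Z = 0 \<Longrightarrow> cderiv Z f x = (\<Sum>a\<in>UNIV. \<Sum>b\<in>UNIV. Z $ a $ b * \<tau> a b)"
    using cderiv_coefficients[OF f, of x] by blast
  define s where "s = (\<Sum>c\<in>UNIV. \<tau> c c) / of_nat CARD('n)"
  have unit: "cderiv (tl_unit a b) f x = \<tau> a b - (if a = b then s else 0)" for a b
  proof -
    have if_sum: "(\<Sum>j\<in>UNIV. if P then F j else 0) = (if P then \<Sum>j\<in>UNIV. F j else 0)" for P and F :: "'n \<Rightarrow> complex"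
      by simp
    have "cderiv (tl_unit a b) f x = (\<Sum>i\<in>UNIV. \<Sum>j\<in>UNIV. tl_unit a b $ i $ j * \<tau> i j)"
      by (rule \<tau>[OF trace_tl_unit])
    also have "\<dots> = (\<Sum>i\<in>UNIV. \<Sum>j\<in>UNIV. (if j = b then if i = a then \<tau> i j else 0 else 0)
        - (if j = i then if a = b then \<tau> i j / of_nat CARD('n) else 0 else 0))"
      by (intro sum.cong refl) (auto simp: tl_unit_entry algebra_simps)
    also have "\<dots> = \<tau> a b - (if a = b then s else 0)"
      by (simp add: sum_subtractf if_sum s_def sum_divide_distrib)
    finally show ?thesis .
  qed
  have "(\<Sum>a\<in>UNIV. \<Sum>b\<in>UNIV. Z $ a $ b * cderiv (tl_unit a b) f x)
      = (\<Sum>a\<in>UNIV. \<Sum>b\<in>UNIV. Z $ a $ b * \<tau> a b - (if b = a then Z $ a $ b * s else 0))"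
    unfolding unit by (intro sum.cong refl) (auto simp: algebra_simps)
  also have "\<dots> = (\<Sum>a\<in>UNIV. \<Sum>b\<in>UNIV. Z $ a $ b * \<tau> a b) - trace Z * s"
    by (simp add: sum_subtractf trace_def sum_distrib_right)
  finally show ?thesis
    using \<tau>[OF Z] Z by simp
qed

lemma cderiv_pol: "f \<in> pol \<Longrightarrow> trace Z = 0 \<Longrightarrow> cderiv Z f \<in> pol"
  unfolding cderiv_def
  by (intro pol_add pol_cmult left_inv_deriv_pol skew_part_in_su herm_part_in_su)

lemma cderiv_add_fun:
  assumes "f \<in> smooth_SU" "g \<in> smooth_SU" "trace Z = 0"
  shows "cderiv Z (\<lambda>x. f x + g x) = (\<lambda>x. cderiv Z f x + cderiv Z g x)"
  using assms by (simp add: cderiv_def left_inv_deriv_add_fun skew_part_in_su herm_part_in_su algebra_simps)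

lemma cderiv_cmult:
  assumes "f \<in> smooth_SU" "trace Z = 0"
  shows "cderiv Z (\<lambda>x. c * f x) = (\<lambda>x. c * cderiv Z f x)"
  using assms by (simp add: cderiv_def left_inv_deriv_cmult skew_part_in_su herm_part_in_su algebra_simps)

lemma cderiv_mult:
  assumes "f \<in> smooth_SU" "g \<in> smooth_SU" "trace Z = 0"
  shows "cderiv Z (\<lambda>x. f x * g x) = (\<lambda>x. f x * cderiv Z g x + cderiv Z f x * g x)"
  using assms by (simp add: cderiv_def left_inv_deriv_mult skew_part_in_su herm_part_in_su algebra_simps)

lemma cderiv_sum:
  assumes "\<And>i. i \<in> I \<Longrightarrow> f i \<in> pol" "trace Z = 0"
  shows "cderiv Z (\<lambda>x. \<Sum>i\<in>I. f i x) = (\<lambda>x. \<Sum>i\<in>I. cderiv Z (f i) x)"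
proof -
  have zero: "cderiv Z (\<lambda>x. 0) = (\<lambda>x. 0)"
    using cderiv_cmult[OF pol_smooth_SU[OF pol_zero] assms(2), of 0] by simp
  show ?thesis
    using assms(1)
    by (induction I rule: infinite_finite_induct)
      (simp_all add: zero cderiv_add_fun pol_smooth_SU pol_sum assms(2))
qed

text \<open>The relation extends from \<open>su\<close> by complex bilinearity: for Z = A + iB and W
  = C + iD the bracket splits into [A,C] - [B,D] and [A,D] + [B,C], both in
  \<open>su\<close>.\<close>

lemma cderiv_commutator:
  assumes f: "f \<in> pol" and Z: "trace Z = 0" and W: "trace W = 0"
  shows "cderiv Z (cderiv W f) x - cderiv W (cderiv Z f) x = cderiv (ad Z W) f x"
proof -
  define A B C D where "A = skew_part Z" and "B = herm_part Z" and "C = skew_part W" and "D = herm_part W"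
  have su: "A \<in> su" "B \<in> su" "C \<in> su" "D \<in> su"
    using Z W by (simp_all add: A_def B_def C_def D_def skew_part_in_su herm_part_in_su)
  have ad_parts: "skew_part (ad Z W) = ad A C - ad B D" "herm_part (ad Z W) = ad A D + ad B C"
  proof -
    have "ad Z W $ i $ j = (ad A C - ad B D) $ i $ j + \<i> * (ad A D + ad B C) $ i $ j" for i j
    proof -
      have Zij: "Z $ i $ j = A $ i $ j + \<i> * B $ i $ j" and Wij: "W $ i $ j = C $ i $ j + \<i> * D $ i $ j" for i j
        unfolding A_def B_def C_def D_def by (rule skew_herm_decompose)+
      have ZW: "(Z ** W) $ i $ j = (A ** C) $ i $ j - (B ** D) $ i $ j + \<i> * ((A ** D) $ i $ j + (B ** C) $ i $ j)"
        unfolding matrix_matrix_mult_def vec_lambda_beta Zij Wij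
        by (simp add: algebra_simps sum.distrib sum_subtractf sum_distrib_left)
      have WZ: "(W ** Z) $ i $ j = (C ** A) $ i $ j - (D ** B) $ i $ j + \<i> * ((C ** B) $ i $ j + (D ** A) $ i $ j)"
        unfolding matrix_matrix_mult_def vec_lambda_beta Zij Wij
        by (simp add: algebra_simps sum.distrib sum_subtractf sum_distrib_left)
      show ?thesis
        unfolding ad_def vector_minus_component vector_add_component ZW WZ by (simp add: algebra_simps)
    qed
    moreover have "ad A C - ad B D \<in> su" "ad A D + ad B C \<in> su"
      using su by (simp_all add: subspace_diff[OF subspace_su] subspace_add[OF subspace_su] ad_in_su)
    ultimately show "skew_part (ad Z W) = ad A C - ad B D" "herm_part (ad Z W) = ad A D + ad B C"
      using skew_herm_unique[of "ad A C - ad B D" "ad A D + ad B C" "ad Z W"] by blast+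
  qed
  have fs: "f \<in> smooth_SU"
    using f by (rule pol_smooth_SU)
  obtain L where L: "bounded_linear L" "\<And>X. X \<in> su \<Longrightarrow> left_inv_deriv X f x = L X"
    using left_inv_deriv_linear[OF fs, of x] by blast
  interpret L: bounded_linear L by (rule L(1))
  have s: "left_inv_deriv X f \<in> smooth_SU" if "X \<in> su" for X
    using left_inv_deriv_smooth_SU[OF fs that] .
  have sc: "(\<lambda>x. c * left_inv_deriv X f x) \<in> smooth_SU" if "X \<in> su" for X c
    using pol_smooth_SU[OF pol_cmult[OF left_inv_deriv_pol[OF f that]]] .
  have comm: "left_inv_deriv X (left_inv_deriv Y f) x = left_inv_deriv Y (left_inv_deriv X f) x + L (ad X Y)"
    if "X \<in> su" "Y \<in> su" for X Y
    using left_inv_deriv_commutator[OF f that, of x] L(2)[OF ad_in_su[OF that]] by (simp add: algebra_simps)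
  have e1: "cderiv (ad Z W) f x = L (ad A C) - L (ad B D) + \<i> * (L (ad A D) + L (ad B C))"
    using su by (simp add: cderiv_def ad_parts L(2) ad_in_su subspace_diff[OF subspace_su] subspace_add[OF subspace_su] L.diff L.add)
  have e2: "cderiv Z (cderiv W f) x = left_inv_deriv A (left_inv_deriv C f) x + \<i> * left_inv_deriv A (left_inv_deriv D f) x
      + \<i> * (left_inv_deriv B (left_inv_deriv C f) x + \<i> * left_inv_deriv B (left_inv_deriv D f) x)"
    using su unfolding cderiv_def A_def[symmetric] B_def[symmetric] C_def[symmetric] D_def[symmetric]
    by (simp add: left_inv_deriv_add_fun left_inv_deriv_cmult s sc)
  have e3: "cderiv W (cderiv Z f) x = left_inv_deriv C (left_inv_deriv A f) x + \<i> * left_inv_deriv C (left_inv_deriv B f) x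
      + \<i> * (left_inv_deriv D (left_inv_deriv A f) x + \<i> * left_inv_deriv D (left_inv_deriv B f) x)"
    using su unfolding cderiv_def A_def[symmetric] B_def[symmetric] C_def[symmetric] D_def[symmetric]
    by (simp add: left_inv_deriv_add_fun left_inv_deriv_cmult s sc)
  show ?thesis
    unfolding e1 e2 e3 comm[OF su(1,3)] comm[OF su(1,4)] comm[OF su(2,3)] comm[OF su(2,4)]
    by (simp add: algebra_simps)
qed

section \<open>Finite-dimensional invariant spaces and their module structure\<close>

definition derivation_invariant :: "('n::finite cmat \<Rightarrow> complex) set \<Rightarrow> bool" where
  "derivation_invariant S \<longleftrightarrow> (\<forall>f\<in>S. \<forall>X\<in>su. left_inv_deriv X f \<in> S)"

lemma span_pol: "B \<subseteq> pol \<Longrightarrow> fn.span B \<subseteq> pol"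
  by (rule fn.span_minimal[OF _ subspace_pol])

lemma zero_in_span: "(\<lambda>x. 0) \<in> fn.span B"
  using fn.span_zero[of B] by (simp only: zero_fun_def)

lemma derivation_invariant_span:
  fixes B :: "('n::finite cmat \<Rightarrow> complex) set"
  assumes B: "B \<subseteq> pol" and D: "\<And>b X. b \<in> B \<Longrightarrow> X \<in> su \<Longrightarrow> left_inv_deriv X b \<in> fn.span B"
  shows "derivation_invariant (fn.span B)"
  unfolding derivation_invariant_def
proof (intro ballI)
  fix f and X :: "'n cmat" assume f: "f \<in> fn.span B" and X: "X \<in> su"
  have pol: "g \<in> smooth_SU" if "g \<in> fn.span B" for g
    using that span_pol[OF B] pol_smooth_SU by blast
  let ?P = "\<lambda>f. f \<in> fn.span B \<and> left_inv_deriv X f \<in> fn.span B"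
  have "?P f"
    using f
  proof (induction rule: fn.span_induct_alt)
    case base
    have "left_inv_deriv X (\<lambda>x. 0) = (\<lambda>x. 0)"
      using left_inv_deriv_cmult[OF pol_smooth_SU[OF pol_zero] X, of 0] by simp
    then show ?case
      unfolding zero_fun_def by (simp only: zero_in_span simp_thms)
  next
    case (step c b f)
    have cb: "fscale c b \<in> fn.span B" "b \<in> fn.span B"
      using step(1) by (auto intro: fn.span_scale fn.span_base)
    have "left_inv_deriv X (\<lambda>x. fscale c b x + f x) = (\<lambda>x. left_inv_deriv X (fscale c b) x + left_inv_deriv X f x)"
      using step(2) cb by (intro left_inv_deriv_add_fun pol X) auto
    moreover have "left_inv_deriv X (fscale c b) = fscale c (left_inv_deriv X b)"
      unfolding fscale_def by (intro left_inv_deriv_cmult pol X cb)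
    ultimately have "left_inv_deriv X (fscale c b + f) = fscale c (left_inv_deriv X b) + left_inv_deriv X f"
      by (simp only: plus_fun_def)
    then show ?case
      using fn.span_add[OF cb(1), of f] fn.span_add[OF fn.span_scale[OF D[OF step(1) X]], of "left_inv_deriv X f" c] step(2)
      by (simp only: simp_thms)
  qed
  then show "left_inv_deriv X f \<in> fn.span B" by simp
qed

lemma linear_functional_span:
  fixes \<phi> :: "'n::finite cmat \<Rightarrow> complex"
  assumes "bounded_linear \<phi>"
  shows "rst \<phi> \<in> fn.span ((\<lambda>b. rst (\<lambda>x. of_real (x \<bullet> b))) ` Basis)"
proof -
  interpret bounded_linear \<phi> by fact
  have "rst \<phi> = (\<Sum>b\<in>Basis. fscale (\<phi> b) (rst (\<lambda>x. of_real (x \<bullet> b))))"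
  proof
    fix x
    have "\<phi> x = \<phi> (\<Sum>b\<in>Basis. (x \<bullet> b) *\<^sub>R b)"
      by (simp add: euclidean_representation)
    also have "\<dots> = (\<Sum>b\<in>Basis. \<phi> b * of_real (x \<bullet> b))"
      by (simp add: sum scaleR scaleR_conv_of_real[where 'a=complex] mult.commute)
    finally show "rst \<phi> x = (\<Sum>b\<in>Basis. fscale (\<phi> b) (rst (\<lambda>x. of_real (x \<bullet> b)))) x"
      by (simp add: sum_fun_apply rst_def fscale_apply)
  qed
  then show ?thesis
    by (simp only:) (intro fn.span_sum fn.span_scale fn.span_base imageI)
qed

lemma span_mult:
  assumes "f \<in> fn.span B" "g \<in> fn.span C"
  shows "(\<lambda>x. f x * g x) \<in> fn.span ((\<lambda>(b, c) x. b x * c x) ` (B \<times> C))"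
    (is "_ \<in> fn.span ?M")
proof -
  have base: "(\<lambda>x. b x * g x) \<in> fn.span ?M" if b: "b \<in> B" for b
    using assms(2)
  proof (induction rule: fn.span_induct_alt)
    case base
    show ?case
      using zero_in_span[of ?M] by (simp only: zero_fun_def mult_zero_right)
  next
    case (step a c g)
    have M: "(\<lambda>x. b x * c x) \<in> ?M"
      using b step(1) by force
    have "fscale a (\<lambda>x. b x * c x) + (\<lambda>x. b x * g x) \<in> fn.span ?M"
      by (rule fn.span_add[OF fn.span_scale[OF fn.span_base[OF M]] step(2)])
    moreover have "(\<lambda>x. b x * (fscale a c + g) x) = fscale a (\<lambda>x. b x * c x) + (\<lambda>x. b x * g x)"
      by (simp add: fun_eq_iff fscale_apply algebra_simps)
    ultimately show ?case
      by (simp only:)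
  qed
  show ?thesis
    using assms(1)
  proof (induction rule: fn.span_induct_alt)
    case base
    show ?case
      using zero_in_span[of ?M] by (simp only: zero_fun_def mult_zero_left)
  next
    case (step a b f)
    have "fscale a (\<lambda>x. b x * g x) + (\<lambda>x. f x * g x) \<in> fn.span ?M"
      by (rule fn.span_add[OF fn.span_scale[OF base[OF step(1)]] step(2)])
    moreover have "(\<lambda>x. (fscale a b + f) x * g x) = fscale a (\<lambda>x. b x * g x) + (\<lambda>x. f x * g x)"
      by (simp add: fun_eq_iff fscale_apply algebra_simps)
    ultimately show ?case
      by (simp only:)
  qed
qed

text \<open>Fields map linear functionals to linear functionals, so these span an invariant space.
  For a sum the union of the generating sets serves, and for a product, by the Leibniz rule, all
  products of generators.\<close>

lemma pol_locally_finite: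
  fixes f :: "'n::finite cmat \<Rightarrow> complex"
  assumes "f \<in> pol"
  shows "\<exists>B. finite B \<and> B \<subseteq> pol \<and> f \<in> fn.span B \<and> derivation_invariant (fn.span B)"
  using assms
proof (induction rule: pol_induct)
  case (linear \<phi>)
  let ?B = "(\<lambda>b :: 'n cmat. rst (\<lambda>x. complex_of_real (x \<bullet> b))) ` Basis"
  have bl: "bounded_linear (\<lambda>x. complex_of_real (x \<bullet> b))" for b :: "'n cmat"
    by (intro bounded_linear_compose[OF bounded_linear_of_real] bounded_linear_inner_left)
  then have "?B \<subseteq> pol"
    by (auto intro: pol_rst cpoly_linear)
  moreover have "derivation_invariant (fn.span ?B)"
    using \<open>?B \<subseteq> pol\<close>
  proof (rule derivation_invariant_span)
    fix b and X :: "'n cmat" assume "b \<in> ?B" and X: "X \<in> su"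
    then obtain c where "b = rst (\<lambda>x. complex_of_real (x \<bullet> c))"
      by auto
    then show "left_inv_deriv X b \<in> fn.span ?B"
      by (simp only: left_inv_deriv_rst_linear[OF bl X])
        (rule linear_functional_span[OF bounded_linear_mult_right_compose[OF bl]])
  qed
  ultimately show ?case
    using linear_functional_span[OF linear] by (intro exI[of _ ?B]) auto
next
  case (const c)
  let ?B = "{rst (\<lambda>x :: 'n cmat. c)}"
  have "?B \<subseteq> pol"
    by (auto intro: pol_rst cpoly_const)
  moreover have "derivation_invariant (fn.span ?B)"
    using \<open>?B \<subseteq> pol\<close>
    by (rule derivation_invariant_span) (use zero_in_span[of ?B] in \<open>simp add: left_inv_deriv_rst_const\<close>)
  ultimately show ?case
    by (intro exI[of _ ?B]) (auto intro: fn.span_base)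
next
  case (add f g)
  then obtain B C where B: "finite B" "B \<subseteq> pol" "f \<in> fn.span B" "derivation_invariant (fn.span B)"
    and C: "finite C" "C \<subseteq> pol" "g \<in> fn.span C" "derivation_invariant (fn.span C)" by blast
  have sub: "fn.span B \<subseteq> fn.span (B \<union> C)" "fn.span C \<subseteq> fn.span (B \<union> C)"
    by (auto intro: fn.span_mono[THEN subsetD])
  have "B \<union> C \<subseteq> pol"
    using B C by simp
  moreover have "derivation_invariant (fn.span (B \<union> C))"
    using \<open>B \<union> C \<subseteq> pol\<close>
    by (rule derivation_invariant_span)
      (use B(4) C(4) sub fn.span_base[of _ B] fn.span_base[of _ C] in \<open>unfold derivation_invariant_def, blast\<close>)
  moreover have "(\<lambda>x. f x + g x) \<in> fn.span (B \<union> C)"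
    using fn.span_add[of f "B \<union> C" g] B(3) C(3) sub by (auto simp: plus_fun_def)
  ultimately show ?case
    using B(1) C(1) by (intro exI[of _ "B \<union> C"]) auto
next
  case (mult f g)
  then obtain B C where B: "finite B" "B \<subseteq> pol" "f \<in> fn.span B" "derivation_invariant (fn.span B)"
    and C: "finite C" "C \<subseteq> pol" "g \<in> fn.span C" "derivation_invariant (fn.span C)" by blast
  let ?M = "(\<lambda>(b, c) x. b x * c x) ` (B \<times> C)"
  have "?M \<subseteq> pol"
    using B(2) C(2) by (auto intro: pol_mult)
  moreover have "derivation_invariant (fn.span ?M)"
    using \<open>?M \<subseteq> pol\<close>
  proof (rule derivation_invariant_span)
    fix m and X :: "'n cmat" assume "m \<in> ?M" and X: "X \<in> su"
    then obtain b c where bc: "b \<in> B" "c \<in> C" "m = (\<lambda>x. b x * c x)"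
      by auto
    then have "b \<in> smooth_SU" "c \<in> smooth_SU"
      using B(2) C(2) pol_smooth_SU by blast+
    then have "left_inv_deriv X m = (\<lambda>x. b x * left_inv_deriv X c x) + (\<lambda>x. left_inv_deriv X b x * c x)"
      by (simp add: bc(3) left_inv_deriv_mult X plus_fun_def)
    moreover have "b \<in> fn.span B" "c \<in> fn.span C"
      using bc by (auto intro: fn.span_base)
    moreover from this have "left_inv_deriv X b \<in> fn.span B" "left_inv_deriv X c \<in> fn.span C"
      using B(4) C(4) X by (auto simp: derivation_invariant_def)
    ultimately show "left_inv_deriv X m \<in> fn.span ?M"
      by (simp only:) (intro fn.span_add span_mult)
  qed
  ultimately show ?case
    using B(1,3) C(1,3) span_mult by (intro exI[of _ ?M]) auto
qed

text \<open>Scalar matrices drop out of the bracket, which leaves that of elementary matrices. The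
  right side may still use corrected units: a correction occurs only if both a = d and b = c, and
  then the two corrections cancel.\<close>

lemma ad_tl_unit:
  fixes a b c d :: "'n::finite"
  shows "ad (tl_unit a b) (tl_unit c d) $ i $ j =
    (if b = c then tl_unit a d $ i $ j else 0) - (if d = a then tl_unit c b $ i $ j else 0)"
proof -
  have mult: "(elem_mat a b 1 ** elem_mat c d 1) $ i $ j = (if b = c \<and> i = a \<and> j = d then 1 else 0)" for a b c d i j :: 'n
    by (simp add: mult_elem_mat_entry)
  have "(mat r ** A) $ i $ j = (A ** mat r) $ i $ j" for r i j and A :: "'n cmat"
    by (simp add: matrix_matrix_mult_def mat_def if_distrib[of "\<lambda>x. _ * x"] if_distrib[of "\<lambda>x. x * _"] cong: if_cong)
  then have "mat r ** A = A ** mat r" for r and A :: "'n cmat"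
    by (simp only: vec_eq_iff) simp
  then have scalar: "(if P then mat r else 0) ** A = A ** (if P then mat r else 0)" for P r and A :: "'n cmat"
    by (cases P) (simp_all only: if_True if_False matrix_mult.zero_left matrix_mult.zero_right)
  define u v s t where "u = elem_mat a b 1" and "v = elem_mat c d 1"
    and "s = (if a = b then mat (1 / of_nat CARD('n)) else 0 :: 'n cmat)"
    and "t = (if c = d then mat (1 / of_nat CARD('n)) else 0 :: 'n cmat)"
  have "s ** v = v ** s" "t ** u = u ** t" "t ** s = s ** t"
    unfolding s_def t_def by (rule scalar)+
  then have "(u - s) ** (v - t) - (v - t) ** (u - s) = u ** v - v ** u"
    by (simp add: matrix_mult.diff_left matrix_mult.diff_right)
  then have "ad (tl_unit a b) (tl_unit c d) = elem_mat a b 1 ** elem_mat c d 1 - elem_mat c d 1 ** elem_mat a b 1"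
    by (simp only: ad_def tl_unit_def u_def v_def s_def t_def)
  then show ?thesis
    by (auto simp: mult tl_unit_entry)
qed

text \<open>The enumeration \<open>h\<close> orders the index type, which gives raising operators a
  meaning. The commutators come from \<open>ad_tl_unit\<close>; the trace vanishes because the
  diagonal units sum to zero.\<close>

lemma gl_module_pol:
  fixes h :: "nat \<Rightarrow> 'n::finite"
  assumes h: "bij_betw h {..<CARD('n)} UNIV" and S: "fn.subspace S" "S \<subseteq> pol" "derivation_invariant S"
  shows "gl_module fscale S CARD('n) (\<lambda>i j. cderiv (tl_unit (h i) (h j)))"
proof unfold_locales
  show "fn.subspace S" by fact
next
  fix i j
  have smooth: "f \<in> smooth_SU" if "f \<in> S" for f
    using that S(2) pol_smooth_SU by blast
  show "fn.operator_on S (cderiv (tl_unit (h i) (h j)))"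
  proof (rule fn.operator_onI)
    fix f assume f: "f \<in> S"
    have "left_inv_deriv (skew_part (tl_unit (h i) (h j))) f + fscale \<i> (left_inv_deriv (herm_part (tl_unit (h i) (h j))) f) \<in> S"
      using S(3)[unfolded derivation_invariant_def, rule_format, OF f]
      by (intro fn.subspace_add[OF S(1)] fn.subspace_scale[OF S(1)]) (simp_all add: skew_part_in_su herm_part_in_su trace_tl_unit)
    then show "cderiv (tl_unit (h i) (h j)) f \<in> S"
      by (simp add: cderiv_def plus_fun_def fscale_def)
  next
    fix f g assume "f \<in> S" "g \<in> S"
    then show "cderiv (tl_unit (h i) (h j)) (f + g) = cderiv (tl_unit (h i) (h j)) f + cderiv (tl_unit (h i) (h j)) g"
      unfolding plus_fun_def by (intro cderiv_add_fun smooth trace_tl_unit)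
  next
    fix c f assume "f \<in> S"
    then show "cderiv (tl_unit (h i) (h j)) (fscale c f) = fscale c (cderiv (tl_unit (h i) (h j)) f)"
      unfolding fscale_def by (intro cderiv_cmult smooth trace_tl_unit)
  qed
next
  fix i j k l f assume ijkl: "i < CARD('n)" "j < CARD('n)" "k < CARD('n)" "l < CARD('n)" and "f \<in> S"
  then have f: "f \<in> pol" "f \<in> smooth_SU"
    using S(2) pol_smooth_SU by auto
  have inj: "h a = h b \<longleftrightarrow> a = b" if "a < CARD('n)" "b < CARD('n)" for a b
    using h that by (auto simp: bij_betw_def inj_on_def)
  let ?T = "\<lambda>i j. tl_unit (h i) (h j)"
  show "cderiv (?T i j) (cderiv (?T k l) f) - cderiv (?T k l) (cderiv (?T i j) f) =
      (if j = k then cderiv (?T i l) f else 0) - (if l = i then cderiv (?T k j) f else 0)"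
  proof
    fix x
    obtain \<tau> where \<tau>: "\<And>Z. trace Z = 0 \<Longrightarrow> cderiv Z f x = (\<Sum>a\<in>UNIV. \<Sum>b\<in>UNIV. Z $ a $ b * \<tau> a b)"
      using cderiv_coefficients[OF f(2), of x] by blast
    have "trace (ad (?T i j) (?T k l)) = 0"
      by (simp add: ad_def linear_diff[OF linear_trace] trace_mul_sym[of "?T k l" "?T i j"])
    then have "cderiv (?T i j) (cderiv (?T k l) f) x - cderiv (?T k l) (cderiv (?T i j) f) x =
        (\<Sum>a\<in>UNIV. \<Sum>b\<in>UNIV. ad (?T i j) (?T k l) $ a $ b * \<tau> a b)"
      unfolding cderiv_commutator[OF f(1) trace_tl_unit trace_tl_unit] by (rule \<tau>)
    also have "\<dots> = (if j = k then (\<Sum>a\<in>UNIV. \<Sum>b\<in>UNIV. ?T i l $ a $ b * \<tau> a b) else 0)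
        - (if l = i then (\<Sum>a\<in>UNIV. \<Sum>b\<in>UNIV. ?T k j $ a $ b * \<tau> a b) else 0)"
    proof -
      have "h j = h k \<longleftrightarrow> j = k" "h l = h i \<longleftrightarrow> l = i"
        using ijkl inj by blast+
      then show ?thesis
        unfolding ad_tl_unit by (cases "j = k"; cases "l = i") (simp_all add: left_diff_distrib sum_subtractf sum_negf)
    qed
    also have "\<dots> = (if j = k then cderiv (?T i l) f x else 0) - (if l = i then cderiv (?T k j) f x else 0)"
      by (simp only: \<tau>[OF trace_tl_unit])
    finally show "(cderiv (?T i j) (cderiv (?T k l) f) - cderiv (?T k l) (cderiv (?T i j) f)) x =
      ((if j = k then cderiv (?T i l) f else 0) - (if l = i then cderiv (?T k j) f else 0)) x"
      by simp
  qed
next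
  fix f assume "f \<in> S"
  then have f: "f \<in> smooth_SU"
    using S(2) pol_smooth_SU by auto
  show "(\<Sum>i<CARD('n). cderiv (tl_unit (h i) (h i)) f) = 0"
  proof
    fix x
    obtain \<tau> where \<tau>: "\<And>Z. trace Z = 0 \<Longrightarrow> cderiv Z f x = (\<Sum>a\<in>UNIV. \<Sum>b\<in>UNIV. Z $ a $ b * \<tau> a b)"
      using cderiv_coefficients[OF f, of x] by blast
    have "(\<Sum>i<CARD('n). cderiv (tl_unit (h i) (h i)) f) x = (\<Sum>c\<in>UNIV. cderiv (tl_unit c c) f x)"
      unfolding sum_fun_apply by (rule sum.reindex_bij_betw[OF h])
    also have "\<dots> = (\<Sum>c\<in>UNIV. \<Sum>a\<in>UNIV. \<Sum>b\<in>UNIV. tl_unit c c $ a $ b * \<tau> a b)"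
      by (simp only: \<tau>[OF trace_tl_unit])
    also have "\<dots> = (\<Sum>a\<in>UNIV. \<Sum>b\<in>UNIV. (\<Sum>c\<in>UNIV. tl_unit c c $ a $ b) * \<tau> a b)"
      by (subst sum.swap, rule sum.cong[OF refl], subst sum.swap) (simp add: sum_distrib_right)
    also have "\<dots> = 0"
    proof -
      have "(\<Sum>c\<in>UNIV. tl_unit c c $ a $ b) = (\<Sum>c\<in>UNIV. (if c = a then if a = b then 1 else 0 else 0) - (if a = b then 1 / of_nat CARD('n) else 0))" for a b :: 'n
        by (intro sum.cong refl) (auto simp: tl_unit_entry)
      then have "(\<Sum>c\<in>UNIV. tl_unit c c $ a $ b) = 0" for a b :: 'n
        by (simp add: sum_subtractf)
      then show ?thesis
        by simp
    qed
    finally show "(\<Sum>i<CARD('n). cderiv (tl_unit (h i) (h i)) f) x = 0 x"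
      by simp
  qed
qed

section \<open>Highest weight vectors\<close>

lemma laplacian_eq_sum:
  fixes \<gamma> :: real and g :: "'n::finite cmat \<Rightarrow> 'n cmat \<Rightarrow> real"
  assumes \<gamma>: "\<gamma> > 0" and g: "g = (\<lambda>X Y. - \<gamma> * killing SU X Y)"
  obtains B where "finite B" "B \<subseteq> su"
    "\<And>f x. laplacian SU g f x = - (\<Sum>X\<in>B. left_inv_deriv X (left_inv_deriv X f) x)"
    "\<And>i j k l. (\<Sum>X\<in>B. X $ k $ l * X $ i $ j) = of_real (1 / (2 * real CARD('n) * \<gamma>)) * - tl_unit l k $ i $ j"
proof -
  define B where "B = (SOME B. orthonormal_basis (lie_algebra SU) g B)"
  have B: "orthonormal_basis (lie_algebra SU) g B"
    unfolding B_def by (rule someI_ex) (rule exists_orthonormal_basis[OF \<gamma> g])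
  have "laplacian SU g f x = - (\<Sum>X\<in>B. left_inv_deriv X (left_inv_deriv X f) x)" for f x
    by (simp add: laplacian_def Let_def flip: B_def)
  with orthonormal_basis_completeness[OF \<gamma> g B] show ?thesis
    by (intro that[of B])
qed

abbreviation SU_laplacian :: "real \<Rightarrow> ('n::finite cmat \<Rightarrow> complex) \<Rightarrow> 'n cmat \<Rightarrow> complex" where
  "SU_laplacian \<gamma> \<equiv> laplacian SU (\<lambda>X Y. - \<gamma> * killing SU X Y)"

text \<open>Each basis field is expanded in the units; summing over the basis, the completeness
  relation collapses the four-fold sum to a Casimir sum. Its minus sign cancels the one in the
  Laplacian.\<close>

lemma laplacian_pol:
  fixes \<gamma> :: real and f :: "'n::finite cmat \<Rightarrow> complex"
  assumes \<gamma>: "\<gamma> > 0" and f: "f \<in> pol"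
  shows "SU_laplacian \<gamma> f x =
    of_real (1 / (2 * real CARD('n) * \<gamma>)) * (\<Sum>a\<in>UNIV. \<Sum>b\<in>UNIV. cderiv (tl_unit a b) (cderiv (tl_unit b a) f) x)"
proof -
  obtain B :: "'n cmat set" where B: "finite B" "B \<subseteq> su"
    and lap: "\<And>f x. SU_laplacian \<gamma> f x = - (\<Sum>X\<in>B. left_inv_deriv X (left_inv_deriv X f) x)"
    and complete: "\<And>i j k l. (\<Sum>X\<in>B. X $ k $ l * X $ i $ j) = of_real (1 / (2 * real CARD('n) * \<gamma>)) * - tl_unit l k $ i $ j"
    using laplacian_eq_sum[OF \<gamma> refl, where 'n='n] by blast
  let ?c = "complex_of_real (1 / (2 * real CARD('n) * \<gamma>))"
  define Q where "Q k l i j = cderiv (tl_unit k l) (cderiv (tl_unit i j) f) x" for k l i j :: 'n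
  have expand: "cderiv (tl_unit k l) (\<lambda>y. \<Sum>i\<in>UNIV. \<Sum>j\<in>UNIV. Z $ i $ j * cderiv (tl_unit i j) f y) x
      = (\<Sum>i\<in>UNIV. \<Sum>j\<in>UNIV. Z $ i $ j * Q k l i j)" for k l and Z :: "'n cmat"
    by (simp add: cderiv_sum cderiv_cmult pol_sum pol_cmult cderiv_pol f trace_tl_unit pol_smooth_SU Q_def)
  have second: "left_inv_deriv X (left_inv_deriv X f) x
      = (\<Sum>k\<in>UNIV. \<Sum>l\<in>UNIV. \<Sum>i\<in>UNIV. \<Sum>j\<in>UNIV. X $ k $ l * X $ i $ j * Q k l i j)" if X: "X \<in> B" for X
  proof -
    have su: "X \<in> su" "trace X = 0"
      using X B by (auto simp: su_def)
    have first: "left_inv_deriv X f = (\<lambda>y. \<Sum>i\<in>UNIV. \<Sum>j\<in>UNIV. X $ i $ j * cderiv (tl_unit i j) f y)"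
      unfolding left_inv_deriv_eq_cderiv[OF pol_smooth_SU[OF f] su(1)]
      by (rule ext) (rule cderiv_expand[OF pol_smooth_SU[OF f] su(2)])
    have sm: "left_inv_deriv X f \<in> smooth_SU"
      by (rule pol_smooth_SU[OF left_inv_deriv_pol[OF f su(1)]])
    have "left_inv_deriv X (left_inv_deriv X f) x = (\<Sum>k\<in>UNIV. \<Sum>l\<in>UNIV. X $ k $ l * cderiv (tl_unit k l) (left_inv_deriv X f) x)"
      unfolding left_inv_deriv_eq_cderiv[OF sm su(1)] by (rule cderiv_expand[OF sm su(2)])
    also have "\<dots> = (\<Sum>k\<in>UNIV. \<Sum>l\<in>UNIV. X $ k $ l * (\<Sum>i\<in>UNIV. \<Sum>j\<in>UNIV. X $ i $ j * Q k l i j))"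
      unfolding first expand ..
    finally show ?thesis
      by (simp add: sum_distrib_left mult.assoc)
  qed
  have "SU_laplacian \<gamma> f x
      = - (\<Sum>X\<in>B. \<Sum>k\<in>UNIV. \<Sum>l\<in>UNIV. \<Sum>i\<in>UNIV. \<Sum>j\<in>UNIV. X $ k $ l * X $ i $ j * Q k l i j)"
    unfolding lap by (rule arg_cong[where f=uminus], rule sum.cong[OF refl], rule second)
  also have "\<dots> = - (\<Sum>k\<in>UNIV. \<Sum>l\<in>UNIV. \<Sum>i\<in>UNIV. \<Sum>j\<in>UNIV. (\<Sum>X\<in>B. X $ k $ l * X $ i $ j) * Q k l i j)"
    by (simp only: sum.swap[of _ _ B] sum_distrib_right)
  also have "\<dots> = ?c * (\<Sum>k\<in>UNIV. \<Sum>l\<in>UNIV. \<Sum>i\<in>UNIV. \<Sum>j\<in>UNIV. tl_unit l k $ i $ j * Q k l i j)"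
    unfolding complete by (simp add: sum_distrib_left sum_negf mult.assoc)
  also have "(\<Sum>k\<in>UNIV. \<Sum>l\<in>UNIV. \<Sum>i\<in>UNIV. \<Sum>j\<in>UNIV. tl_unit l k $ i $ j * Q k l i j)
      = (\<Sum>k\<in>UNIV. \<Sum>l\<in>UNIV. cderiv (tl_unit k l) (cderiv (tl_unit l k) f) x)"
  proof (rule sum.cong[OF refl], rule sum.cong[OF refl])
    fix k l :: 'n
    have "cderiv (tl_unit l k) f = (\<lambda>y. \<Sum>i\<in>UNIV. \<Sum>j\<in>UNIV. tl_unit l k $ i $ j * cderiv (tl_unit i j) f y)"
      by (rule ext) (rule cderiv_expand[OF pol_smooth_SU[OF f] trace_tl_unit])
    then show "(\<Sum>i\<in>UNIV. \<Sum>j\<in>UNIV. tl_unit l k $ i $ j * Q k l i j) = cderiv (tl_unit k l) (cderiv (tl_unit l k) f) x"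
      using expand[of k l "tl_unit l k"] by (simp only:)
  qed
  finally show ?thesis .
qed

lemma laplacian_eq_casimir:
  fixes \<gamma> :: real and h :: "nat \<Rightarrow> 'n::finite"
  assumes \<gamma>: "\<gamma> > 0" and h: "bij_betw h {..<CARD('n)} UNIV"
    and S: "fn.subspace S" "S \<subseteq> pol" "derivation_invariant S" and f: "f \<in> S"
  shows "SU_laplacian \<gamma> f =
    fscale (of_real (1 / (2 * real CARD('n) * \<gamma>))) (gl_module.casimir CARD('n) (\<lambda>i j. cderiv (tl_unit (h i) (h j))) f)"
proof
  fix x
  have fpol: "f \<in> pol"
    using f S(2) by blast
  interpret gl_module fscale S "CARD('n)" "\<lambda>i j. cderiv (tl_unit (h i) (h j))"
    by (rule gl_module_pol[OF h S])
  have "casimir f x = (\<Sum>i<CARD('n). \<Sum>j<CARD('n). cderiv (tl_unit (h i) (h j)) (cderiv (tl_unit (h j) (h i)) f) x)"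
    by (simp add: casimir_def sum_fun_apply)
  also have "\<dots> = (\<Sum>i<CARD('n). \<Sum>b\<in>UNIV. cderiv (tl_unit (h i) b) (cderiv (tl_unit b (h i)) f) x)"
    by (rule sum.cong[OF refl]) (rule sum.reindex_bij_betw[OF h])
  also have "\<dots> = (\<Sum>a\<in>UNIV. \<Sum>b\<in>UNIV. cderiv (tl_unit a b) (cderiv (tl_unit b a) f) x)"
    by (rule sum.reindex_bij_betw[OF h])
  finally show "SU_laplacian \<gamma> f x =
    fscale (of_real (1 / (2 * real CARD('n) * \<gamma>))) (casimir f) x"
    using laplacian_pol[OF \<gamma> fpol, of x] by (simp add: fscale_apply)
qed

text \<open>A priori the derivative is only real linear. The determinant is affine in each row, so
  along an elementary matrix the derivative is the entry times a cofactor, which exhibits complex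
  linearity.\<close>

lemma det_derivative_complex_linear:
  fixes M V :: "'n::finite cmat"
  assumes G: "(det has_derivative G) (at M)"
  shows "G V = (\<Sum>a\<in>UNIV. \<Sum>b\<in>UNIV. V $ a $ b * det (\<chi> i. if i = a then axis b 1 else M $ i))"
proof -
  interpret bounded_linear G
    using G by (rule has_derivative_bounded_linear)
  have elem: "G (elem_mat a b c) = c * det (\<chi> i. if i = a then axis b 1 else M $ i)" (is "_ = c * ?k") for a b c
  proof -
    have "det (M + t *\<^sub>R elem_mat a b c) = det M + t *\<^sub>R (c * ?k)" for t :: real
    proof -
      have "M + t *\<^sub>R elem_mat a b c = (\<chi> i. if i = a then M $ i + vector_scalar_mult (of_real t * c) (axis b 1) else M $ i)"
        by (auto simp: vec_eq_iff axis_def scaleR_conv_of_real[where 'a=complex])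
      then have "det (M + t *\<^sub>R elem_mat a b c) = det (\<chi> i. if i = a then M $ i else M $ i)
          + det (\<chi> i. if i = a then vector_scalar_mult (of_real t * c) (axis b 1) else M $ i)"
        by (simp only: det_row_add[of a "\<lambda>i. M $ i" "\<lambda>i. vector_scalar_mult (of_real t * c) (axis b 1)" "\<lambda>i. M $ i"])
      also have "det (\<chi> i. if i = a then vector_scalar_mult (of_real t * c) (axis b 1) else M $ i) = (of_real t * c) * ?k"
        by (rule det_row_mul)
      finally show ?thesis
        by (simp add: scaleR_conv_of_real[where 'a=complex])
    qed
    moreover have "((\<lambda>t::real. det M + t *\<^sub>R (c * ?k)) has_vector_derivative c * ?k) (at 0)"
      by (auto intro!: derivative_eq_intros)
    ultimately show ?thesis
      using vector_derivative_unique_at[OF det_line_has_vector_derivative[OF G, of "elem_mat a b c"]] by simp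
  qed
  have "G V = G (\<Sum>a\<in>UNIV. \<Sum>b\<in>UNIV. elem_mat a b (V $ a $ b))"
    by (rule arg_cong[where f=G, OF elem_mat_decompose])
  then show ?thesis
    by (simp add: sum elem)
qed

text \<open>
  The principal minor on the index set \<open>A\<close>, as the determinant of a full-size matrix.
\<close>

definition minor_mat :: "'n::finite set \<Rightarrow> 'n cmat \<Rightarrow> 'n cmat" where
  "minor_mat A x = (\<chi> i j. if i \<in> A \<and> j \<in> A then x $ i $ j else if i = j then 1 else 0)"

text \<open>The linear part of the affine map \<open>minor_mat A\<close>.\<close>

definition block :: "'n::finite set \<Rightarrow> 'n cmat \<Rightarrow> 'n cmat" where
  "block A x = (\<chi> i j. if i \<in> A \<and> j \<in> A then x $ i $ j else 0)"

lemma cpoly_minor: "cpoly (\<lambda>x. det (minor_mat A x))"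
proof (rule cpoly_det)
  show "cpoly (\<lambda>x. minor_mat A x $ i $ j)" for i j
  proof (cases "i \<in> A \<and> j \<in> A")
    case True
    then show ?thesis
      by (simp add: minor_mat_def cpoly_entry)
  next
    case False
    then have "(\<lambda>x. minor_mat A x $ i $ j) = (\<lambda>x. if i = j then 1 else 0)"
      by (auto simp: minor_mat_def fun_eq_iff)
    then show ?thesis
      by (simp only: cpoly_const)
  qed
qed

lemma minor_has_derivative:
  fixes A :: "'n::finite set"
  obtains G where "(det has_derivative G) (at (minor_mat A x))"
    "((\<lambda>y. det (minor_mat A y)) has_derivative (\<lambda>V. G (block A V))) (at x)"
proof -
  obtain G where G: "(det has_derivative G) (at (minor_mat A x))"
    using cpoly_has_derivative[OF cpoly_det[of "\<lambda>x :: 'n cmat. x", OF cpoly_entry]] by blast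
  have "linear (block A)"
    by (intro linearI) (auto simp: block_def vec_eq_iff)
  then have "(block A has_derivative block A) (at x)"
    by (intro bounded_linear_imp_has_derivative) (simp add: linear_conv_bounded_linear)
  then have "((\<lambda>y. block A y + minor_mat A 0) has_derivative block A) (at x)"
    by (rule has_derivative_eq_rhs[OF has_derivative_add[OF _ has_derivative_const]]) simp
  moreover have "block A y + minor_mat A 0 = minor_mat A y" for y
    by (auto simp: block_def minor_mat_def vec_eq_iff)
  ultimately have "(minor_mat A has_derivative block A) (at x)"
    by simp
  from has_derivative_compose[OF this G] show ?thesis
    by (intro that[OF G])
qed

text \<open>For directions in \<open>su\<close> this is the chain rule; it extends to traceless
  \<open>Z\<close> because the derivative of the determinant is complex linear.\<close>

lemma cderiv_minor:
  fixes A :: "'n::finite set"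
  assumes G: "(det has_derivative G) (at (minor_mat A x))" and x: "x \<in> SU" and Z: "trace Z = 0"
  shows "cderiv Z (rst (\<lambda>y. det (minor_mat A y))) x = G (block A (x ** Z))"
proof -
  obtain H where "(det has_derivative H) (at (minor_mat A x))"
    "((\<lambda>y. det (minor_mat A y)) has_derivative (\<lambda>V. H (block A V))) (at x)"
    using minor_has_derivative by blast
  then have D: "((\<lambda>y. det (minor_mat A y)) has_derivative (\<lambda>V. G (block A V))) (at x)"
    using has_derivative_unique[OF G] by simp
  have LI: "left_inv_deriv X (rst (\<lambda>y. det (minor_mat A y))) x = G (block A (x ** X))" if X: "X \<in> su" for X
  proof -
    have "left_inv_deriv X (rst (\<lambda>y. det (minor_mat A y))) x = frechet_derivative (\<lambda>y. det (minor_mat A y)) (at x) (x ** X)"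
      by (rule left_inv_deriv_local[of _ UNIV]) (auto intro: cpoly_smooth_on_open cpoly_minor X x simp: rst_def)
    then show ?thesis
      using frechet_derivative_at[OF D] by metis
  qed
  have entry: "block A (x ** Z) $ i $ j = block A (x ** skew_part Z) $ i $ j + \<i> * block A (x ** herm_part Z) $ i $ j" for i j
    by (simp add: block_def matrix_matrix_mult_def skew_herm_decompose[of Z] sum.distrib sum_distrib_left algebra_simps)
  have "G (block A (x ** Z)) = G (block A (x ** skew_part Z)) + \<i> * G (block A (x ** herm_part Z))"
    unfolding det_derivative_complex_linear[OF G] entry
    by (simp add: sum.distrib sum_distrib_left distrib_right mult.assoc)
  then show ?thesis
    unfolding cderiv_def LI[OF skew_part_in_su[OF Z]] LI[OF herm_part_in_su[OF Z]] by simp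
qed

definition weight_vector :: "(nat \<Rightarrow> 'n::finite) \<Rightarrow> (nat \<Rightarrow> complex) \<Rightarrow> ('n cmat \<Rightarrow> complex) \<Rightarrow> bool" where
  "weight_vector h w f \<longleftrightarrow> f \<in> pol
     \<and> (\<forall>i j. i < j \<longrightarrow> j < CARD('n) \<longrightarrow> cderiv (tl_unit (h i) (h j)) f = (\<lambda>x. 0))
     \<and> (\<forall>i<CARD('n). cderiv (tl_unit (h i) (h i)) f = (\<lambda>x. w i * f x))"

text \<open>The weight is the k-th fundamental weight. Right multiplication by an elementary matrix
  puts column a into column b. In a leading minor an earlier column than b also belongs to the
  minor, so the derivative vanishes for a before b and reproduces the minor for a = b in
  \<open>A\<close>. The trace part contributes k/n.\<close>

lemma weight_vector_minor:
  fixes h :: "nat \<Rightarrow> 'n::finite"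
  assumes h: "bij_betw h {..<CARD('n)} UNIV" and k: "k \<le> CARD('n)"
  shows "weight_vector h (\<lambda>i. (if i < k then 1 else 0) - of_nat k / of_nat CARD('n)) (rst (\<lambda>x. det (minor_mat (h ` {..<k}) x)))"
proof -
  define A where "A = h ` {..<k}"
  have inj: "h a = h b \<longleftrightarrow> a = b" if "a < CARD('n)" "b < CARD('n)" for a b
    using h that by (auto simp: bij_betw_def inj_on_def)
  have memA: "h i \<in> A \<longleftrightarrow> i < k" if "i < CARD('n)" for i
  proof
    assume "h i \<in> A"
    then obtain j where "j < k" "h i = h j"
      by (auto simp: A_def)
    then show "i < k"
      using inj[OF that, of j] k by simp
  qed (auto simp: A_def)
  have cardA: "card A = k"
    unfolding A_def using h k by (subst card_image) (auto simp: bij_betw_def intro: inj_on_subset)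
  have minor_weight: "cderiv (tl_unit (h i) (h j)) (rst (\<lambda>y. det (minor_mat A y))) x =
      (if i = j then ((if i < k then 1 else 0) - of_nat k / of_nat CARD('n)) * rst (\<lambda>y. det (minor_mat A y)) x else 0)"
    if ij: "i \<le> j" "j < CARD('n)" for i j x
  proof (cases "x \<in> SU")
    case True
    let ?M = "minor_mat A x"
    obtain G where G: "(det has_derivative G) (at ?M)"
      using minor_has_derivative[of A x] by blast
    interpret bounded_linear G
      using G by (rule has_derivative_bounded_linear)
    \<comment> \<open>The condition will hold because \<open>A\<close> consists of the first k
      indices and i <= j. For b in \<open>A\<close> it makes the truncated product a right multiple
      of \<open>minor_mat A x\<close>, so that Jacobi's formula applies.\<close>
    have elem: "G (block A (x ** elem_mat a b 1)) = (if a = b \<and> a \<in> A then det ?M else 0)"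
      if "b \<in> A \<longrightarrow> a \<in> A" for a b
    proof (cases "b \<in> A")
      case b: True
      with that have a: "a \<in> A" by blast
      have "block A (x ** elem_mat a b 1) = ?M ** elem_mat a b 1"
        using a b by (auto simp: vec_eq_iff block_def mult_elem_mat_entry minor_mat_def)
      then have "G (block A (x ** elem_mat a b 1)) = det ?M * trace (elem_mat a b 1 :: 'n cmat)"
        by (simp add: det_derivative_along_mult[OF G])
      moreover have "trace (elem_mat a b 1 :: 'n cmat) = (if a = b then 1 else 0)"
        by (cases "a = b") (auto simp: trace_def intro!: sum.neutral)
      ultimately show ?thesis
        using a by simp
    next
      case False
      then have "block A (x ** elem_mat a b 1) = 0"
        by (auto simp: vec_eq_iff block_def mult_elem_mat_entry)
      then show ?thesis
        using False by (auto simp: zero)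
    qed
    \<comment> \<open>The scalar matrix is the average of the diagonal elementary matrices, of which
      exactly k contribute.\<close>
    have scalar: "G (block A (x ** mat (1 / of_nat CARD('n)))) = of_nat k / of_nat CARD('n) * det ?M"
    proof -
      have "block A (x ** mat (1 / of_nat CARD('n))) = (1 / real CARD('n)) *\<^sub>R (\<Sum>a\<in>UNIV. block A (x ** elem_mat a a 1))"
      proof -
        have "block A (x ** mat (1 / of_nat CARD('n))) $ i $ j = ((1 / real CARD('n)) *\<^sub>R (\<Sum>a\<in>UNIV. block A (x ** elem_mat a a 1))) $ i $ j" for i j
        proof -
          have "(x ** mat (1 / of_nat CARD('n))) $ i $ j = x $ i $ j / of_nat CARD('n)"
            by (simp add: matrix_matrix_mult_def mat_def if_distrib[of "\<lambda>x. _ * x"] cong: if_cong)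
          moreover have "(\<Sum>a\<in>UNIV. block A (x ** elem_mat a a 1) $ i $ j) = (if i \<in> A \<and> j \<in> A then x $ i $ j else 0)"
            by (cases "i \<in> A \<and> j \<in> A") (auto simp: block_def mult_elem_mat_entry)
          ultimately show ?thesis
            by (simp add: block_def scaleR_conv_of_real[where 'a=complex])
        qed
        then show ?thesis
          by (simp add: vec_eq_iff)
      qed
      then have "G (block A (x ** mat (1 / of_nat CARD('n)))) = (1 / real CARD('n)) *\<^sub>R (\<Sum>a\<in>UNIV. if a \<in> A then det ?M else 0)"
        by (simp add: scaleR sum elem)
      also have "(\<Sum>a\<in>UNIV. if a \<in> A then det ?M else 0) = of_nat k * det ?M"
        using cardA by (simp add: sum.If_cases)
      finally show ?thesis
        by (simp add: scaleR_conv_of_real[where 'a=complex])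
    qed
    have lin: "linear (\<lambda>Z. G (block A (x ** Z)))"
    proof (rule linearI)
      have "block A (P + Q) = block A P + block A Q" "block A (r *\<^sub>R P) = r *\<^sub>R block A P" for P Q r
        by (auto simp: block_def vec_eq_iff)
      then show "G (block A (x ** (P + Q))) = G (block A (x ** P)) + G (block A (x ** Q))"
        "G (block A (x ** (r *\<^sub>R P))) = r *\<^sub>R G (block A (x ** P))" for P Q r
        by (simp_all add: matrix_mult.add_right matrix_mult.scaleR_right add scaleR)
    qed
    have "cderiv (tl_unit (h i) (h j)) (rst (\<lambda>y. det (minor_mat A y))) x = G (block A (x ** tl_unit (h i) (h j)))"
      by (rule cderiv_minor[OF G True trace_tl_unit])
    also have "\<dots> = G (block A (x ** elem_mat (h i) (h j) 1)) - G (block A (x ** (if h i = h j then mat (1 / of_nat CARD('n)) else 0)))"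
      unfolding tl_unit_def by (rule linear_diff[OF lin])
    also have "\<dots> = (if i = j then ((if i < k then 1 else 0) - of_nat k / of_nat CARD('n)) * det ?M else 0)"
      using ij memA[of i] memA[of j] inj[of i j] linear_0[OF lin]
      by (auto simp: elem scalar algebra_simps)
    finally show ?thesis
      using True by (simp add: rst_def)
  next
    case False
    have "cderiv (tl_unit (h i) (h j)) (rst (\<lambda>y. det (minor_mat A y))) \<in> smooth_SU"
      by (intro pol_smooth_SU cderiv_pol pol_rst cpoly_minor trace_tl_unit)
    then show ?thesis
      using False by (simp add: smooth_SU_def rst_def)
  qed
  show ?thesis
    unfolding weight_vector_def A_def[symmetric]
    using minor_weight by (auto simp: fun_eq_iff intro: pol_rst cpoly_minor)
qed

text \<open>By the Leibniz rule weights add, and annihilation by raising operators persists.\<close>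

lemma weight_vector_mult:
  assumes "weight_vector h w f" "weight_vector h w' g"
  shows "weight_vector h (\<lambda>i. w i + w' i) (\<lambda>x. f x * g x)"
proof -
  have "f \<in> smooth_SU" "g \<in> smooth_SU"
    using assms by (auto simp: weight_vector_def pol_smooth_SU)
  then show ?thesis
    using assms unfolding weight_vector_def
    by (simp add: cderiv_mult trace_tl_unit pol_mult algebra_simps)
qed

lemma weight_vector_one: "weight_vector h (\<lambda>i. 0) (rst (\<lambda>x. 1))"
proof -
  have "cderiv (tl_unit a b) (rst (\<lambda>x. 1)) = (\<lambda>x. 0)" for a b :: 'a
    by (simp add: cderiv_def left_inv_deriv_rst_const skew_part_in_su herm_part_in_su trace_tl_unit)
  then show ?thesis
    by (simp add: weight_vector_def pol_rst cpoly_const)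
qed

text \<open>The factor \<open>rst (\<lambda>x. 1)\<close> keeps the power with exponent 0 normalised
  to zero off the group.\<close>

lemma weight_vector_power:
  assumes "weight_vector h w f"
  shows "weight_vector h (\<lambda>i. of_nat m * w i) (\<lambda>x. rst (\<lambda>x. 1) x * f x ^ m)"
proof (induction m)
  case 0
  show ?case
    using weight_vector_one[of h] by (simp only: power_0 mult_1_right of_nat_0 mult_zero_left)
next
  case (Suc m)
  then show ?case
    using weight_vector_mult[OF assms Suc] by (simp add: algebra_simps)
qed

lemma exists_weight_vector:
  fixes h :: "nat \<Rightarrow> 'n::finite"
  assumes h: "bij_betw h {..<CARD('n)} UNIV" and "L \<le> CARD('n)"
  shows "\<exists>f. weight_vector h (\<lambda>i. \<Sum>k=1..L. of_nat (m k) * ((if i < k then 1 else 0) - of_nat k / of_nat CARD('n))) f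
    \<and> f (mat 1) = 1"
  using \<open>L \<le> CARD('n)\<close>
proof (induction L)
  case 0
  have "rst (\<lambda>x. 1) (mat 1 :: 'n cmat) = 1"
    by (simp add: rst_def SU_one)
  then show ?case
    using weight_vector_one[of h] by (intro exI[of _ "rst (\<lambda>x. 1)"]) simp
next
  case (Suc L)
  then obtain f where f: "weight_vector h (\<lambda>i. \<Sum>k=1..L. of_nat (m k) * ((if i < k then 1 else 0) - of_nat k / of_nat CARD('n))) f"
    "f (mat 1) = 1"
    by auto
  let ?d = "rst (\<lambda>x. det (minor_mat (h ` {..<Suc L}) x))"
  have "minor_mat (h ` {..<Suc L}) (mat 1) = mat 1"
    by (auto simp: minor_mat_def mat_def vec_eq_iff)
  then have "?d (mat 1) = 1"
    by (simp add: rst_def SU_one)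
  then show ?case
    using weight_vector_mult[OF f(1) weight_vector_power[OF weight_vector_minor[OF h Suc.prems], of "m (Suc L)"]] f(2)
    by (intro exI[of _ "\<lambda>x. f x * (rst (\<lambda>x. 1) x * ?d x ^ m (Suc L))"]) (simp add: rst_def SU_one)
qed

lemma eigval_in_Spec:
  fixes l :: nat and \<gamma> :: real
  assumes l: "l \<ge> 1" and card: "CARD('n::finite) = l + 1" and \<gamma>: "\<gamma> > 0"
    and \<nu>: "\<nu> \<in> {1..l} \<rightarrow>\<^sub>E {1..}"
  shows "complex_of_real (eigval l \<gamma> \<nu>) \<in> Spec (SU :: 'n cmat set) (\<lambda>X Y. - \<gamma> * killing SU X Y)"
proof -
  obtain h :: "nat \<Rightarrow> 'n" where h: "bij_betw h {..<CARD('n)} UNIV"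
    using ex_bij_betw_nat_finite[of "UNIV :: 'n set"] by (auto simp: atLeast0LessThan)
  \<comment> \<open>The exponents are \<open>\<nu> k - 1\<close> because \<nu> describes the weight
    shifted by half the sum of the positive roots.\<close>
  define w :: "nat \<Rightarrow> complex" where
    "w i = (\<Sum>k=1..l. of_nat (\<nu> k - 1) * ((if i < k then 1 else 0) - of_nat k / of_nat CARD('n)))" for i
  have "\<exists>v. weight_vector h w v \<and> v (mat 1) = 1"
    unfolding w_def by (rule exists_weight_vector[OF h]) (simp add: card)
  then obtain v where v: "weight_vector h w v" "v (mat 1) = 1" by blast
  then have vpol: "v \<in> pol"
    by (simp add: weight_vector_def)
  then obtain B where B: "finite B" "B \<subseteq> pol" "v \<in> fn.span B" "derivation_invariant (fn.span B)"
    using pol_locally_finite by blast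
  interpret gl_module fscale "fn.span B" "CARD('n)" "\<lambda>i j. cderiv (tl_unit (h i) (h j))"
    by (rule gl_module_pol[OF h fn.subspace_span span_pol[OF B(2)] B(4)])
  define c where "c = (\<Sum>i<CARD('n). (w i)\<^sup>2) + (\<Sum>i<CARD('n). \<Sum>j\<in>{i<..<CARD('n)}. w i - w j)"
  have "casimir v = fscale c v"
    unfolding c_def
  proof (rule casimir_highest_weight[OF B(3)])
    show "cderiv (tl_unit (h i) (h j)) v = 0" if "i < j" "j < CARD('n)" for i j
      using v(1) that by (auto simp: weight_vector_def zero_fun_def)
    show "cderiv (tl_unit (h i) (h i)) v = fscale (w i) v" if "i < CARD('n)" for i
      using v(1) that by (auto simp: weight_vector_def fscale_def)
  qed
  then have "SU_laplacian \<gamma> v = fscale (of_real (1 / (2 * real CARD('n) * \<gamma>))) (fscale c v)"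
    using laplacian_eq_casimir[OF \<gamma> h fn.subspace_span span_pol[OF B(2)] B(4) B(3)] by simp
  moreover have "of_real (eigval l \<gamma> \<nu>) = of_real (1 / (2 * (real l + 1) * \<gamma>)) * c"
    unfolding c_def card
  proof (rule eigval_of_weight[OF l \<gamma>])
    fix i assume i: "i < l"
    have "w i - w (Suc i) = (\<Sum>k=1..l. if k = Suc i then of_nat (\<nu> k - 1) else 0)"
      unfolding w_def sum_subtractf[symmetric] by (intro sum.cong refl) (auto simp: algebra_simps)
    also have "\<dots> = of_nat (\<nu> (Suc i) - 1)"
      using i by simp
    also have "\<dots> = of_nat (\<nu> (Suc i)) - 1"
      using PiE_mem[OF \<nu>, of "Suc i"] i by (simp add: of_nat_diff)
    finally show "w i - w (Suc i) = of_nat (\<nu> (Suc i)) - 1" .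
  next
    have "(\<Sum>i<CARD('n). w i) = (\<Sum>k=1..l. \<Sum>i<CARD('n). of_nat (\<nu> k - 1) * ((if i < k then 1 else 0) - of_nat k / of_nat CARD('n)))"
      unfolding w_def by (rule sum.swap)
    also have "\<dots> = (\<Sum>k=1..l. of_nat (\<nu> k - 1) * (\<Sum>i<CARD('n). (if i < k then 1 else 0) - of_nat k / of_nat CARD('n)))"
      by (simp only: sum_distrib_left)
    also have "\<dots> = 0"
    proof (rule sum.neutral, rule ballI)
      fix k assume "k \<in> {1..l}"
      then have "{..<CARD('n)} \<inter> {i. i < k} = {..<k}"
        using card by auto
      then have "(\<Sum>i<CARD('n). if i < k then 1 else (0::complex)) = of_nat k"
        by (simp add: sum.If_cases)
      then show "of_nat (\<nu> k - 1) * (\<Sum>i<CARD('n). (if i < k then 1 else 0) - of_nat k / of_nat CARD('n)) = (0::complex)"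
        by (simp add: sum_subtractf)
    qed
    finally show "(\<Sum>i<l + 1. w i) = 0"
      by (simp only: card)
  qed
  moreover have "real CARD('n) = real l + 1"
    by (simp add: card)
  ultimately have "SU_laplacian \<gamma> v x = of_real (eigval l \<gamma> \<nu>) * v x" for x
    by (simp add: fscale_apply)
  moreover have "smooth_on v SU"
    using pol_smooth_SU[OF vpol] by (simp add: smooth_SU_def)
  ultimately show ?thesis
    unfolding Spec_def using v(2) SU_one by (auto intro!: exI[of _ v] bexI[of _ "mat 1"])
qed

section \<open>Completeness of the polynomial functions\<close>

lemma norm_SU_mult:
  fixes B A :: "'n::finite cmat"
  assumes "B \<in> SU"
  shows "norm (B ** A) = norm A"
proof -
  have "trace (B ** A ** ctranspose (B ** A)) = trace (ctranspose (B ** A) ** (B ** A))"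
    by (rule trace_mul_sym)
  also have "ctranspose (B ** A) ** (B ** A) = ctranspose A ** (ctranspose B ** B) ** A"
    by (simp add: ctranspose_mult matrix_mul_assoc)
  also have "trace \<dots> = trace (A ** ctranspose A)"
    using SU_ctranspose_mult[OF assms] trace_mul_sym[of "ctranspose A" A] by simp
  finally show ?thesis
    by (simp add: norm_eq_sqrt_inner inner_cmat)
qed

text \<open>Right translations are taken because the flow of a left-invariant field is right
  multiplication.\<close>

interpretation SU: homogeneous_compact "SU :: 'n::finite cmat set" "(\<lambda>u x. x ** u) ` SU"
proof
  show "compact (SU :: 'n cmat set)" by (rule compact_SU)
  show "(SU :: 'n cmat set) \<noteq> {}"
    using SU_one by blast
next
  fix g :: "'n cmat \<Rightarrow> 'n cmat" assume "g \<in> (\<lambda>u x. x ** u) ` SU"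
  then obtain u where u: "u \<in> SU" "g = (\<lambda>x. x ** u)" by auto
  have "x \<in> g ` SU" if "x \<in> SU" for x
  proof (rule image_eqI)
    show "x ** ctranspose u \<in> SU"
      using that u by (intro SU_mult SU_ctranspose)
    show "x = g (x ** ctranspose u)"
      using u SU_ctranspose_mult[of u] by (simp add: matrix_mul_assoc[symmetric])
  qed
  then show "g ` SU = SU"
    using u SU_mult by blast
  show "dist (g x) (g y) = dist x y" for x y
    using u norm_mult_SU[of u "x - y"] by (simp add: dist_norm matrix_mult.diff_left)
next
  fix x y :: "'n cmat" assume xy: "x \<in> SU" "y \<in> SU"
  then have "ctranspose x ** y \<in> SU"
    by (intro SU_mult SU_ctranspose)
  moreover have "x ** (ctranspose x ** y) = y"
    using xy by (simp add: matrix_mul_assoc SU_def)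
  ultimately show "\<exists>g\<in>(\<lambda>u x. x ** u) ` SU. g x = y"
    by (intro bexI[of _ "\<lambda>z. z ** (ctranspose x ** y)"] imageI)
qed

text \<open>For a fixed small time t the difference quotient of \<open>h\<close> along the flow is
  uniformly close to \<open>d\<close>, and its mean tends to zero by invariance. So t is fixed
  before k grows.\<close>

lemma mean_derivative_tendsto_zero:
  fixes h d :: "'n::finite cmat \<Rightarrow> complex"
  assumes h: "continuous_on SU h" and d: "continuous_on SU d" and X: "X \<in> su"
    and deriv: "\<And>x t. x \<in> SU \<Longrightarrow>
      ((\<lambda>s. h (x ** mexp (s *\<^sub>R X))) has_vector_derivative d (x ** mexp (t *\<^sub>R X))) (at t)"
  shows "(\<lambda>k. SU.mean k d) \<longlonglongrightarrow> 0"
proof (rule LIMSEQ_I)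
  fix c :: real assume c: "c > 0"
  from c have c2: "c / 2 > 0" by simp
  obtain \<delta> where \<delta>: "\<delta> > 0" "\<And>x y. x \<in> SU \<Longrightarrow> y \<in> SU \<Longrightarrow> dist y x < \<delta> \<Longrightarrow> dist (d y) (d x) < c / 2"
    using compact_uniformly_continuous[OF d compact_SU, unfolded uniformly_continuous_on_def, rule_format, OF c2]
    by blast
  have "continuous (at 0) (\<lambda>t. mexp (t *\<^sub>R X))"
    by (rule has_vector_derivative_continuous[OF mexp_has_vector_derivative])
  then obtain \<epsilon> where \<epsilon>: "\<epsilon> > 0" "\<And>s. \<bar>s\<bar> < \<epsilon> \<Longrightarrow> dist (mexp (s *\<^sub>R X)) (mexp (0 *\<^sub>R X)) < \<delta>"
    using continuous_at_eps_delta[THEN iffD1, rule_format, OF _ \<delta>(1), of 0 "\<lambda>t. mexp (t *\<^sub>R X)"] by auto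
  define t where "t = \<epsilon> / 2"
  have t: "t > 0" "t < \<epsilon>"
    using \<epsilon>(1) by (auto simp: t_def)
  have step: "norm (d x - (h (x ** mexp (t *\<^sub>R X)) - h x) / t) \<le> c / 2" if x: "x \<in> SU" for x
  proof -
    \<comment> \<open>Subtracting a linear function leaves a derivative that is small near 0, so the
      mean value inequality bounds the error of the difference quotient.\<close>
    define f where "f s = h (x ** mexp (s *\<^sub>R X)) - s *\<^sub>R d x" for s
    have f: "(f has_derivative (\<lambda>r. r *\<^sub>R (d (x ** mexp (s *\<^sub>R X)) - d x))) (at s)" for s
    proof -
      have "(f has_vector_derivative d (x ** mexp (s *\<^sub>R X)) - d x) (at s)"
        unfolding f_def by (rule has_vector_derivative_diff[OF deriv[OF x]]) (auto intro!: derivative_eq_intros)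
      then show ?thesis
        by (simp add: has_vector_derivative_def)
    qed
    have "continuous_on {0..t} f"
      by (intro continuous_at_imp_continuous_on ballI has_derivative_continuous[OF f])
    then obtain s where s: "s \<in> {0<..<t}" "norm (f t - f 0) \<le> norm ((t - 0) *\<^sub>R (d (x ** mexp (s *\<^sub>R X)) - d x))"
      using mvt_general[OF t(1) _ f] by blast
    have "dist (x ** mexp (s *\<^sub>R X)) x = norm (x ** (mexp (s *\<^sub>R X) - mexp (0 *\<^sub>R X)))"
      by (simp add: dist_norm matrix_mult.diff_right mexp_zero)
    also have "\<dots> < \<delta>"
      using \<epsilon>(2)[of s] s(1) t by (simp add: norm_SU_mult[OF x] dist_norm)
    finally have "norm (d (x ** mexp (s *\<^sub>R X)) - d x) < c / 2"
      using \<delta>(2)[OF x, of "x ** mexp (s *\<^sub>R X)"] x X by (simp add: curve_in_SU dist_norm)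
    then have "norm (f t - f 0) \<le> t * (c / 2)"
      using s(2) t(1) by (smt (verit) mult_left_mono norm_scaleR)
    moreover have "f t - f 0 = - (of_real t * (d x - (h (x ** mexp (t *\<^sub>R X)) - h x) / t))"
      using t(1) by (simp add: f_def mexp_zero scaleR_conv_of_real[where 'a=complex] field_simps)
    ultimately have "t * norm (d x - (h (x ** mexp (t *\<^sub>R X)) - h x) / t) \<le> t * (c / 2)"
      using t(1) by (simp add: norm_mult)
    then show ?thesis
      using t(1) by simp
  qed
  have "(\<lambda>k. SU.mean k (h \<circ> (\<lambda>x. x ** mexp (t *\<^sub>R X))) - SU.mean k h) \<longlonglongrightarrow> 0"
    using mexp_in_SU[OF X] by (intro SU.mean_invariant[OF h]) auto
  then obtain k0 where k0: "\<And>k. k \<ge> k0 \<Longrightarrow> norm (SU.mean k (h \<circ> (\<lambda>x. x ** mexp (t *\<^sub>R X))) - SU.mean k h) < t * (c / 2)"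
    using LIMSEQ_D[of _ 0 "t * (c / 2)"] t c by force
  have "norm (SU.mean k d) < c" if k: "k \<ge> k0" for k
  proof -
    let ?q = "\<lambda>x. inverse (of_real t) * (h (x ** mexp (t *\<^sub>R X)) - h x)"
    have "norm (SU.mean k (\<lambda>x. d x - ?q x)) \<le> c / 2"
      by (rule SU.mean_norm_le) (use step in \<open>simp add: field_simps\<close>)
    moreover have q: "SU.mean k ?q = inverse (of_real t) * (SU.mean k (h \<circ> (\<lambda>x. x ** mexp (t *\<^sub>R X))) - SU.mean k h)"
      by (simp only: SU.mean_cmult SU.mean_diff comp_def)
    have "norm (SU.mean k ?q) < c / 2"
      unfolding q norm_mult using k0[OF k] t(1) by (simp add: norm_inverse norm_divide field_simps)
    moreover have "SU.mean k d = SU.mean k (\<lambda>x. d x - ?q x) + SU.mean k ?q"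
      by (simp only: SU.mean_diff) simp
    ultimately show ?thesis
      by (smt (verit) norm_triangle_ineq field_sum_of_halves)
  qed
  then show "\<exists>k0. \<forall>k\<ge>k0. norm (SU.mean k d - 0) < c"
    by auto
qed

lemma mean_by_parts:
  fixes f p :: "'n::finite cmat \<Rightarrow> complex"
  assumes f: "f \<in> smooth_SU" and p: "p \<in> smooth_SU" and X: "X \<in> su"
  shows "(\<lambda>k. SU.mean k (\<lambda>x. f x * left_inv_deriv X p x) + SU.mean k (\<lambda>x. left_inv_deriv X f x * p x)) \<longlonglongrightarrow> 0"
proof -
  have "(\<lambda>k. SU.mean k (\<lambda>x. f x * left_inv_deriv X p x + left_inv_deriv X f x * p x)) \<longlonglongrightarrow> 0"
  proof (rule mean_derivative_tendsto_zero[OF _ _ X])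
    show "continuous_on SU (\<lambda>x. f x * p x)"
      by (intro continuous_on_mult smooth_SU_continuous_on f p)
    show "continuous_on SU (\<lambda>x. f x * left_inv_deriv X p x + left_inv_deriv X f x * p x)"
      by (intro continuous_on_add continuous_on_mult smooth_SU_continuous_on left_inv_deriv_smooth_SU f p X)
    show "((\<lambda>s. f (x ** mexp (s *\<^sub>R X)) * p (x ** mexp (s *\<^sub>R X))) has_vector_derivative
        f (x ** mexp (t *\<^sub>R X)) * left_inv_deriv X p (x ** mexp (t *\<^sub>R X))
        + left_inv_deriv X f (x ** mexp (t *\<^sub>R X)) * p (x ** mexp (t *\<^sub>R X))) (at t)" for x t
      by (intro has_vector_derivative_mult smooth_SU_has_vector_derivative f p X)
  qed
  then show ?thesis
    by (simp only: SU.mean_add)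
qed

text \<open>Integration by parts is used twice; the term with one derivative on each factor cancels
  in the difference.\<close>

lemma mean_symmetric:
  fixes f p :: "'n::finite cmat \<Rightarrow> complex"
  assumes f: "f \<in> smooth_SU" and p: "p \<in> smooth_SU" and X: "X \<in> su"
  shows "(\<lambda>k. SU.mean k (\<lambda>x. f x * left_inv_deriv X (left_inv_deriv X p) x)
    - SU.mean k (\<lambda>x. left_inv_deriv X (left_inv_deriv X f) x * p x)) \<longlonglongrightarrow> 0"
  using tendsto_diff[OF mean_by_parts[OF f left_inv_deriv_smooth_SU[OF p X] X]
      mean_by_parts[OF left_inv_deriv_smooth_SU[OF f X] p X]]
  by simp

text \<open>The pairing is bilinear, without conjugation, so an eigenfunction \<open>f\<close>
  yields functionals with the eigenvalue itself and not its conjugate.\<close>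

lemma mean_laplacian_symmetric:
  fixes f p :: "'n::finite cmat \<Rightarrow> complex"
  assumes \<gamma>: "\<gamma> > 0" and f: "f \<in> smooth_SU" and p: "p \<in> smooth_SU"
  shows "(\<lambda>k. SU.mean k (\<lambda>x. f x * SU_laplacian \<gamma> p x)
    - SU.mean k (\<lambda>x. SU_laplacian \<gamma> f x * p x)) \<longlonglongrightarrow> 0"
proof -
  obtain B :: "'n cmat set" where B: "finite B" "B \<subseteq> su"
    and lap: "\<And>f x. SU_laplacian \<gamma> f x = - (\<Sum>X\<in>B. left_inv_deriv X (left_inv_deriv X f) x)"
    by (rule laplacian_eq_sum[OF \<gamma> refl, where 'n='n]) (rule that)
  have "(\<lambda>k. \<Sum>X\<in>B. SU.mean k (\<lambda>x. f x * left_inv_deriv X (left_inv_deriv X p) x)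
    - SU.mean k (\<lambda>x. left_inv_deriv X (left_inv_deriv X f) x * p x)) \<longlonglongrightarrow> 0"
    by (rule tendsto_null_sum, rule mean_symmetric[OF f p]) (use B in auto)
  then have "(\<lambda>k. SU.mean k (\<lambda>x. f x * (\<Sum>X\<in>B. left_inv_deriv X (left_inv_deriv X p) x))
    - SU.mean k (\<lambda>x. (\<Sum>X\<in>B. left_inv_deriv X (left_inv_deriv X f) x) * p x)) \<longlonglongrightarrow> 0"
    by (simp only: sum_distrib_left sum_distrib_right SU.mean_sum sum_subtractf)
  from tendsto_minus[OF this]
  have "(\<lambda>k. (- 1) * SU.mean k (\<lambda>x. f x * (\<Sum>X\<in>B. left_inv_deriv X (left_inv_deriv X p) x))
    - (- 1) * SU.mean k (\<lambda>x. (\<Sum>X\<in>B. left_inv_deriv X (left_inv_deriv X f) x) * p x)) \<longlonglongrightarrow> 0"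
    by simp
  then show ?thesis
    unfolding lap SU.mean_cmult[symmetric] by simp
qed

section \<open>Polynomial approximation and reduction to finite dimension\<close>

lemma cpoly_approximation:
  fixes f :: "'n::finite cmat \<Rightarrow> complex"
  assumes f: "continuous_on SU f" and "e > 0"
  obtains p where "cpoly p" "\<And>x. x \<in> SU \<Longrightarrow> norm (f x - p x) < e"
proof -
  have real: "cpoly (\<lambda>x. complex_of_real (r x))" if "real_polynomial_function r" for r :: "'n cmat \<Rightarrow> real"
    using that
  proof (induction rule: real_polynomial_function.induct)
    case (linear f)
    then show ?case
      by (intro cpoly_linear bounded_linear_compose[OF bounded_linear_of_real])
  qed (auto intro: cpoly_const cpoly_add cpoly_mult)
  obtain a where a: "real_polynomial_function a" "\<And>x. x \<in> SU \<Longrightarrow> \<bar>Re (f x) - a x\<bar> < e / 2"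
    using Stone_Weierstrass_real_polynomial_function[OF compact_SU, of "\<lambda>x. Re (f x)" "e / 2"]
      continuous_on_Re[OF f] \<open>e > 0\<close> by auto
  obtain b where b: "real_polynomial_function b" "\<And>x. x \<in> SU \<Longrightarrow> \<bar>Im (f x) - b x\<bar> < e / 2"
    using Stone_Weierstrass_real_polynomial_function[OF compact_SU, of "\<lambda>x. Im (f x)" "e / 2"]
      continuous_on_Im[OF f] \<open>e > 0\<close> by auto
  show ?thesis
  proof (rule that[of "\<lambda>x. of_real (a x) + \<i> * of_real (b x)"])
    show "cpoly (\<lambda>x. of_real (a x) + \<i> * of_real (b x))"
      by (intro cpoly_add cpoly_mult cpoly_const real a(1) b(1))
    fix x :: "'n cmat" assume x: "x \<in> SU"
    have "norm (f x - (of_real (a x) + \<i> * of_real (b x))) \<le> \<bar>Re (f x) - a x\<bar> + \<bar>Im (f x) - b x\<bar>"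
      using cmod_le[of "f x - (of_real (a x) + \<i> * of_real (b x))"] by simp
    then show "norm (f x - (of_real (a x) + \<i> * of_real (b x))) < e"
      using a(2)[OF x] b(2)[OF x] by linarith
  qed
qed

text \<open>The conjugate of \<open>f\<close> is approximated uniformly by polynomials. If all
  pairings with polynomials tended to zero, so would the means of |f|^2, against
  \<open>SU.mean_faithful\<close>.\<close>

lemma exists_pol_pairing:
  fixes f :: "'n::finite cmat \<Rightarrow> complex"
  assumes f: "continuous_on SU f" and x0: "x0 \<in> SU" "f x0 \<noteq> 0"
  shows "\<exists>p\<in>pol. \<not> (\<lambda>k. SU.mean k (\<lambda>x. f x * p x)) \<longlonglongrightarrow> 0"
proof (rule ccontr)
  assume "\<not> ?thesis"
  then have lim: "(\<lambda>k. SU.mean k (\<lambda>x. f x * p x)) \<longlonglongrightarrow> 0" if "p \<in> pol" for p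
    using that by blast
  obtain M where M: "M > 0" "\<And>x. x \<in> SU \<Longrightarrow> norm (f x) \<le> M"
    using compact_imp_bounded[OF compact_continuous_image[OF f compact_SU]] by (auto simp: bounded_pos)
  have "(\<lambda>k. SU.mean k (\<lambda>x. complex_of_real ((cmod (f x))\<^sup>2))) \<longlonglongrightarrow> 0"
  proof (rule LIMSEQ_I)
    fix c :: real assume c: "c > 0"
    have "continuous_on SU (\<lambda>x. cnj (f x))"
      by (intro continuous_on_cnj f)
    then obtain p where p: "cpoly p" "\<And>x. x \<in> SU \<Longrightarrow> norm (cnj (f x) - p x) < c / (2 * M)"
      using cpoly_approximation[of "\<lambda>x. cnj (f x)" "c / (2 * M)"] c M(1) by auto
    obtain k0 where k0: "\<And>k. k \<ge> k0 \<Longrightarrow> norm (SU.mean k (\<lambda>x. f x * rst p x)) < c / 2"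
      using LIMSEQ_D[OF lim[OF pol_rst[OF p(1)]], of "c / 2"] c by auto
    have "norm (SU.mean k (\<lambda>x. complex_of_real ((cmod (f x))\<^sup>2))) < c" if k: "k \<ge> k0" for k
    proof -
      have "norm (SU.mean k (\<lambda>x. f x * (cnj (f x) - rst p x))) \<le> c / 2"
      proof (rule SU.mean_norm_le)
        fix x :: "'n cmat" assume x: "x \<in> SU"
        have "norm (f x * (cnj (f x) - rst p x)) \<le> M * (c / (2 * M))"
          unfolding norm_mult using M(2)[OF x] p(2)[OF x] x M(1)
          by (intro mult_mono) (auto simp: rst_def less_imp_le)
        then show "norm (f x * (cnj (f x) - rst p x)) \<le> c / 2"
          using M(1) by simp
      qed
      moreover have "SU.mean k (\<lambda>x. complex_of_real ((cmod (f x))\<^sup>2)) =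
          SU.mean k (\<lambda>x. f x * (cnj (f x) - rst p x)) + SU.mean k (\<lambda>x. f x * rst p x)"
      proof -
        have "complex_of_real ((cmod (f x))\<^sup>2) = f x * (cnj (f x) - rst p x) + f x * rst p x" for x
          by (simp add: algebra_simps complex_norm_square[symmetric] flip: of_real_power)
        then show ?thesis
          by (simp only: SU.mean_add)
      qed
      ultimately show ?thesis
        using k0[OF k] norm_triangle_ineq[of "SU.mean k (\<lambda>x. f x * (cnj (f x) - rst p x))" "SU.mean k (\<lambda>x. f x * rst p x)"]
        by simp
    qed
    then show "\<exists>k0. \<forall>k\<ge>k0. norm (SU.mean k (\<lambda>x. complex_of_real ((cmod (f x))\<^sup>2)) - 0) < c"
      by auto
  qed
  moreover have "\<not> (\<lambda>k. SU.mean k (\<lambda>x. complex_of_real ((cmod (f x))\<^sup>2))) \<longlonglongrightarrow> 0"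
    by (rule SU.mean_faithful[OF _ _ x0(1)]) (use x0 in \<open>auto intro!: continuous_intros f\<close>)
  ultimately show False by blast
qed

text \<open>The spectrum concerns values on the group only, so this allows an eigenfunction to be
  replaced by its normalised form.\<close>

lemma laplacian_rst:
  fixes f :: "'n::finite cmat \<Rightarrow> complex"
  assumes \<gamma>: "\<gamma> > 0" and x: "x \<in> SU"
  shows "SU_laplacian \<gamma> (rst f) x = SU_laplacian \<gamma> f x"
proof -
  obtain B :: "'n cmat set" where B: "finite B" "B \<subseteq> su"
    and lap: "\<And>f x. SU_laplacian \<gamma> f x = - (\<Sum>X\<in>B. left_inv_deriv X (left_inv_deriv X f) x)"
    by (rule laplacian_eq_sum[OF \<gamma> refl, where 'n='n]) (rule that)
  have LI: "left_inv_deriv X (rst f) = rst (left_inv_deriv X f)" if "X \<in> su" for X and f :: "'n cmat \<Rightarrow> complex"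
  proof
    fix x
    show "left_inv_deriv X (rst f) x = rst (left_inv_deriv X f) x"
      using that by (cases "x \<in> SU") (simp_all add: left_inv_deriv_def rst_def curve_in_SU)
  qed
  show ?thesis
    unfolding lap using B x by (auto simp: LI subset_iff rst_def intro!: sum.cong)
qed

lemma Spec_eigval:
  fixes l :: nat and \<gamma> :: real
  assumes l: "l \<ge> 1" and card: "CARD('n::finite) = l + 1" and \<gamma>: "\<gamma> > 0"
    and \<mu>: "\<mu> \<in> Spec (SU :: 'n cmat set) (\<lambda>X Y. - \<gamma> * killing SU X Y)"
  shows "\<exists>\<nu>\<in>{1..l} \<rightarrow>\<^sub>E {1..}. \<mu> = complex_of_real (eigval l \<gamma> \<nu>)"
proof -
  let ?L = "SU_laplacian \<gamma> :: ('n cmat \<Rightarrow> complex) \<Rightarrow> _"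
  obtain f :: "'n cmat \<Rightarrow> complex" and x0 where f: "smooth_on f SU" "x0 \<in> SU" "f x0 \<noteq> 0"
    "\<And>x. x \<in> SU \<Longrightarrow> ?L f x = \<mu> * f x"
    using \<mu> unfolding Spec_def by blast
  define F where "F = rst f"
  have F: "F \<in> smooth_SU" "F x0 \<noteq> 0"
    using f(1-3) rst_smooth_SU[OF f(1)] by (simp_all add: F_def) (simp add: rst_def)
  have LF: "?L F x = \<mu> * F x" if "x \<in> SU" for x
    using laplacian_rst[OF \<gamma> that, of f] f(4)[OF that] that by (simp only: F_def rst_def if_True)
  obtain p where p: "p \<in> pol" "\<not> (\<lambda>k. SU.mean k (\<lambda>x. F x * p x)) \<longlonglongrightarrow> 0"
    using exists_pol_pairing[OF smooth_SU_continuous_on[OF F(1)] f(2) F(2)] by blast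
  obtain B where B: "finite B" "B \<subseteq> pol" "p \<in> fn.span B" "derivation_invariant (fn.span B)"
    using pol_locally_finite[OF p(1)] by blast
  obtain h :: "nat \<Rightarrow> 'n" where h: "bij_betw h {..<CARD('n)} UNIV"
    using ex_bij_betw_nat_finite[of "UNIV :: 'n set"] by (auto simp: atLeast0LessThan)
  interpret gl_module fscale "fn.span B" "CARD('n)" "\<lambda>i j. cderiv (tl_unit (h i) (h j))"
    by (rule gl_module_pol[OF h fn.subspace_span span_pol[OF B(2)] B(4)])
  let ?c = "complex_of_real (1 / (2 * real CARD('n) * \<gamma>))"
  have L: "?L v = fscale ?c (casimir v)" if "v \<in> fn.span B" for v
    by (rule laplacian_eq_casimir[OF \<gamma> h fn.subspace_span span_pol[OF B(2)] B(4) that])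
  have L_op: "fn.operator_on (fn.span B) ?L"
  proof (rule fn.operator_onI)
    show "?L v \<in> fn.span B" if "v \<in> fn.span B" for v
      unfolding L[OF that] by (intro fn.span_scale fn.operator_onD(1)[OF operator_casimir that])
    show "?L (v + w) = ?L v + ?L w" if "v \<in> fn.span B" "w \<in> fn.span B" for v w
      unfolding L[OF that(1)] L[OF that(2)] L[OF fn.span_add[OF that]] fn.operator_onD(2)[OF operator_casimir that]
      by (rule fn.scale_right_distrib)
    show "?L (fscale a v) = fscale a (?L v)" if "v \<in> fn.span B" for a v
      unfolding L[OF that] L[OF fn.span_scale[OF that]] fn.operator_onD(3)[OF operator_casimir that]
      by (rule fn.scale_left_commute)
  qed
  have "\<exists>w\<in>fn.span B. w \<noteq> 0 \<and> ?L w = fscale \<mu> w"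
  proof (rule fn.eigenvalue_of_asymptotic_functional[OF fn.subspace_span L_op B(1) order_refl B(3)])
    show "SU.mean k (\<lambda>x. F x * (v + w) x) = SU.mean k (\<lambda>x. F x * v x) + SU.mean k (\<lambda>x. F x * w x)" for v w k
      by (simp add: SU.mean_add[symmetric] distrib_left)
    show "SU.mean k (\<lambda>x. F x * fscale a v x) = a * SU.mean k (\<lambda>x. F x * v x)" for a v k
      by (simp add: SU.mean_cmult[symmetric] fscale_apply mult.left_commute)
    show "\<not> (\<lambda>k. SU.mean k (\<lambda>x. F x * p x)) \<longlonglongrightarrow> 0" by (rule p(2))
  next
    fix v assume "v \<in> fn.span B"
    then have "v \<in> smooth_SU"
      using span_pol[OF B(2)] pol_smooth_SU by blast
    moreover have "SU.mean k (\<lambda>x. ?L F x * v x) = \<mu> * SU.mean k (\<lambda>x. F x * v x)" for k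
      unfolding SU.mean_cmult[symmetric] by (rule SU.mean_cong) (simp only: LF mult.assoc)
    ultimately show "(\<lambda>k. SU.mean k (\<lambda>x. F x * ?L v x) - \<mu> * SU.mean k (\<lambda>x. F x * v x)) \<longlonglongrightarrow> 0"
      using mean_laplacian_symmetric[OF \<gamma> F(1), of v] by (simp only:)
  qed
  then obtain w where w: "w \<in> fn.span B" "w \<noteq> 0" "?L w = fscale \<mu> w" by blast
  have c: "?c \<noteq> 0"
    using \<gamma> by simp
  have "casimir w = fscale (1 / ?c) (fscale ?c (casimir w))"
    using c by (simp add: fn.scale_scale)
  also have "\<dots> = fscale (\<mu> / ?c) w"
    using w(3) unfolding L[OF w(1)] by (simp add: fn.scale_scale)
  finally obtain a m where a: "\<And>i. Suc i < CARD('n) \<Longrightarrow> a i - a (Suc i) = of_nat (m i)" "(\<Sum>i<CARD('n). a i) = 0"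
    "\<mu> / ?c = (\<Sum>i<CARD('n). (a i)\<^sup>2) + (\<Sum>i<CARD('n). \<Sum>j\<in>{i<..<CARD('n)}. a i - a j)"
    using casimir_eigenvalue[OF B(1) order_refl w(1,2)] by blast
  \<comment> \<open>Weight differences are indexed from 0 and may vanish, while \<nu> is indexed
    from 1 and positive; hence both shifts. \<open>restrict\<close> puts the tuple into the
    extensional function space.\<close>
  define \<nu> where "\<nu> = restrict (\<lambda>j. m (j - 1) + 1) {1..l}"
  have "complex_of_real (eigval l \<gamma> \<nu>) = of_real (1 / (2 * (real l + 1) * \<gamma>)) *
    ((\<Sum>i<l + 1. (a i)\<^sup>2) + (\<Sum>i<l + 1. \<Sum>j\<in>{i<..<l + 1}. a i - a j))"
    by (rule eigval_of_weight[OF l \<gamma>]) (use a(1,2) card in \<open>auto simp: \<nu>_def\<close>)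
  also have "\<dots> = ?c * (\<mu> / ?c)"
    unfolding a(3) by (simp only: card of_nat_add of_nat_1)
  also have "\<dots> = \<mu>"
    using c by simp
  finally show ?thesis
    by (intro bexI[of _ \<nu>]) (auto simp: \<nu>_def)
qed

theorem theorem2p5:
  fixes l :: nat and \<gamma> :: real
  assumes "l \<ge> 1" and "CARD('n::finite) = l + 1" and "\<gamma> > 0"
  shows "Spec (SU :: ('n cmat) set) (\<lambda>X Y. - \<gamma> * killing SU X Y) =
         {complex_of_real (eigval l \<gamma> \<nu>) | \<nu>. \<nu> \<in> {1..l} \<rightarrow>\<^sub>E {1..}}"
  using eigval_in_Spec[OF assms] Spec_eigval[OF assms] by auto

end
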